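(* Let $\Gamma$ be a cuspidal tree lattice acting on the uniform tree $Y$, let $X=\Gamma\backslash Y$, and let $T$ be the operator on $S(\mathrm{OE}(X))=\bigoplus_{e\in \mathrm{OE}(X)}\mathbb C e$ given by $Te=\sum_{e':\,o(e')=t(e)}w(e,e')e'$. For $|u|$ small enough, the operator $1-uT$ is of strong determinant class and one has $$Z(u)^{-1}=\det(1-uT).$$ This is a rational function of $u$.
   Context: Graphs: an oriented edge $e$ has origin $o(e)$, terminus $t(e)$ and reverse $e^{-1}$; $\mathrm{OE}(X)$ is the set of oriented edges of $X$. A path is a sequence $(e_1,\dots,e_n)$ of oriented edges with $t(e_j)=o(e_{j+1})$ for $1\le j\le n-1$; it is reduced if $e_{j+1}\ne e_j^{-1}$ for all $1\le j\le n-1$. Tree lattices: a tree lattice is a group $\Gamma$ with an action on a locally finite tree $Y$ such that all edge stabilizers $\Gamma_e$ are finite and $\sum_{e \bmod \Gamma} 1/|\Gamma_e|<\infty$. Throughout, $Y$ is uniform, i.e. $G\backslash Y$ is finite where $G=\mathrm{Aut}(Y)$, and $\Gamma$ acts orientation preservingly, so that the oriented edges of $X=\Gamma\backslash Y$ are the $\Gamma$-orbits of oriented edges of $Y$. Cusps: a ray in $Y$ is an infinite reduced path; two rays $r,s$ are equivalent if there are $N\in\mathbb N$, $k\in\mathbb Z$ with $r_{j+k}=s_j$ for all $j\ge N$; the set of equivalence classes is the boundary $\partial Y$. For $c\in\partial Y$, two vertices $x,y$ lie in the same horocycle with respect to $c$ if there are rays in $c$ starting at $x$ and $y$ and an $n\ge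 0$ such that the two rays have the same $n$-th vertex. Let $P_c$ be the stabilizer of $c$ in $G$ and $N_c\subset P_c$ the subgroup of elements stabilizing one (hence every) horocycle with respect to $c$. The point $c$ is a cusp of $\Gamma$ if $\Gamma\cap P_c=\Gamma\cap N_c$ and $\Gamma\cap N_c$ acts transitively on some horocycle with respect to $c$; then a ray in $c$, or rather its image in $X$, is called a cusp section. The cusp is periodic if, along a ray in $c$ with vertices $x_1,x_2,\dots$, the sequence of valencies $\mathrm{val}(x_n)$ (in $Y$) is eventually periodic. The tree lattice $\Gamma$ is cuspidal if $X$ is the union of a finite graph and finitely many periodic cusp sections. Cycles, weights, zeta function: a path $(e_1,\dots,e_n)$ in $X$ is closed if $t(e_n)=o(e_1)$; a cycle is an equivalence class of closed paths under cyclic shifts; $l(c)$ is its length. A cycle is prime if it is not a power of a shorter one. For an oriented edge $e$ of $Y$ put $w(e)=|\Gamma_{o(e)}e|$, and for an edge $e$ of $X$ put $w(e)=w(\tilde e)$ for any preimage $\tilde e$ in $Y$. For edges $e,e'$ of $X$ with $t(e)=o(e')$ put $w(e,e')=w(e')$ if $e'\neq e^{-1}$ and $w(e,e')=w(e')-1$ if $e'=e^{-1}$. For a closed path $p=(e_1,\dots,e_n)$ let $w(p)=\prod_{j \bmod n}w(e_j,e_{j+1})$; it depends only on the cycle. The Bass-Ihara zeta function is $Z(u)=\prod_c(1-w(c)u^{l(c)})^{-1}$ (for small $|u|$), the product over all prime cycles $c$ in $X$. Determinants: for a set $I$ let $P(I)=\prod_{i\in I}\mathbb C i$ and $S(I)=\bigoplus_{i\in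 I}\mathbb C i$, with pairing $\langle\sum a_ii,\sum b_ii\rangle=\sum a_ib_i$ on $P(I)\times S(I)$. For a linear $A:S(I)\to P(I)$ and finite $F\subset I$ let $A_F$ be the composition $S(F)\hookrightarrow S(I)\xrightarrow{A}P(I)\twoheadrightarrow P(F)$. $A$ is of determinant class if the limit $\det(A):=\lim_F\det(A_F)$ over the net of all finite subsets $F\subset I$ exists and is $\neq0$. A permutation of $I$ is finite if it is the identity outside a finite set. $A$ is of strong determinant class if (i) there is a finite $F_0\subset I$ with $\langle Ai,i\rangle\ne0$ for $i\notin F_0$ and $\sum_{i\in I\smallsetminus F_0}|\log\langle Ai,i\rangle|<\infty$, and (ii) $\sum_{\sigma\text{ finite}}\left|\prod_{i\in I}\langle Ai,\sigma i\rangle\right|<\infty$, the sum running over finite permutations $\sigma$ of $I$. *)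

theory Defs
  imports
    "HOL-Analysis.Analysis"
    "HOL-Computational_Algebra.Polynomial"
    "HOL-Combinatorics.Permutations"
    "HOL-Algebra.Group_Action"
    "Graph_Theory.Pair_Digraph"
    "Graph_Theory.Digraph_Component"
begin

section \<open>Trees, automorphisms, quotient graphs\<close>

text \<open>
  A tree has no multiple edges, so an oriented edge of \<open>Y\<close> is the pair of its origin and its
  terminus, and \<^const>\<open>prod.swap\<close> is the reversal. Quotients of \<open>Y\<close> may have loops and multiple
  edges; they are general digraphs with an explicit reversal.
\<close>

definition reduced :: "('v \<times> 'v) list \<Rightarrow> bool" where
  "reduced p \<longleftrightarrow> successively (\<lambda>e e'. e' \<noteq> prod.swap e) p"

text \<open>
  The predicate \<open>tree\<close> of \<open>Graph_Theory\<close> is not applicable here: it counts an edge followed by its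
  reverse as a cycle.
\<close>

definition is_tree :: "'v pair_pre_digraph \<Rightarrow> bool" where
  "is_tree Y \<longleftrightarrow> pair_bidirected_digraph Y \<and> connected (with_proj Y) \<and>
     \<not> (\<exists>x p. p \<noteq> [] \<and> pre_digraph.awalk (with_proj Y) x p x \<and> reduced p)"

definition locally_finite :: "'v pair_pre_digraph \<Rightarrow> bool" where
  "locally_finite Y \<longleftrightarrow> (\<forall>x\<in>pverts Y. finite (out_arcs (with_proj Y) x))"

definition automorphisms :: "'v pair_pre_digraph \<Rightarrow> ('v \<Rightarrow> 'v) set" where
  "automorphisms Y = {f \<in> Bij (pverts Y).
     \<forall>x\<in>pverts Y. \<forall>y\<in>pverts Y. (f x, f y) \<in> parcs Y \<longleftrightarrow> (x, y) \<in> parcs Y}"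

definition aut_group :: "'v pair_pre_digraph \<Rightarrow> ('v \<Rightarrow> 'v) monoid" where
  "aut_group Y = (BijGroup (pverts Y))\<lparr>carrier := automorphisms Y\<rparr>"

definition edge_act :: "('g \<Rightarrow> 'v \<Rightarrow> 'v) \<Rightarrow> 'g \<Rightarrow> 'v \<times> 'v \<Rightarrow> 'v \<times> 'v" where
  "edge_act \<phi> g = map_prod (\<phi> g) (\<phi> g)"

definition quotient_graph ::
  "('g, 'm) monoid_scheme \<Rightarrow> ('g \<Rightarrow> 'v \<Rightarrow> 'v) \<Rightarrow> 'v pair_pre_digraph \<Rightarrow>
     ('v set, ('v \<times> 'v) set) pre_digraph" where
  "quotient_graph \<Gamma> \<phi> Y =
     \<lparr> verts = Group_Action.orbits \<Gamma> (pverts Y) \<phi>,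
       arcs = Group_Action.orbits \<Gamma> (parcs Y) (edge_act \<phi>),
       tail = (\<lambda>e. fst ` e), head = (\<lambda>e. snd ` e) \<rparr>"

definition edge_rev :: "('v \<times> 'v) set \<Rightarrow> ('v \<times> 'v) set" where
  "edge_rev e = prod.swap ` e"

definition uniform :: "'v pair_pre_digraph \<Rightarrow> bool" where
  "uniform Y \<longleftrightarrow>
     finite (verts (quotient_graph (aut_group Y) (\<lambda>f. f) Y)) \<and>
     finite (arcs (quotient_graph (aut_group Y) (\<lambda>f. f) Y))"


section \<open>Tree lattices\<close>

definition tree_lattice ::
  "('g, 'm) monoid_scheme \<Rightarrow> ('g \<Rightarrow> 'v \<Rightarrow> 'v) \<Rightarrow> 'v pair_pre_digraph \<Rightarrow> bool" where
  "tree_lattice \<Gamma> \<phi> Y \<longleftrightarrow>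
     is_tree Y \<and> locally_finite Y \<and>
     group_action \<Gamma> (pverts Y) \<phi> \<and> \<phi> ` carrier \<Gamma> \<subseteq> automorphisms Y \<and>
     (\<forall>e\<in>parcs Y. finite (stabilizer \<Gamma> (edge_act \<phi>) e)) \<and>
     (\<lambda>e. 1 / real (card (stabilizer \<Gamma> (edge_act \<phi>) (SOME e'. e' \<in> e))))
       summable_on arcs (quotient_graph \<Gamma> \<phi> Y)"

text \<open>An orientation selects exactly one of \<open>e\<close>, \<open>e\<^sup>-\<^sup>1\<close> for each edge.\<close>

definition orientation_preserving ::
  "('g, 'm) monoid_scheme \<Rightarrow> ('g \<Rightarrow> 'v \<Rightarrow> 'v) \<Rightarrow> 'v pair_pre_digraph \<Rightarrow> bool" where
  "orientation_preserving \<Gamma> \<phi> Y \<longleftrightarrow>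
     (\<exists>D\<subseteq>parcs Y. (\<forall>e\<in>parcs Y. e \<in> D \<longleftrightarrow> prod.swap e \<notin> D) \<and>
        (\<forall>g\<in>carrier \<Gamma>. \<forall>e\<in>D. edge_act \<phi> g e \<in> D))"


section \<open>Boundary and cusps\<close>

definition rays :: "'v pair_pre_digraph \<Rightarrow> (nat \<Rightarrow> 'v \<times> 'v) set" where
  "rays Y = {r. \<forall>j. r j \<in> parcs Y \<and> snd (r j) = fst (r (Suc j)) \<and> r (Suc j) \<noteq> prod.swap (r j)}"

definition ray_equiv :: "'v pair_pre_digraph \<Rightarrow> ((nat \<Rightarrow> 'v \<times> 'v) \<times> (nat \<Rightarrow> 'v \<times> 'v)) set" where
  "ray_equiv Y = {(r, s). r \<in> rays Y \<and> s \<in> rays Y \<and>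
     (\<exists>N. \<exists>k::int. \<forall>j\<ge>N. int j + k \<ge> 0 \<and> r (nat (int j + k)) = s j)}"

definition boundary :: "'v pair_pre_digraph \<Rightarrow> (nat \<Rightarrow> 'v \<times> 'v) set set" where
  "boundary Y = rays Y // ray_equiv Y"

definition same_horocycle :: "(nat \<Rightarrow> 'v \<times> 'v) set \<Rightarrow> 'v \<Rightarrow> 'v \<Rightarrow> bool" where
  "same_horocycle c x y \<longleftrightarrow>
     (\<exists>r\<in>c. \<exists>s\<in>c. \<exists>n. fst (r 0) = x \<and> fst (s 0) = y \<and> fst (r n) = fst (s n))"

definition horocycles :: "'v pair_pre_digraph \<Rightarrow> (nat \<Rightarrow> 'v \<times> 'v) set \<Rightarrow> 'v set set" where
  "horocycles Y c = {{y \<in> pverts Y. same_horocycle c x y} | x. x \<in> pverts Y}"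

definition P_stab :: "'v pair_pre_digraph \<Rightarrow> (nat \<Rightarrow> 'v \<times> 'v) set \<Rightarrow> ('v \<Rightarrow> 'v) set" where
  "P_stab Y c = {f \<in> automorphisms Y. (\<lambda>r j. map_prod f f (r j)) ` c = c}"

definition N_stab :: "'v pair_pre_digraph \<Rightarrow> (nat \<Rightarrow> 'v \<times> 'v) set \<Rightarrow> ('v \<Rightarrow> 'v) set" where
  "N_stab Y c = {f \<in> P_stab Y c. \<exists>H\<in>horocycles Y c. f ` H = H}"

text \<open>
  The action of \<open>\<Gamma>\<close> need not be faithful; intersections of \<open>\<Gamma>\<close> with subgroups of the automorphism
  group are read as preimages under \<open>\<phi>\<close>.
\<close>

definition is_cusp ::
  "('g, 'm) monoid_scheme \<Rightarrow> ('g \<Rightarrow> 'v \<Rightarrow> 'v) \<Rightarrow> 'v pair_pre_digraph \<Rightarrow>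
     (nat \<Rightarrow> 'v \<times> 'v) set \<Rightarrow> bool" where
  "is_cusp \<Gamma> \<phi> Y c \<longleftrightarrow> c \<in> boundary Y \<and>
     {g \<in> carrier \<Gamma>. \<phi> g \<in> P_stab Y c} = {g \<in> carrier \<Gamma>. \<phi> g \<in> N_stab Y c} \<and>
     (\<exists>H\<in>horocycles Y c. \<forall>x\<in>H. \<forall>y\<in>H. \<exists>g\<in>carrier \<Gamma>. \<phi> g \<in> N_stab Y c \<and> \<phi> g x = y)"

definition periodic_cusp ::
  "('g, 'm) monoid_scheme \<Rightarrow> ('g \<Rightarrow> 'v \<Rightarrow> 'v) \<Rightarrow> 'v pair_pre_digraph \<Rightarrow>
     (nat \<Rightarrow> 'v \<times> 'v) set \<Rightarrow> bool" where
  "periodic_cusp \<Gamma> \<phi> Y c \<longleftrightarrow> is_cusp \<Gamma> \<phi> Y c \<and>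
     (\<exists>r\<in>c. \<exists>N. \<exists>p>0. \<forall>n\<ge>N.
        out_degree (with_proj Y) (fst (r (n + p))) = out_degree (with_proj Y) (fst (r n)))"

text \<open>\<open>H\<close> is the finite graph, \<open>R\<close> a set of rays representing the periodic cusp sections.\<close>

definition cuspidal ::
  "('g, 'm) monoid_scheme \<Rightarrow> ('g \<Rightarrow> 'v \<Rightarrow> 'v) \<Rightarrow> 'v pair_pre_digraph \<Rightarrow> bool" where
  "cuspidal \<Gamma> \<phi> Y \<longleftrightarrow>
     (\<exists>H R. subgraph H (quotient_graph \<Gamma> \<phi> Y) \<and> edge_rev ` arcs H = arcs H \<and>
        finite (verts H) \<and> finite (arcs H) \<and>
        finite R \<and> (\<forall>r\<in>R. \<exists>c. periodic_cusp \<Gamma> \<phi> Y c \<and> r \<in> c) \<and>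
        verts (quotient_graph \<Gamma> \<phi> Y) =
          verts H \<union> (\<Union>r\<in>R. \<Union>j. {Group_Action.orbit \<Gamma> \<phi> (fst (r j))}) \<and>
        arcs (quotient_graph \<Gamma> \<phi> Y) =
          arcs H \<union> (\<Union>r\<in>R. \<Union>j. {Group_Action.orbit \<Gamma> (edge_act \<phi>) (r j),
                                edge_rev (Group_Action.orbit \<Gamma> (edge_act \<phi>) (r j))}))"


section \<open>Weights, cycles and the zeta function\<close>

definition edge_weight ::
  "('g, 'm) monoid_scheme \<Rightarrow> ('g \<Rightarrow> 'v \<Rightarrow> 'v) \<Rightarrow> ('v \<times> 'v) set \<Rightarrow> nat" where
  "edge_weight \<Gamma> \<phi> e =
     (let e' = (SOME e'. e' \<in> e)
      in card ((\<lambda>g. edge_act \<phi> g e') ` stabilizer \<Gamma> \<phi> (fst e')))"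

definition pair_weight ::
  "('g, 'm) monoid_scheme \<Rightarrow> ('g \<Rightarrow> 'v \<Rightarrow> 'v) \<Rightarrow> ('v \<times> 'v) set \<Rightarrow> ('v \<times> 'v) set \<Rightarrow> int" where
  "pair_weight \<Gamma> \<phi> e e' =
     (if e' = edge_rev e then int (edge_weight \<Gamma> \<phi> e') - 1 else int (edge_weight \<Gamma> \<phi> e'))"

definition path_weight ::
  "('g, 'm) monoid_scheme \<Rightarrow> ('g \<Rightarrow> 'v \<Rightarrow> 'v) \<Rightarrow> ('v \<times> 'v) set list \<Rightarrow> int" where
  "path_weight \<Gamma> \<phi> p =
     (\<Prod>j<length p. pair_weight \<Gamma> \<phi> (p ! j) (p ! (Suc j mod length p)))"

definition closed_path :: "('a, 'e) pre_digraph \<Rightarrow> 'e list \<Rightarrow> bool" where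
  "closed_path X p \<longleftrightarrow> p \<noteq> [] \<and> (\<exists>x. pre_digraph.awalk X x p x)"

definition cyclic_class :: "'e list \<Rightarrow> 'e list set" where
  "cyclic_class p = {rotate n p | n. True}"

definition graph_cycles :: "('a, 'e) pre_digraph \<Rightarrow> 'e list set set" where
  "graph_cycles X = {cyclic_class p | p. closed_path X p}"

text \<open>A power of a shorter cycle is the class of a concatenation \<open>q\<^sup>m\<close> with \<open>m \<ge> 2\<close>.\<close>

definition prime_cycles :: "('a, 'e) pre_digraph \<Rightarrow> 'e list set set" where
  "prime_cycles X = {c \<in> graph_cycles X.
     \<not> (\<exists>q m. closed_path X q \<and> m \<ge> 2 \<and> c = cyclic_class (concat (replicate m q)))}"

definition cycle_length :: "'e list set \<Rightarrow> nat" where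
  "cycle_length c = length (SOME p. p \<in> c)"

definition cycle_weight ::
  "('g, 'm) monoid_scheme \<Rightarrow> ('g \<Rightarrow> 'v \<Rightarrow> 'v) \<Rightarrow> ('v \<times> 'v) set list set \<Rightarrow> int" where
  "cycle_weight \<Gamma> \<phi> c = path_weight \<Gamma> \<phi> (SOME p. p \<in> c)"

text \<open>
  Infinite products over an arbitrary index set are limits along the net of finite subsets;
  \<open>net_prod\<close> is meaningful only when \<open>has_net_prod\<close> holds for some value.
\<close>

definition has_net_prod :: "('i \<Rightarrow> complex) \<Rightarrow> 'i set \<Rightarrow> complex \<Rightarrow> bool" where
  "has_net_prod f I z \<longleftrightarrow> ((\<lambda>F. prod f F) \<longlongrightarrow> z) (finite_subsets_at_top I)"

definition net_prod :: "('i \<Rightarrow> complex) \<Rightarrow> 'i set \<Rightarrow> complex" where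
  "net_prod f I = Lim (finite_subsets_at_top I) (\<lambda>F. prod f F)"

definition zeta_factor ::
  "('g, 'm) monoid_scheme \<Rightarrow> ('g \<Rightarrow> 'v \<Rightarrow> 'v) \<Rightarrow> complex \<Rightarrow> ('v \<times> 'v) set list set \<Rightarrow> complex" where
  "zeta_factor \<Gamma> \<phi> u c = inverse (1 - of_int (cycle_weight \<Gamma> \<phi> c) * u ^ cycle_length c)"

definition bass_ihara_zeta ::
  "('g, 'm) monoid_scheme \<Rightarrow> ('g \<Rightarrow> 'v \<Rightarrow> 'v) \<Rightarrow> 'v pair_pre_digraph \<Rightarrow> complex \<Rightarrow> complex" where
  "bass_ihara_zeta \<Gamma> \<phi> Y u =
     net_prod (zeta_factor \<Gamma> \<phi> u) (prime_cycles (quotient_graph \<Gamma> \<phi> Y))"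


section \<open>Determinants\<close>

text \<open>\<open>P(I)\<close> and \<open>S(I)\<close> are realised as spaces of functions vanishing outside \<open>I\<close>.\<close>

definition P_space :: "'i set \<Rightarrow> ('i \<Rightarrow> complex) set" where
  "P_space I = {f. \<forall>i. i \<notin> I \<longrightarrow> f i = 0}"

definition S_space :: "'i set \<Rightarrow> ('i \<Rightarrow> complex) set" where
  "S_space I = {f \<in> P_space I. finite {i. f i \<noteq> 0}}"

definition basis :: "'i \<Rightarrow> 'i \<Rightarrow> complex" where
  "basis i = (\<lambda>j. if j = i then 1 else 0)"

definition pairing :: "('i \<Rightarrow> complex) \<Rightarrow> ('i \<Rightarrow> complex) \<Rightarrow> complex" where
  "pairing a b = (\<Sum>i | b i \<noteq> 0. a i * b i)"

definition linear_SP :: "'i set \<Rightarrow> (('i \<Rightarrow> complex) \<Rightarrow> ('i \<Rightarrow> complex)) \<Rightarrow> bool" where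
  "linear_SP I A \<longleftrightarrow> A ` S_space I \<subseteq> P_space I \<and>
     (\<forall>f\<in>S_space I. \<forall>g\<in>S_space I. A (\<lambda>i. f i + g i) = (\<lambda>i. A f i + A g i)) \<and>
     (\<forall>f\<in>S_space I. \<forall>a. A (\<lambda>i. a * f i) = (\<lambda>i. a * A f i))"

definition compression ::
  "'i set \<Rightarrow> (('i \<Rightarrow> complex) \<Rightarrow> ('i \<Rightarrow> complex)) \<Rightarrow> ('i \<Rightarrow> complex) \<Rightarrow> ('i \<Rightarrow> complex)" where
  "compression F A f = (\<lambda>i. if i \<in> F then A f i else 0)"

text \<open>The determinant of an endomorphism of \<open>S(F)\<close>, \<open>F\<close> finite, by the Leibniz formula.\<close>

definition fin_det :: "'i set \<Rightarrow> (('i \<Rightarrow> complex) \<Rightarrow> ('i \<Rightarrow> complex)) \<Rightarrow> complex" where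
  "fin_det F B =
     (\<Sum>\<sigma> | \<sigma> permutes F. of_int (sign \<sigma>) * (\<Prod>i\<in>F. pairing (B (basis i)) (basis (\<sigma> i))))"

definition det_class :: "'i set \<Rightarrow> (('i \<Rightarrow> complex) \<Rightarrow> ('i \<Rightarrow> complex)) \<Rightarrow> bool" where
  "det_class I A \<longleftrightarrow> linear_SP I A \<and>
     (\<exists>z. z \<noteq> 0 \<and> ((\<lambda>F. fin_det F (compression F A)) \<longlongrightarrow> z) (finite_subsets_at_top I))"

definition net_det :: "'i set \<Rightarrow> (('i \<Rightarrow> complex) \<Rightarrow> ('i \<Rightarrow> complex)) \<Rightarrow> complex" where
  "net_det I A = Lim (finite_subsets_at_top I) (\<lambda>F. fin_det F (compression F A))"

text \<open>
  The first condition guarantees that the infinite products in the second one converge, as all but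
  finitely many factors are diagonal entries of \<open>A\<close>.
\<close>

definition strong_det_class :: "'i set \<Rightarrow> (('i \<Rightarrow> complex) \<Rightarrow> ('i \<Rightarrow> complex)) \<Rightarrow> bool" where
  "strong_det_class I A \<longleftrightarrow> linear_SP I A \<and>
     (\<exists>F\<subseteq>I. finite F \<and> (\<forall>i\<in>I - F. pairing (A (basis i)) (basis i) \<noteq> 0) \<and>
        (\<lambda>i. cmod (Ln (pairing (A (basis i)) (basis i)))) summable_on (I - F)) \<and>
     (\<lambda>\<sigma>. cmod (net_prod (\<lambda>i. pairing (A (basis i)) (basis (\<sigma> i))) I))
       summable_on {\<sigma>. \<sigma> permutes I \<and> finite {i. \<sigma> i \<noteq> i}}"


section \<open>The edge operator\<close>

text \<open>The linear extension of \<open>T e = (\<Sum>e'. w(e, e') e')\<close>, over \<open>e'\<close> with \<open>o(e') = t(e)\<close>.\<close>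

definition edge_operator ::
  "('g, 'm) monoid_scheme \<Rightarrow> ('g \<Rightarrow> 'v \<Rightarrow> 'v) \<Rightarrow> 'v pair_pre_digraph \<Rightarrow>
     (('v \<times> 'v) set \<Rightarrow> complex) \<Rightarrow> (('v \<times> 'v) set \<Rightarrow> complex)" where
  "edge_operator \<Gamma> \<phi> Y f =
     (let X = quotient_graph \<Gamma> \<phi> Y
      in (\<lambda>e'. \<Sum>e | f e \<noteq> 0.
             f e * (if e' \<in> arcs X \<and> tail X e' = head X e
                    then of_int (pair_weight \<Gamma> \<phi> e e') else 0)))"

definition one_minus_uT ::
  "('g, 'm) monoid_scheme \<Rightarrow> ('g \<Rightarrow> 'v \<Rightarrow> 'v) \<Rightarrow> 'v pair_pre_digraph \<Rightarrow> complex \<Rightarrow>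
     (('v \<times> 'v) set \<Rightarrow> complex) \<Rightarrow> (('v \<times> 'v) set \<Rightarrow> complex)" where
  "one_minus_uT \<Gamma> \<phi> Y u f = (\<lambda>e. f e - u * edge_operator \<Gamma> \<phi> Y f e)"

end

theory Submission
  imports Defs
begin

text \<open>
  Let \<open>t i j\<close> be the coefficient of \<open>j\<close> in \<open>T i\<close>. These numbers are nonnegative, and because \<open>Y\<close> has
  bounded valency the row sums of \<open>t\<close> are bounded by some \<open>B\<close>; the theorem holds for
  \<open>|u| < 1 / (B + 1)\<close>. Infinitely many edges are controlled by the following picture of \<open>X\<close>.

  The structure of \<open>X\<close> (\<open>cusp_sections\<close>, \<open>exists_cusp_weights\<close>). Up to a finite set, the edges of
  \<open>X\<close> form finitely many disjoint cusp sections with outward edges \<open>e 0, e 1, \<dots>\<close> and their reverses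
  \<open>f 0, f 1, \<dots>\<close>. The stabilizer of a vertex far out on a cusp ray fixes the next vertex and permutes
  all other neighbours transitively. Hence \<open>e n\<close> has weight \<open>1\<close> and leads only to \<open>e (n + 1)\<close> or
  back to \<open>f n\<close>, while \<open>f (n + 1)\<close> leads only to \<open>f n\<close>, since turning back to \<open>e (n + 1)\<close> has
  weight \<open>1 - 1 = 0\<close>. Let \<open>F1\<close> be the finite set of all edges but \<open>e n\<close> and \<open>f n\<close> with \<open>n \<ge> 1\<close>. A path of
  nonzero weight outside \<open>F1\<close> runs out, turns at most once and comes back, so every closed path of
  nonzero weight meets \<open>F1\<close>. This one fact gives all the convergence.

  The cusp rays have this local form for the following reasons. Transitivity on a horocycle makes
  the stabilizer of a vertex of the ray transitive on the neighbours behind it, provided that \<open>Y\<close> has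
  no leaves (\<open>children_same_orbit\<close>, \<open>no_leaf\<close>). The ray leaves every orbit of vertices, because otherwise some
  element of the lattice would shift the ray along itself, which a cusp excludes (\<open>axis_proper\<close>). If
  the stabilizer moved the next vertex as well, all edges at that vertex would be equivalent, so \<open>X\<close>
  would end there; this can happen at one vertex of the ray at most (\<open>eventually_fixed\<close>).

  Strong determinant class. Removing the edges outside \<open>F1\<close> one at a time by elimination does not
  decrease the permanent of \<open>1 + |u| t\<close>, does not increase the row sums of \<open>|u| t\<close>, and preserves
  triangularity. So the sums over permutations are at most \<open>2 ^ card F1\<close>, whatever finite set of edges
  they are restricted to (\<open>Perm_le_of_triangular\<close>).

  The product formula. For a finite set \<open>F\<close> of edges, \<open>det (1 - u T)\<close> restricted to \<open>F\<close> equals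
  \<open>exp (- \<Sum>p. w(p) u ^ l(p) / l(p))\<close>, the sum running over the closed paths in \<open>F\<close>, because both
  sides solve the same linear differential equation in \<open>u\<close> (\<open>Det_char_matrix_eq_exp\<close>). At most
  \<open>card F1 * B ^ n\<close> of the sum comes from paths of length \<open>n\<close>, as each of them can be rotated to start
  in \<open>F1\<close> (\<open>sum_cyclic_weight_le\<close>); so the series converges absolutely over all closed paths and the
  determinants converge along finite sets of edges, to a nonzero limit. Writing every closed path
  uniquely as a power of a primitive one turns the exponent into \<open>\<Sum>c. Ln (1 - w(c) u ^ l(c))\<close> over
  the prime cycles (\<open>cyclic_language.has_sum_primes\<close>), which is the logarithm of the inverse zeta function.

  Rationality. Gaussian elimination removes a truncated cusp section and changes only the entry of
  the matrix at \<open>(e 0, f 0)\<close> (\<open>Det_chain\<close>). In the limit this entry is a series with eventually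
  periodic coefficients, hence rational in \<open>u\<close> (\<open>rational_on_tail_sum\<close>), and the determinant becomes a
  finite one with rational entries.
\<close>

section \<open>Determinants indexed by finite sets\<close>

definition Det :: "'i set \<Rightarrow> ('i \<Rightarrow> 'i \<Rightarrow> complex) \<Rightarrow> complex" where
  "Det F A = (\<Sum>\<sigma> | \<sigma> permutes F. of_int (sign \<sigma>) * (\<Prod>i\<in>F. A i (\<sigma> i)))"

lemma Det_cong:
  assumes "\<And>i j. i \<in> F \<Longrightarrow> j \<in> F \<Longrightarrow> A i j = B i j"
  shows "Det F A = Det F B"
  unfolding Det_def
  by (intro sum.cong arg_cong2[where f="(*)"] refl prod.cong assms) (auto simp: permutes_in_image)

lemma Det_row_expand:
  assumes "finite F" "k \<in> F"
  shows "Det F (A(k := v)) =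
    (\<Sum>\<sigma> | \<sigma> permutes F. of_int (sign \<sigma>) * (v (\<sigma> k) * (\<Prod>i\<in>F - {k}. A i (\<sigma> i))))"
  unfolding Det_def
proof (intro sum.cong refl arg_cong2[where f="(*)"])
  fix \<sigma>
  have "(\<Prod>i\<in>F. (A(k := v)) i (\<sigma> i)) = v (\<sigma> k) * (\<Prod>i\<in>F - {k}. (A(k := v)) i (\<sigma> i))"
    using assms by (simp add: prod.remove)
  also have "(\<Prod>i\<in>F - {k}. (A(k := v)) i (\<sigma> i)) = (\<Prod>i\<in>F - {k}. A i (\<sigma> i))"
    by (intro prod.cong) auto
  finally show "(\<Prod>i\<in>F. (A(k := v)) i (\<sigma> i)) = v (\<sigma> k) * (\<Prod>i\<in>F - {k}. A i (\<sigma> i))" .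
qed

lemma Det_row_linear:
  assumes "finite F" "k \<in> F" "\<And>j. j \<in> F \<Longrightarrow> v j = (\<Sum>m\<in>J. c m * R m j)"
  shows "Det F (A(k := v)) = (\<Sum>m\<in>J. c m * Det F (A(k := R m)))"
proof -
  have "Det F (A(k := v)) = (\<Sum>\<sigma> | \<sigma> permutes F. \<Sum>m\<in>J.
     c m * (of_int (sign \<sigma>) * (R m (\<sigma> k) * (\<Prod>i\<in>F - {k}. A i (\<sigma> i)))))"
    unfolding Det_row_expand[OF assms(1,2)]
  proof (intro sum.cong refl)
    fix \<sigma> assume "\<sigma> \<in> {\<sigma>. \<sigma> permutes F}"
    then have "\<sigma> k \<in> F" using assms(2) by (simp add: permutes_in_image)
    from assms(3)[OF this]
    show "of_int (sign \<sigma>) * (v (\<sigma> k) * (\<Prod>i\<in>F - {k}. A i (\<sigma> i))) = (\<Sum>m\<in>J.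
     c m * (of_int (sign \<sigma>) * (R m (\<sigma> k) * (\<Prod>i\<in>F - {k}. A i (\<sigma> i)))))"
      by (simp add: sum_distrib_left sum_distrib_right mult_ac)
  qed
  also have "\<dots> = (\<Sum>m\<in>J. c m * Det F (A(k := R m)))"
    unfolding Det_row_expand[OF assms(1,2)] by (subst sum.swap) (simp add: sum_distrib_left)
  finally show ?thesis .
qed

lemma Det_equal_rows:
  assumes "finite F" "k \<in> F" "l \<in> F" "k \<noteq> l" "\<And>j. j \<in> F \<Longrightarrow> A k j = A l j"
  shows "Det F A = 0"
proof -
  let ?\<tau> = "Transposition.transpose k l"
  have perm: "?\<tau> permutes F" using assms by (simp add: permutes_swap_id)
  have "Det F A = (\<Sum>\<sigma> | \<sigma> permutes F. of_int (sign (\<sigma> \<circ> ?\<tau>)) * (\<Prod>i\<in>F. A i ((\<sigma> \<circ> ?\<tau>) i)))"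
    unfolding Det_def by (rule sum_permutations_compose_right[OF perm])
  also have "\<dots> = (\<Sum>\<sigma> | \<sigma> permutes F. - (of_int (sign \<sigma>) * (\<Prod>i\<in>F. A i (\<sigma> i))))"
  proof (intro sum.cong refl)
    fix \<sigma> assume "\<sigma> \<in> {\<sigma>. \<sigma> permutes F}"
    then have \<sigma>: "\<sigma> permutes F" by simp
    have s: "sign (\<sigma> \<circ> ?\<tau>) = - sign \<sigma>"
      using \<sigma> assms perm sign_compose[of \<sigma> ?\<tau>] sign_swap_id[of k l] permutation_permutes
      by (metis mult_minus1_right)
    have "(\<Prod>i\<in>F. A i ((\<sigma> \<circ> ?\<tau>) i)) = (\<Prod>i\<in>F. A (?\<tau> i) (\<sigma> i))"
      by (subst prod.permute[OF perm]) (simp add: o_def)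
    also have "\<dots> = (\<Prod>i\<in>F. A i (\<sigma> i))"
    proof (intro prod.cong refl)
      fix i assume "i \<in> F"
      then have "\<sigma> i \<in> F" using \<sigma> by (simp add: permutes_in_image)
      then show "A (?\<tau> i) (\<sigma> i) = A i (\<sigma> i)" using assms(5) by (auto simp: Transposition.transpose_def)
    qed
    finally show "of_int (sign (\<sigma> \<circ> ?\<tau>)) * (\<Prod>i\<in>F. A i ((\<sigma> \<circ> ?\<tau>) i)) =
        - (of_int (sign \<sigma>) * (\<Prod>i\<in>F. A i (\<sigma> i)))"
      by (simp add: s)
  qed
  also have "\<dots> = - Det F A" unfolding Det_def by (simp add: sum_negf)
  finally show ?thesis by simp
qed

text \<open>
  Cramer's rule by rows: when the new row is expanded linearly, all terms but the \<open>k\<close>-th have two equal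
  rows.
\<close>

lemma Det_row_combination:
  assumes "finite F" "k \<in> F" "\<And>j. j \<in> F \<Longrightarrow> v j = (\<Sum>i\<in>F. x i * A i j)"
  shows "Det F (A(k := v)) = x k * Det F A"
proof -
  have "Det F (A(k := v)) = (\<Sum>i\<in>F. x i * Det F (A(k := A i)))"
    by (rule Det_row_linear[OF assms])
  also have "\<dots> = (\<Sum>i\<in>F. if i = k then x k * Det F A else 0)"
    using assms by (intro sum.cong refl) (auto intro: Det_equal_rows)
  finally show ?thesis using assms by simp
qed

text \<open>
  The only permutations that contribute fix \<open>k\<close>, since every other one picks a zero from its column.
\<close>

lemma Det_unit_column:
  assumes "finite F" "k \<notin> F" "A k k = 1" "\<And>i. i \<in> F \<Longrightarrow> A i k = 0"
  shows "Det (insert k F) A = Det F A"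
proof -
  have "Det F A = (\<Sum>\<sigma> | \<sigma> permutes F. of_int (sign \<sigma>) * (\<Prod>i\<in>insert k F. A i (\<sigma> i)))"
    unfolding Det_def using assms by (intro sum.cong refl) (auto simp: permutes_not_in)
  also have "\<dots> = Det (insert k F) A"
    unfolding Det_def
  proof (rule sum.mono_neutral_left)
    show "finite {\<sigma>. \<sigma> permutes insert k F}" using assms by (simp add: finite_permutations)
    show "{\<sigma>. \<sigma> permutes F} \<subseteq> {\<sigma>. \<sigma> permutes insert k F}"
      by (auto intro: permutes_subset)
    show "\<forall>\<sigma>\<in>{\<sigma>. \<sigma> permutes insert k F} - {\<sigma>. \<sigma> permutes F}.
        of_int (sign \<sigma>) * (\<Prod>i\<in>insert k F. A i (\<sigma> i)) = 0"
    proof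
      fix \<sigma> assume *: "\<sigma> \<in> {\<sigma>. \<sigma> permutes insert k F} - {\<sigma>. \<sigma> permutes F}"
      have "\<sigma> k \<noteq> k"
      proof
        assume "\<sigma> k = k"
        then have "\<sigma> permutes F" using * permutes_superset[of \<sigma> "insert k F" F] by blast
        with * show False by simp
      qed
      obtain i where i: "i \<in> insert k F" "\<sigma> i = k"
        using * permutes_surj[of \<sigma> "insert k F"] permutes_in_image[of \<sigma> "insert k F"]
        by (metis DiffD1 insertI1 mem_Collect_eq surjD)
      with \<open>\<sigma> k \<noteq> k\<close> have "i \<in> F" by auto
      then have "A i (\<sigma> i) = 0" using assms i by simp
      then have "(\<Prod>i\<in>insert k F. A i (\<sigma> i)) = 0"
        using i(1) assms(1) by (auto intro!: prod_zero)
      then show "of_int (sign \<sigma>) * (\<Prod>i\<in>insert k F. A i (\<sigma> i)) = 0" by simp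
    qed
  qed
  finally show ?thesis by simp
qed

text \<open>
  One step of Gaussian elimination in the case of a pivot column with a single entry off the
  diagonal: only the row of that entry changes. This is the situation met at the end of a truncated
  cusp section.
\<close>

lemma Det_eliminate:
  assumes "finite F" "k \<notin> F" "l \<in> F" "A k k = 1" "\<And>i. i \<in> F \<Longrightarrow> i \<noteq> l \<Longrightarrow> A i k = 0"
  shows "Det (insert k F) A = Det F (A(l := \<lambda>j. A l j - A l k * A k j))"
proof -
  let ?v = "\<lambda>j. A l j - A l k * A k j"
  have kl: "k \<noteq> l" using assms by auto
  define x :: "'a \<Rightarrow> complex" where "x i = (if i = l then 1 else if i = k then - A l k else 0)" for i
  have "Det (insert k F) (A(l := ?v)) = x l * Det (insert k F) A"
  proof (rule Det_row_combination)
    fix j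
    have "(\<Sum>i\<in>insert k F. x i * A i j) = (\<Sum>i\<in>{k,l}. x i * A i j)"
      using assms by (intro sum.mono_neutral_right) (auto simp: x_def)
    also have "\<dots> = ?v j" using kl by (simp add: x_def)
    finally show "?v j = (\<Sum>i\<in>insert k F. x i * A i j)" by simp
  qed (use assms in auto)
  then have "Det (insert k F) A = Det (insert k F) (A(l := ?v))" by (simp add: x_def)
  also have "\<dots> = Det F (A(l := ?v))"
    using assms kl by (intro Det_unit_column) auto
  finally show ?thesis .
qed

section \<open>Powers of a finite truncation and the determinant as an exponential\<close>

text \<open>
  The powers of the restriction of \<open>t\<close> to \<open>F\<close>; rows outside \<open>F\<close> are allowed as starting points.
\<close>

primrec tpow :: "'i set \<Rightarrow> ('i \<Rightarrow> 'i \<Rightarrow> real) \<Rightarrow> nat \<Rightarrow> 'i \<Rightarrow> 'i \<Rightarrow> real" where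
  "tpow F t 0 i j = (if i = j then 1 else 0)"
| "tpow F t (Suc n) i j = (\<Sum>k\<in>F. t i k * tpow F t n k j)"

lemma tpow_Suc_right:
  assumes "finite F" "i \<in> F" "j \<in> F"
  shows "tpow F t (Suc n) i j = (\<Sum>k\<in>F. tpow F t n i k * t k j)"
  using assms(2)
proof (induction n arbitrary: i)
  case 0
  then show ?case using assms by (simp add: if_distrib if_distribR cong: if_cong)
next
  case (Suc n)
  have "tpow F t (Suc (Suc n)) i j = (\<Sum>k\<in>F. t i k * (\<Sum>m\<in>F. tpow F t n k m * t m j))"
    using Suc.IH by (subst tpow.simps, intro sum.cong refl) (simp only:)
  also have "\<dots> = (\<Sum>m\<in>F. tpow F t (Suc n) i m * t m j)"
    by (simp add: sum_distrib_left sum_distrib_right, subst sum.swap) (simp add: mult_ac)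
  finally show ?case .
qed

definition char_matrix :: "('i \<Rightarrow> 'i \<Rightarrow> real) \<Rightarrow> complex \<Rightarrow> 'i \<Rightarrow> 'i \<Rightarrow> complex" where
  "char_matrix t u i j = (if i = j then 1 else 0) - u * of_real (t i j)"

lemma Det_char_matrix_deriv:
  assumes "finite F"
  shows "((\<lambda>u. Det F (char_matrix t u)) has_field_derivative
     (\<Sum>k\<in>F. Det F ((char_matrix t u)(k := \<lambda>j. - of_real (t k j))))) (at u)"
proof -
  have "((\<lambda>u. Det F (char_matrix t u)) has_field_derivative
     (\<Sum>\<sigma> | \<sigma> permutes F. of_int (sign \<sigma>) *
       (\<Sum>k\<in>F. - of_real (t k (\<sigma> k)) * (\<Prod>i\<in>F - {k}. char_matrix t u i (\<sigma> i))))) (at u)"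
    unfolding Det_def
  proof (intro DERIV_sum DERIV_cmult)
    fix \<sigma>
    show "((\<lambda>u. \<Prod>i\<in>F. char_matrix t u i (\<sigma> i)) has_field_derivative
       (\<Sum>k\<in>F. - of_real (t k (\<sigma> k)) * (\<Prod>i\<in>F - {k}. char_matrix t u i (\<sigma> i)))) (at u)"
      by (rule has_field_derivative_prod)
        (auto simp: char_matrix_def intro!: derivative_eq_intros)
  qed
  also have "(\<Sum>\<sigma> | \<sigma> permutes F. of_int (sign \<sigma>) *
       (\<Sum>k\<in>F. - of_real (t k (\<sigma> k)) * (\<Prod>i\<in>F - {k}. char_matrix t u i (\<sigma> i)))) =
    (\<Sum>k\<in>F. Det F ((char_matrix t u)(k := \<lambda>j. - of_real (t k j))))"
    using assms by (simp add: Det_row_expand sum_distrib_left del: sum_negf, subst sum.swap) simp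
  finally show ?thesis .
qed

locale bounded_weights =
  fixes I :: "'i set" and t :: "'i \<Rightarrow> 'i \<Rightarrow> real" and B :: real
  assumes t_nonneg: "\<And>i j. i \<in> I \<Longrightarrow> j \<in> I \<Longrightarrow> 0 \<le> t i j"
    and row_sum: "\<And>i F. i \<in> I \<Longrightarrow> finite F \<Longrightarrow> F \<subseteq> I \<Longrightarrow> (\<Sum>j\<in>F. t i j) \<le> B"
    and B_pos: "0 < B"
begin

lemma tpow_nonneg:
  assumes "F \<subseteq> I" "i \<in> I"
  shows "0 \<le> tpow F t n i j"
  using assms(2) by (induction n arbitrary: i) (use assms(1) in \<open>auto intro!: sum_nonneg mult_nonneg_nonneg t_nonneg\<close>)

lemma tpow_row_sum:
  assumes "finite F" "F \<subseteq> I" "i \<in> I"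
  shows "(\<Sum>j\<in>F. tpow F t n i j) \<le> B ^ n"
  using assms(3)
proof (induction n arbitrary: i)
  case 0
  then show ?case using assms by (simp add: sum.delta)
next
  case (Suc n)
  have "(\<Sum>j\<in>F. tpow F t (Suc n) i j) = (\<Sum>k\<in>F. t i k * (\<Sum>j\<in>F. tpow F t n k j))"
    by (simp add: sum_distrib_left) (rule sum.swap)
  also have "\<dots> \<le> (\<Sum>k\<in>F. t i k * B ^ n)"
    using assms Suc by (intro sum_mono mult_left_mono t_nonneg Suc.IH) auto
  also have "\<dots> \<le> B * B ^ n"
    using row_sum[OF Suc.prems assms(1,2)] B_pos by (simp add: sum_distrib_right[symmetric])
  finally show ?case by simp
qed

lemma tpow_le:
  assumes "finite F" "F \<subseteq> I" "i \<in> I" "j \<in> F"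
  shows "tpow F t n i j \<le> B ^ n"
proof -
  have "tpow F t n i j \<le> (\<Sum>j\<in>F. tpow F t n i j)"
    using assms by (intro member_le_sum tpow_nonneg) auto
  also have "\<dots> \<le> B ^ n" by (rule tpow_row_sum) fact+
  finally show ?thesis .
qed

definition trace_pow :: "'i set \<Rightarrow> nat \<Rightarrow> real" where
  "trace_pow F n = (\<Sum>k\<in>F. tpow F t n k k)"

lemma summable_tpow:
  assumes "finite F" "F \<subseteq> I" "i \<in> F" "j \<in> F" "norm u * B < 1"
  shows "summable (\<lambda>n. u ^ n * of_real (tpow F t (n + m) i j) :: complex)"
proof (rule summable_comparison_test')
  show "summable (\<lambda>n. B ^ m * (norm u * B) ^ n)"
    using assms B_pos by (intro summable_mult summable_geometric) auto
  fix n :: nat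
  have "tpow F t (n + m) i j \<le> B ^ (n + m)" "0 \<le> tpow F t (n + m) i j"
    using assms by (auto intro!: tpow_le tpow_nonneg)
  then have "norm u ^ n * tpow F t (n + m) i j \<le> norm u ^ n * B ^ (n + m)"
    by (intro mult_left_mono) auto
  with \<open>0 \<le> tpow F t (n + m) i j\<close>
  show "norm (u ^ n * of_real (tpow F t (n + m) i j)) \<le> B ^ m * (norm u * B) ^ n"
    by (simp add: norm_mult norm_power power_mult_distrib power_add mult_ac)
qed

text \<open>
  With \<open>R = (\<Sum>n. u ^ n * t ^ n)\<close> the resolvent of the restriction to \<open>F\<close>, this is
  \<open>t = (t R) (1 - u t)\<close>. It expresses the rows of \<open>t\<close>, which are the derivatives of the rows of
  \<open>1 - u t\<close> up to sign, as combinations of the rows of \<open>1 - u t\<close> itself.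
\<close>

lemma char_matrix_rows:
  assumes "finite F" "F \<subseteq> I" "k \<in> F" "j \<in> F" "norm u * B < 1"
  shows "of_real (t k j) = (\<Sum>i\<in>F. (\<Sum>n. u ^ n * of_real (tpow F t (Suc n) k i)) * char_matrix t u i j)"
proof -
  have S: "summable (\<lambda>n. u ^ n * of_real (tpow F t (Suc n) k i) :: complex)" if "i \<in> F" for i
    using summable_tpow[OF assms(1,2,3) that assms(5), of 1] by simp
  have j: "summable (\<lambda>n. u ^ n * of_real (tpow F t (Suc n) k j) :: complex)"
    using S[of j] assms by simp
  have "(\<Sum>i\<in>F. (\<Sum>n. u ^ n * of_real (tpow F t (Suc n) k i)) * char_matrix t u i j)
     = (\<Sum>n. u ^ n * of_real (tpow F t (Suc n) k j)) -
       (\<Sum>i\<in>F. (\<Sum>n. u ^ n * of_real (tpow F t (Suc n) k i)) * (u * of_real (t i j)))"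
    using assms by (simp add: char_matrix_def right_diff_distrib sum_subtractf
       if_distrib[of "\<lambda>x. _ * x"] del: tpow.simps cong: if_cong)
  also have "(\<Sum>i\<in>F. (\<Sum>n. u ^ n * of_real (tpow F t (Suc n) k i)) * (u * of_real (t i j)))
      = (\<Sum>n. \<Sum>i\<in>F. (u ^ n * of_real (tpow F t (Suc n) k i)) * (u * of_real (t i j)))"
  proof (subst suminf_sum)
    fix i assume "i \<in> F"
    with S show "summable (\<lambda>n. (u ^ n * of_real (tpow F t (Suc n) k i)) * (u * of_real (t i j)))"
      by (intro summable_mult2)
  next
    show "(\<Sum>i\<in>F. (\<Sum>n. u ^ n * of_real (tpow F t (Suc n) k i)) * (u * of_real (t i j))) =
      (\<Sum>i\<in>F. (\<Sum>n. (u ^ n * of_real (tpow F t (Suc n) k i)) * (u * of_real (t i j))))"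
      by (intro sum.cong refl suminf_mult2 S)
  qed
  also have "\<dots> = (\<Sum>n. u ^ Suc n * of_real (tpow F t (Suc (Suc n)) k j))"
    using assms(1,3,4)
    by (simp del: tpow.simps add: tpow_Suc_right[of F k j t "Suc _"] sum_distrib_left of_real_sum mult_ac)
  also have "\<dots> = (\<Sum>n. u ^ n * of_real (tpow F t (Suc n) k j)) - u ^ 0 * of_real (tpow F t (Suc 0) k j)"
    using suminf_split_head[OF j] by simp
  also have "tpow F t (Suc 0) k j = t k j" using assms by (simp add: if_distrib cong: if_cong)
  finally show ?thesis by simp
qed

text \<open>
  Both sides have value \<open>1\<close> at \<open>u = 0\<close> and logarithmic derivative
  \<open>- (\<Sum>n. trace_pow F (n + 1) * u ^ n)\<close>. For the determinant this is the product rule, where each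
  differentiated row is a combination of all rows by \<open>char_matrix_rows\<close>.
\<close>

lemma Det_char_matrix_eq_exp:
  assumes F: "finite F" "F \<subseteq> I" and u: "norm u * B < 1"
  shows "Det F (char_matrix t u) = exp (- (\<Sum>n. of_real (trace_pow F n / real n) * u ^ n))"
proof -
  let ?a = "\<lambda>n. of_real (trace_pow F n / real n) :: complex"
  let ?L = "\<lambda>u. \<Sum>n. ?a n * u ^ n"
  let ?S = "ball (0::complex) (1 / B)"
  let ?f = "\<lambda>u. Det F (char_matrix t u)"
  have tr: "\<bar>trace_pow F n\<bar> \<le> real (card F) * B ^ n" for n
  proof -
    have "\<bar>trace_pow F n\<bar> \<le> (\<Sum>k\<in>F. B ^ n)" unfolding trace_pow_def
      using F by (intro order_trans[OF sum_abs] sum_mono) (auto intro!: tpow_le simp: abs_of_nonneg tpow_nonneg subset_iff)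
    then show ?thesis by simp
  qed
  have sm: "summable (\<lambda>n. ?a n * v ^ n)" if "norm v * B < 1" for v
  proof (rule summable_comparison_test')
    show "summable (\<lambda>n. real (card F) * (norm v * B) ^ n)"
      using that B_pos by (intro summable_mult summable_geometric) auto
    fix n :: nat
    have "norm (?a n * v ^ n) = \<bar>trace_pow F n\<bar> / real n * norm v ^ n"
      by (simp add: norm_mult norm_power norm_divide)
    also have "\<dots> \<le> \<bar>trace_pow F n\<bar> * norm v ^ n"
      by (cases n) (auto intro!: mult_right_mono simp: field_simps)
    also have "\<dots> \<le> real (card F) * B ^ n * norm v ^ n"
      by (intro mult_right_mono tr) auto
    finally show "norm (?a n * v ^ n) \<le> real (card F) * (norm v * B) ^ n"
      by (simp add: power_mult_distrib mult_ac)
  qed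
  have DL: "(?L has_field_derivative (\<Sum>n. of_real (trace_pow F (Suc n)) * v ^ n)) (at v)"
    if v: "v \<in> ?S" for v
  proof -
    \<comment> \<open>A radius strictly between \<open>norm v\<close> and the radius of convergence.\<close>
    define K where "K = (norm v + 1 / B) / 2"
    have K: "norm v < K" "K * B < 1"
      using v B_pos by (auto simp: K_def field_simps)
    have K0: "0 \<le> K" using K(1) norm_ge_zero[of v] by linarith
    have "(?L has_field_derivative (\<Sum>n. diffs ?a n * v ^ n)) (at v)"
      by (rule termdiffs_strong[of _ "of_real K"]) (use K K0 sm[of "of_real K"] in auto)
    moreover have "diffs ?a = (\<lambda>n. of_real (trace_pow F (Suc n)))"
      by (auto simp: diffs_def fun_eq_iff simp del: of_nat_Suc)
    ultimately show ?thesis by simp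
  qed
  have Df: "(?f has_field_derivative - (\<Sum>n. of_real (trace_pow F (Suc n)) * v ^ n) * ?f v) (at v)"
    if v: "v \<in> ?S" for v
  proof -
    have v': "norm v * B < 1" using v B_pos by (simp add: field_simps)
    let ?y = "\<lambda>k i. \<Sum>n. v ^ n * of_real (tpow F t (Suc n) k i) :: complex"
    have "(\<Sum>k\<in>F. Det F ((char_matrix t v)(k := \<lambda>j. - of_real (t k j)))) = (\<Sum>k\<in>F. - ?y k k * ?f v)"
    proof (intro sum.cong refl)
      fix k assume k: "k \<in> F"
      show "Det F ((char_matrix t v)(k := \<lambda>j. - of_real (t k j))) = - ?y k k * ?f v"
        by (rule Det_row_combination[where x = "\<lambda>i. - ?y k i"])
          (use F k v' in \<open>auto simp: char_matrix_rows sum_negf simp del: tpow.simps\<close>)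
    qed
    also have "\<dots> = - (\<Sum>k\<in>F. ?y k k) * ?f v"
      by (simp add: sum_distrib_right sum_negf)
    also have "(\<Sum>k\<in>F. ?y k k) = (\<Sum>n. \<Sum>k\<in>F. v ^ n * of_real (tpow F t (Suc n) k k))"
      using F v' summable_tpow[of F _ _ v 1] by (subst suminf_sum) auto
    also have "\<dots> = (\<Sum>n. of_real (trace_pow F (Suc n)) * v ^ n)"
      by (simp add: trace_pow_def sum_distrib_left mult_ac del: tpow.simps)
    finally show ?thesis using Det_char_matrix_deriv[OF F(1), of t v] by (simp only:)
  qed
  have "\<exists>c. \<forall>v\<in>?S. ?f v * exp (?L v) = c"
  proof (rule has_field_derivative_zero_constant)
    fix v assume v: "v \<in> ?S"
    show "((\<lambda>v. ?f v * exp (?L v)) has_field_derivative 0) (at v within ?S)"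
    proof (rule has_field_derivative_at_within, rule DERIV_cong)
      show "((\<lambda>v. ?f v * exp (?L v)) has_field_derivative
          (- (\<Sum>n. of_real (trace_pow F (Suc n)) * v ^ n) * ?f v) * exp (?L v) +
          (exp (?L v) * (\<Sum>n. of_real (trace_pow F (Suc n)) * v ^ n)) * ?f v) (at v)"
        by (rule DERIV_mult[OF Df[OF v] DERIV_chain2[OF DERIV_exp DL[OF v]]])
      have "(- a * b) * c + (c * a) * b = 0" for a b c :: complex by (simp add: mult_ac)
      then show "(- (\<Sum>n. of_real (trace_pow F (Suc n)) * v ^ n) * ?f v) * exp (?L v) +
          (exp (?L v) * (\<Sum>n. of_real (trace_pow F (Suc n)) * v ^ n)) * ?f v = 0" .
    qed
  qed simp
  then obtain c where c: "\<And>v. v \<in> ?S \<Longrightarrow> ?f v * exp (?L v) = c" by blast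
  have "?f 0 = 1"
  proof -
    let ?One = "\<lambda>i j. if i = j then 1 else 0 :: complex"
    have "?f 0 = Det F ?One" by (simp add: char_matrix_def[abs_def])
    also have "\<dots> = Det ({} :: 'i set) ?One"
      using F(1)
    proof (induction F rule: finite_induct)
      case (insert x F)
      then show ?case by (subst Det_unit_column) auto
    qed simp
    finally show ?thesis by (simp add: Det_def)
  qed
  moreover have "?L 0 = 0" using powser_zero[of ?a] by simp
  ultimately have "c = 1" using c[of 0] B_pos by simp
  moreover have "u \<in> ?S" using u B_pos by (simp add: field_simps)
  ultimately have "?f u * exp (?L u) = 1" using c by blast
  then show ?thesis by (simp add: exp_minus field_simps)
qed

end

section \<open>Eliminating a chain\<close>

definition with_entry :: "('i \<Rightarrow> 'i \<Rightarrow> complex) \<Rightarrow> 'i \<Rightarrow> 'i \<Rightarrow> complex \<Rightarrow> 'i \<Rightarrow> 'i \<Rightarrow> complex" where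
  "with_entry A a b x = A(a := (A a)(b := x))"

text \<open>
  The nested expression \<open>\<alpha> 0 + \<beta> 0 * (\<alpha> 1 + \<beta> 1 * (\<dots> (\<alpha> (n - 1) + \<beta> (n - 1) * s)))\<close>.
\<close>

primrec nested :: "(nat \<Rightarrow> complex) \<Rightarrow> (nat \<Rightarrow> complex) \<Rightarrow> nat \<Rightarrow> complex \<Rightarrow> complex" where
  "nested \<alpha> \<beta> 0 s = s"
| "nested \<alpha> \<beta> (Suc n) s = nested \<alpha> \<beta> n (\<alpha> n + \<beta> n * s)"

lemma nested_eq_sum:
  "nested \<alpha> \<beta> n s = (\<Sum>k<n. \<alpha> k * (\<Prod>j<k. \<beta> j)) + (\<Prod>j<n. \<beta> j) * s"
  by (induction n arbitrary: s) (auto simp: algebra_simps)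

text \<open>
  A truncated cusp section \<open>e 0, \<dots>, e n, f n, \<dots>, f 0\<close> is attached to the rest \<open>G\<close> of the index set at
  \<open>e 0\<close> and \<open>f 0\<close> only. Eliminating \<open>e n\<close> and then \<open>f n\<close> contributes to the entry at
  \<open>(e (n - 1), f (n - 1))\<close> the weight of the detour through them, and the section shrinks by one layer
  of the same shape. The statement allows an arbitrary entry \<open>- s\<close> at the tip so that
  this can be iterated.
\<close>

lemma Det_chain:
  fixes e f :: "nat \<Rightarrow> 'i" and G :: "'i set"
  defines "S \<equiv> \<lambda>n. G \<union> e ` {1..n} \<union> f ` {1..n}"
  assumes G: "finite G" "e 0 \<in> G" "f 0 \<in> G" "\<And>n. e (Suc n) \<notin> G" "\<And>n. f (Suc n) \<notin> G"
    and dist: "inj e" "inj f" "\<And>m n. e m \<noteq> f n"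
    and colE: "\<And>n i. i \<in> G \<union> range e \<union> range f \<Longrightarrow>
        A i (e (Suc n)) = (if i = e (Suc n) then 1 else if i = e n then - u else 0)"
    and colF: "\<And>n i. i \<in> G \<union> range e \<union> range f \<Longrightarrow>
        A i (f (Suc n)) = (if i = f (Suc n) then 1 else if i = e (Suc n) then - \<alpha> (Suc n)
          else if i = f (Suc (Suc n)) then - \<beta> (Suc n) else 0)"
    and rowE: "\<And>n i. i \<in> G \<union> range e \<union> range f \<Longrightarrow>
        A (e (Suc n)) i = (if i = e (Suc n) then 1 else if i = e (Suc (Suc n)) then - u
          else if i = f (Suc n) then - \<alpha> (Suc n) else 0)"
    and rowF: "\<And>n i. i \<in> G \<union> range e \<union> range f \<Longrightarrow>
        A (f (Suc n)) i = (if i = f (Suc n) then 1 else if i = f n then - \<beta> n else 0)"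
    and entry: "A (e 0) (f 0) = - \<alpha> 0"
  shows "Det (S n) (with_entry A (e n) (f n) (- s)) =
     Det G (with_entry A (e 0) (f 0) (- nested \<alpha> (\<lambda>n. u * \<beta> n) n s))"
proof (induction n arbitrary: s)
  case 0
  then show ?case by (simp add: S_def)
next
  case (Suc n)
  let ?e = "e (Suc n)" and ?f = "f (Suc n)"
  define M where "M = with_entry A ?e ?f (- s)"
  define M1 where "M1 = M(e n := \<lambda>j. M (e n) j - M (e n) ?e * M ?e j)"
  define M2 where "M2 = M1(e n := \<lambda>j. M1 (e n) j - M1 (e n) ?f * M1 ?f j)"
  have ee: "e i = e j \<longleftrightarrow> i = j" and ff: "f i = f j \<longleftrightarrow> i = j" for i j
    using dist by (auto simp: inj_eq)
  have ef: "e i \<noteq> f j" "f j \<noteq> e i" for i j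
    using dist(3)[of i j] by auto
  have enS: "e n \<in> S n" "f n \<in> S n" using G by (cases n; auto simp: S_def)+
  have sub: "S n \<subseteq> G \<union> range e \<union> range f" by (auto simp: S_def)
  have notin: "e (Suc m) \<notin> S n" "f (Suc m) \<notin> S n" if "n \<le> m" for m
    using that G(4,5)[of m] by (auto simp: S_def ee ff ef)
  have diff: "i \<noteq> ?e" "i \<noteq> ?f" "i \<noteq> e (Suc (Suc n))" "i \<noteq> f (Suc (Suc n))" if "i \<in> S n" for i
    using that notin[of n] notin[of "Suc n"] by auto
  have S_Suc: "S (Suc n) = insert ?e (insert ?f (S n))"
    by (auto simp: S_def atLeastAtMostSuc_conv)
  have fin: "finite (S n)" using G by (auto simp: S_def)
  have all: "e i \<in> G \<union> range e \<union> range f" "f i \<in> G \<union> range e \<union> range f" for i by auto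
  have "Det (S (Suc n)) M = Det (insert ?f (S n)) M1"
    unfolding S_Suc M1_def
  proof (rule Det_eliminate)
    show "M ?e ?e = 1" using colE[OF all(1), of "Suc n"] by (simp add: M_def with_entry_def ef)
    fix i assume i: "i \<in> insert ?f (S n)" "i \<noteq> e n"
    then have "i \<in> G \<union> range e \<union> range f" "i \<noteq> ?e" using sub diff by (auto simp: ef)
    then show "M i ?e = 0" using colE[of i n] i by (simp add: M_def with_entry_def ef)
  qed (use fin notin[of n] enS in \<open>auto simp: ef\<close>)
  also have "\<dots> = Det (S n) M2"
    unfolding M2_def
  proof (rule Det_eliminate)
    show "M1 ?f ?f = 1" using colF[OF all(2), of "Suc n"] by (simp add: M1_def M_def with_entry_def ef)
    fix i assume i: "i \<in> S n" "i \<noteq> e n"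
    then show "M1 i ?f = 0" using colF[of i n] sub diff[of i] by (auto simp: M1_def M_def with_entry_def ef)
  qed (use fin notin[of n] enS in \<open>auto simp: ef\<close>)
  also have "\<dots> = Det (S n) (with_entry A (e n) (f n) (- (\<alpha> n + (u * \<beta> n) * s)))"
  proof (rule Det_cong)
    fix i j assume ij: "i \<in> S n" "j \<in> S n"
    show "M2 i j = with_entry A (e n) (f n) (- (\<alpha> n + (u * \<beta> n) * s)) i j"
    proof (cases "i = e n")
      case False
      then show ?thesis using ij diff[of i] by (simp add: M2_def M1_def M_def with_entry_def)
    next
      case True
      have Me: "M (e n) j' = A (e n) j'" for j' by (simp add: M_def with_entry_def ee)
      have 1: "A (e n) ?e = - u" using colE[OF all(1), of n n] by (simp add: ee)
      have 2: "A (e n) ?f = 0" using colF[OF all(1), of n n] by (simp add: ee ef)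
      have 3: "M ?e j = 0" using rowE[of j n] ij sub diff[of j] by (auto simp: M_def with_entry_def)
      have 4: "M ?e ?f = - s" by (simp add: M_def with_entry_def)
      have 5: "M1 ?f j = (if j = f n then - \<beta> n else 0)"
        using rowF[of j n] ij sub diff[of j] by (auto simp: M1_def M_def with_entry_def ef)
      have 6: "A (e n) (f n) = - \<alpha> n"
        using entry rowE[OF all(2), of "n - 1" n] by (cases n) (auto simp: ef ff)
      show ?thesis using True
        using ij 3 by (simp add: M2_def 5) (auto simp: M1_def Me 1 2 4 with_entry_def 6 algebra_simps)
    qed
  qed
  also have "\<dots> = Det G (with_entry A (e 0) (f 0) (- nested \<alpha> (\<lambda>n. u * \<beta> n) (Suc n) s))"
    by (simp only: Suc.IH nested.simps)
  finally show ?case by (simp only: M_def)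
qed

section \<open>Permanents\<close>

definition Perm :: "'i set \<Rightarrow> ('i \<Rightarrow> 'i \<Rightarrow> real) \<Rightarrow> real" where
  "Perm F M = (\<Sum>\<sigma> | \<sigma> permutes F. \<Prod>i\<in>F. M i (\<sigma> i))"

lemma prod_add_ge_first_order:
  fixes a b :: "'i \<Rightarrow> real"
  assumes "finite F" "\<And>i. i \<in> F \<Longrightarrow> 0 \<le> a i" "\<And>i. i \<in> F \<Longrightarrow> 0 \<le> b i"
  shows "(\<Prod>i\<in>F. a i) + (\<Sum>i\<in>F. b i * (\<Prod>j\<in>F - {i}. a j)) \<le> (\<Prod>i\<in>F. a i + b i)"
  using assms
proof (induction F rule: finite_induct)
  case (insert k F)
  have eq: "(\<Sum>i\<in>F. b i * (\<Prod>j\<in>insert k F - {i}. a j)) = a k * (\<Sum>i\<in>F. b i * (\<Prod>j\<in>F - {i}. a j))"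
    unfolding sum_distrib_left
  proof (intro sum.cong refl)
    fix i assume "i \<in> F"
    then have "insert k F - {i} = insert k (F - {i})" using insert by auto
    then show "b i * (\<Prod>j\<in>insert k F - {i}. a j) = a k * (b i * (\<Prod>j\<in>F - {i}. a j))"
      using insert by simp
  qed
  have "(\<Prod>i\<in>insert k F. a i) + (\<Sum>i\<in>insert k F. b i * (\<Prod>j\<in>insert k F - {i}. a j)) =
     a k * ((\<Prod>i\<in>F. a i) + (\<Sum>i\<in>F. b i * (\<Prod>j\<in>F - {i}. a j))) + b k * (\<Prod>i\<in>F. a i)"
    using insert by (simp add: eq algebra_simps)
  also have "\<dots> \<le> a k * (\<Prod>i\<in>F. a i + b i) + b k * (\<Prod>i\<in>F. a i + b i)"
    using insert by (intro add_mono mult_left_mono prod_mono insert.IH) auto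
  finally show ?case using insert by (simp add: algebra_simps)
qed simp

text \<open>
  Permutations of \<open>insert k F\<close> arise from those of \<open>F\<close> by inserting \<open>k\<close> into at most one arrow
  \<open>i \<mapsto> q i\<close>. The right-hand side also counts insertions into several arrows at once, which is harmless
  because all entries are nonnegative.
\<close>

lemma Perm_eliminate:
  assumes F: "finite F" "k \<notin> F" and "M k k = 1"
    and M: "\<And>i j. i \<in> insert k F \<Longrightarrow> j \<in> insert k F \<Longrightarrow> 0 \<le> M i j"
  shows "Perm (insert k F) M \<le> Perm F (\<lambda>i j. M i j + M i k * M k j)"
proof -
  have "Perm (insert k F) M = (\<Sum>b\<in>insert k F. \<Sum>q | q permutes F.
      \<Prod>i\<in>insert k F. M i ((Transposition.transpose k b \<circ> q) i))"
    unfolding Perm_def by (rule sum_over_permutations_insert) (use F in auto)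
  also have "\<dots> = (\<Sum>q | q permutes F. \<Sum>b\<in>insert k F.
      \<Prod>i\<in>insert k F. M i ((Transposition.transpose k b \<circ> q) i))"
    by (rule sum.swap)
  also have "\<dots> \<le> (\<Sum>q | q permutes F. \<Prod>i\<in>F. M i (q i) + M i k * M k (q i))"
  proof (rule sum_mono)
    fix q assume "q \<in> {q. q permutes F}"
    then have q: "q permutes F" by simp
    have qk: "q k = k" using q F by (simp add: permutes_not_in)
    have qF: "q i \<in> F \<longleftrightarrow> i \<in> F" for i using q by (simp add: permutes_in_image)
    let ?T = "\<lambda>b. \<Prod>i\<in>insert k F. M i ((Transposition.transpose k b \<circ> q) i)"
    have "?T k = (\<Prod>i\<in>F. M i (q i))" using F qk \<open>M k k = 1\<close> by simp
    moreover have "(\<Sum>b\<in>F. ?T b) = (\<Sum>i\<in>F. ?T (q i))"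
      using sum.permute[OF q, of ?T] by simp
    moreover have "(\<Sum>i\<in>F. ?T (q i)) = (\<Sum>i\<in>F. (M i k * M k (q i)) * (\<Prod>j\<in>F - {i}. M j (q j)))"
    proof (intro sum.cong refl)
      fix i assume i: "i \<in> F"
      have "?T (q i) = M k (q i) * (\<Prod>j\<in>F. M j (Transposition.transpose k (q i) (q j)))"
        using F qk by simp
      also have "(\<Prod>j\<in>F. M j (Transposition.transpose k (q i) (q j))) =
         M i k * (\<Prod>j\<in>F - {i}. M j (Transposition.transpose k (q i) (q j)))"
        using F i by (simp add: prod.remove[of F i])
      also have "(\<Prod>j\<in>F - {i}. M j (Transposition.transpose k (q i) (q j))) = (\<Prod>j\<in>F - {i}. M j (q j))"
      proof (intro prod.cong refl)
        fix j assume "j \<in> F - {i}"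
        then have "q j \<noteq> q i" "q j \<noteq> k"
          using F qF permutes_inj[OF q] by (auto dest: injD) 
        then show "M j (Transposition.transpose k (q i) (q j)) = M j (q j)"
          by (simp add: Transposition.transpose_def)
      qed
      finally show "?T (q i) = (M i k * M k (q i)) * (\<Prod>j\<in>F - {i}. M j (q j))" by simp
    qed
    moreover have "(\<Prod>i\<in>F. M i (q i)) + (\<Sum>i\<in>F. (M i k * M k (q i)) * (\<Prod>j\<in>F - {i}. M j (q j)))
       \<le> (\<Prod>i\<in>F. M i (q i) + M i k * M k (q i))"
      using F qF by (intro prod_add_ge_first_order) (auto intro!: M mult_nonneg_nonneg)
    ultimately show "(\<Sum>b\<in>insert k F. ?T b) \<le> (\<Prod>i\<in>F. M i (q i) + M i k * M k (q i))"
      using F by (subst sum.insert) linarith+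
  qed
  finally show ?thesis by (simp add: Perm_def)
qed

lemma Perm_le_prod_row_sums:
  assumes F: "finite F" and M: "\<And>i j. i \<in> F \<Longrightarrow> j \<in> F \<Longrightarrow> 0 \<le> M i j"
  shows "Perm F M \<le> (\<Prod>i\<in>F. \<Sum>j\<in>F. M i j)"
proof -
  have inj: "inj_on (\<lambda>\<sigma>. (\<lambda>x\<in>F. \<sigma> x)) {\<sigma>. \<sigma> permutes F}"
  proof (rule inj_onI)
    fix \<sigma> \<tau> assume st: "\<sigma> \<in> {\<sigma>. \<sigma> permutes F}" "\<tau> \<in> {\<sigma>. \<sigma> permutes F}" "(\<lambda>x\<in>F. \<sigma> x) = (\<lambda>x\<in>F. \<tau> x)"
    show "\<sigma> = \<tau>"
    proof
      fix x show "\<sigma> x = \<tau> x"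
        using st(1,2) fun_cong[OF st(3), of x] by (cases "x \<in> F") (auto simp: permutes_not_in restrict_apply)
    qed
  qed
  have "Perm F M = (\<Sum>g\<in>(\<lambda>\<sigma>. (\<lambda>x\<in>F. \<sigma> x)) ` {\<sigma>. \<sigma> permutes F}. \<Prod>i\<in>F. M i (g i))"
    unfolding Perm_def by (subst sum.reindex[OF inj]) (auto intro!: sum.cong prod.cong)
  also have "\<dots> \<le> (\<Sum>g\<in>PiE F (\<lambda>_. F). \<Prod>i\<in>F. M i (g i))"
    using F by (intro sum_mono2)
      (auto intro!: finite_PiE prod_nonneg M simp: permutes_in_image PiE_iff)
  also have "\<dots> = (\<Prod>i\<in>F. \<Sum>j\<in>F. M i j)"
    using F by (subst prod_sum_PiE) auto
  finally show ?thesis .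
qed

text \<open>
  Elimination of \<open>k \<in> S\<close> replaces \<open>N i j\<close> by \<open>N i j + N i k * N k j\<close>. Row sums do not grow, as the mass
  \<open>N i k\<close> is removed with column \<open>k\<close> and redistributed with total factor at most \<open>\<theta> \<le> 1\<close>, and
  the matrix stays strictly triangular on the rest of \<open>S\<close>. So \<open>S\<close> disappears altogether, and the bound
  depends on the size of \<open>F\<close> only.
\<close>

lemma Perm_le_of_triangular:
  fixes N :: "'i \<Rightarrow> 'i \<Rightarrow> real" and h :: "'i \<Rightarrow> real"
  assumes "finite F" "finite S" "F \<inter> S = {}"
    and "\<And>i j. i \<in> F \<union> S \<Longrightarrow> j \<in> F \<union> S \<Longrightarrow> 0 \<le> N i j"
    and "\<And>i. i \<in> F \<union> S \<Longrightarrow> (\<Sum>j\<in>F \<union> S. N i j) \<le> \<theta>"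
    and "\<And>i j. i \<in> S \<Longrightarrow> j \<in> S \<Longrightarrow> N i j \<noteq> 0 \<Longrightarrow> h i < h j"
    and "0 \<le> \<theta>" "\<theta> \<le> 1"
  shows "Perm (F \<union> S) (\<lambda>i j. (if i = j then 1 else 0) + N i j) \<le> (1 + \<theta>) ^ card F"
  using assms(2-6)
proof (induction S arbitrary: N rule: finite_induct)
  case empty
  have "Perm F (\<lambda>i j. (if i = j then 1 else 0) + N i j) \<le> (\<Prod>i\<in>F. \<Sum>j\<in>F. (if i = j then 1 else 0) + N i j)"
    using empty assms(1) by (intro Perm_le_prod_row_sums) auto
  also have "\<dots> \<le> (\<Prod>i\<in>F. 1 + \<theta>)"
    using empty assms(1) by (intro prod_mono) (auto simp: sum.distrib intro!: sum_nonneg add_nonneg_nonneg)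
  finally show ?case by simp
next
  case (insert k S)
  have Nkk: "N k k = 0" using insert.prems(4)[of k k] by auto
  let ?N = "\<lambda>i j. N i j + N i k * N k j"
  have nn: "0 \<le> N i j" if "i \<in> F \<union> insert k S" "j \<in> F \<union> insert k S" for i j
    using insert.prems(2) that by blast
  have fin: "finite (F \<union> S)" "k \<notin> F \<union> S" using insert assms(1) by auto
  have "Perm (insert k (F \<union> S)) (\<lambda>i j. (if i = j then 1 else 0) + N i j)
     \<le> Perm (F \<union> S) (\<lambda>i j. ((if i = j then 1 else 0) + N i j) +
        ((if i = k then 1 else 0) + N i k) * ((if k = j then 1 else 0) + N k j))"
    using fin Nkk nn by (intro Perm_eliminate) auto
  also have "\<dots> = Perm (F \<union> S) (\<lambda>i j. (if i = j then 1 else 0) + ?N i j)"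
    unfolding Perm_def
  proof (intro sum.cong prod.cong refl)
    fix q i assume "q \<in> {\<sigma>. \<sigma> permutes F \<union> S}" "i \<in> F \<union> S"
    then have "q i \<in> F \<union> S" "i \<noteq> k" using fin permutes_in_image[of q "F \<union> S" i] by auto
    moreover have "q i \<noteq> k" using calculation(1) fin by auto
    ultimately show "((if i = q i then 1 else 0) + N i (q i)) + ((if i = k then 1 else 0) + N i k) *
        ((if k = q i then 1 else 0) + N k (q i)) = (if i = q i then 1 else 0) + ?N i (q i)" by simp
  qed
  also have "\<dots> \<le> (1 + \<theta>) ^ card F"
  proof (rule insert.IH)
    show "F \<inter> S = {}" using insert by auto
    show "0 \<le> ?N i j" if "i \<in> F \<union> S" "j \<in> F \<union> S" for i j
      using that nn[of i j] nn[of i k] nn[of k j] by auto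
    show "(\<Sum>j\<in>F \<union> S. ?N i j) \<le> \<theta>" if i: "i \<in> F \<union> S" for i
    proof -
      have split: "(\<Sum>j\<in>F \<union> insert k S. N i' j) = N i' k + (\<Sum>j\<in>F \<union> S. N i' j)" for i'
        using fin by simp
      have "(\<Sum>j\<in>F \<union> S. N k j) \<le> 1"
        using insert.prems(3)[of k] split[of k] Nkk assms by simp
      then have "N i k * (\<Sum>j\<in>F \<union> S. N k j) \<le> N i k * 1"
        using nn[of i k] i by (intro mult_left_mono) auto
      then show ?thesis
        using insert.prems(3)[of i] split[of i] i by (simp add: sum.distrib sum_distrib_left[symmetric])
    qed
    show "h i < h j" if "i \<in> S" "j \<in> S" "?N i j \<noteq> 0" for i j
    proof (cases "N i j = 0")
      case True
      then have "N i k \<noteq> 0" "N k j \<noteq> 0" using that by auto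
      then have "h i < h k" "h k < h j" using insert.prems(4) that by blast+
      then show ?thesis by simp
    qed (use insert.prems(4) that in blast)
  qed
  finally show ?case by simp
qed

section \<open>Cyclic words\<close>

abbreviation wpow :: "'e list \<Rightarrow> nat \<Rightarrow> 'e list" where
  "wpow q m \<equiv> concat (replicate m q)"

lemma wpow_add: "wpow q (m + n) = wpow q m @ wpow q n"
  by (simp add: replicate_add)

lemma wpow_mult: "wpow (wpow q m) n = wpow q (m * n)"
  by (induction n) (auto simp: wpow_add)

lemma length_wpow: "length (wpow q m) = m * length q"
  by (induction m) auto

lemma wpow_Cons_snoc: "wpow (x # xs) m @ [x] = x # wpow (xs @ [x]) m"
  by (induction m) auto

lemma rotate1_wpow: "rotate1 (wpow q m) = wpow (rotate1 q) m"
proof (cases q)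
  case (Cons x xs)
  then show ?thesis
    using wpow_Cons_snoc[where x = x and xs = xs] by (cases m) auto
qed (induction m, auto)

lemma rotate_wpow: "rotate k (wpow q m) = wpow (rotate k q) m"
  by (induction k) (auto simp: rotate1_wpow)

lemma rotate_back: "\<exists>j. rotate j (rotate k p) = p"
proof (cases "p = []")
  case False
  have "rotate (length p - k mod length p) (rotate (k mod length p) p) = rotate (length p) p"
    unfolding rotate_rotate using False by (simp add: mod_le_divisor)
  then show ?thesis by (metis rotate_conv_mod rotate_id mod_self)
qed simp

text \<open>
  A special case of the fact that commuting words are powers of a common word, under a divisibility
  of lengths that makes one a power of the other: strip copies of \<open>xs\<close> from the front of \<open>ys\<close>.
\<close>

lemma commuting_dvd_imp_wpow:
  assumes "xs @ ys = ys @ xs" "length xs dvd length ys" "xs \<noteq> []"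
  shows "\<exists>k. ys = wpow xs k"
  using assms(1,2)
proof (induction ys rule: length_induct)
  case (1 ys)
  show ?case
  proof (cases "ys = []")
    case True
    then show ?thesis by (intro exI[of _ 0]) simp
  next
    case False
    then have "length xs \<le> length ys" using 1 by (auto dest: dvd_imp_le)
    then have "take (length xs) ys = xs" using 1(2)
      by (metis append_eq_conv_conj take_append diff_is_0_eq take_0 append_Nil2)
    then obtain zs where zs: "ys = xs @ zs" by (metis append_take_drop_id)
    then have "xs @ zs = zs @ xs" "length xs dvd length zs" "length zs < length ys"
      using 1 assms(3) by auto
    then obtain k where "zs = wpow xs k" using 1 by blast
    then show ?thesis using zs by (intro exI[of _ "Suc k"]) simp
  qed
qed

lemma rotate_fixed_imp_wpow:
  assumes "rotate d p = p" "d dvd length p" "0 < d" "p \<noteq> []"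
  shows "p = wpow (take d p) (length p div d)"
proof -
  have le: "d \<le> length p" using assms by (auto dest: dvd_imp_le)
  have "rotate d p = drop d p @ take d p"
  proof (cases "d = length p")
    case False
    then show ?thesis using le by (simp add: rotate_drop_take)
  qed simp
  then have "take d p @ drop d p = drop d p @ take d p" using assms(1) by simp
  moreover have "length (take d p) dvd length (drop d p)" "take d p \<noteq> []"
    using assms le by (auto intro: dvd_diff_nat)
  ultimately obtain k where "drop d p = wpow (take d p) k"
    using commuting_dvd_imp_wpow by blast
  then have p: "p = wpow (take d p) (Suc k)" by (metis append_take_drop_id concat.simps(2) replicate_Suc)
  then have "length p = Suc k * d" using le by (metis length_wpow length_take min.absorb2)
  then have "length p div d = Suc k" using assms by simp
  with p show ?thesis by simp
qed

definition period :: "'e list \<Rightarrow> nat" where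
  "period p = (LEAST d. 0 < d \<and> rotate d p = p)"

lemma period:
  assumes "p \<noteq> []"
  shows "0 < period p" "rotate (period p) p = p" "rotate d p = p \<Longrightarrow> period p dvd d"
proof -
  have "0 < length p \<and> rotate (length p) p = p" using assms by simp
  then have *: "0 < period p \<and> rotate (period p) p = p"
    unfolding period_def by (rule LeastI)
  then show "0 < period p" "rotate (period p) p = p" by auto
  assume d: "rotate d p = p"
  have "rotate (k * period p) p = p" for k
    by (induction k) (use * in \<open>auto simp: rotate_rotate[symmetric]\<close>)
  then have "rotate (d mod period p) p = rotate (d mod period p) (rotate (d div period p * period p) p)"
    by simp
  also have "\<dots> = rotate d p" unfolding rotate_rotate by simp
  finally have "rotate (d mod period p) p = p" using d by simp
  then have "\<not> 0 < d mod period p"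
    using not_less_Least[of "d mod period p" "\<lambda>d. 0 < d \<and> rotate d p = p"] *
    by (auto simp: period_def[symmetric])
  then show "period p dvd d" by auto
qed

definition primitive :: "'e list \<Rightarrow> bool" where
  "primitive p \<longleftrightarrow> p \<noteq> [] \<and> (\<forall>q m. 2 \<le> m \<longrightarrow> p \<noteq> wpow q m)"

text \<open>
  A word fixed by a rotation by fewer letters than it has is a proper power, since its least period
  divides its length.
\<close>

lemma primitive_iff_period: "primitive p \<longleftrightarrow> p \<noteq> [] \<and> period p = length p"
proof
  assume p: "primitive p"
  then have ne: "p \<noteq> []" by (simp add: primitive_def)
  have dvd: "period p dvd length p" using period(3)[OF ne, of "length p"] by simp
  have "p = wpow (take (period p) p) (length p div period p)"
    using rotate_fixed_imp_wpow[OF _ dvd] period[OF ne] ne by blast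
  then have "\<not> 2 \<le> length p div period p" using p by (auto simp: primitive_def)
  moreover have "length p div period p \<noteq> 0" using dvd ne by (auto simp: dvd_div_eq_0_iff)
  ultimately have "length p div period p = 1" by linarith
  then show "p \<noteq> [] \<and> period p = length p" using dvd ne by (metis dvd_div_mult_self mult_1)
next
  assume p: "p \<noteq> [] \<and> period p = length p"
  show "primitive p" unfolding primitive_def
  proof (intro conjI allI impI notI)
    fix q m assume m: "2 \<le> m" "p = wpow q m"
    have "rotate (length q) p = p" using m by (simp add: rotate_wpow)
    then have "period p dvd length q" using period(3) p by blast
    moreover have "length p = m * length q" using m length_wpow by blast
    moreover have "0 < length q" using p calculation(2) by (cases q) auto
    ultimately have "m * length q \<le> length q" using p by (metis dvd_imp_le)
    then show False using m \<open>0 < length q\<close> by simp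
  qed (use p in auto)
qed

lemma primitive_rotate: "primitive (rotate k p) \<longleftrightarrow> primitive p"
proof -
  have "primitive (rotate1 p)" if "primitive p" for p :: "'a list"
    unfolding primitive_def
  proof (intro conjI allI impI notI)
    fix q m assume m: "2 \<le> (m::nat)" "rotate1 p = wpow q m"
    have "rotate (length p - 1) (rotate1 p) = rotate (Suc (length p - 1)) p"
      by (simp only: rotate_Suc rotate1_rotate_swap)
    also have "Suc (length p - 1) = length p" using that by (simp add: primitive_def)
    finally have "p = rotate (length p - 1) (rotate1 p)" by simp
    then have "p = wpow (rotate (length p - 1) q) m" using m by (simp add: rotate_wpow)
    then show False using that m by (auto simp: primitive_def)
  qed (use that in \<open>auto simp: primitive_def\<close>)
  then have *: "primitive (rotate k p)" if "primitive p" for k and p :: "'a list"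
    using that by (induction k) auto
  show ?thesis
  proof
    assume "primitive (rotate k p)"
    moreover obtain j where "rotate j (rotate k p) = p" using rotate_back by blast
    ultimately show "primitive p" by (metis *)
  qed (rule *)
qed

text \<open>
  The length of a primitive root is determined by the word: it is the least period of all its powers.
\<close>

lemma primitive_root_unique:
  assumes "primitive q" "primitive r" "wpow q (Suc m) = wpow r (Suc n)"
  shows "q = r \<and> m = n"
proof -
  have *: "length q = period (wpow q (Suc m))" if "primitive q" for q :: "'a list" and m
  proof -
    let ?p = "wpow q (Suc m)"
    have ne: "?p \<noteq> []" "q \<noteq> []" using that by (auto simp: primitive_def)
    have "period ?p dvd length q" using period(3)[OF ne(1), of "length q"] by (simp add: rotate_wpow del: replicate_Suc)
    moreover have "period q dvd period ?p"
    proof -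
      have "wpow (rotate (period ?p) q) (Suc m) = wpow q (Suc m)"
        using period(2)[OF ne(1)] by (simp only: rotate_wpow)
      then have "rotate (period ?p) q = q" by (simp add: append_eq_append_conv)
      then show ?thesis using period(3) ne by blast
    qed
    ultimately show ?thesis using that by (auto simp: primitive_iff_period dvd_antisym)
  qed
  have "length q = length r" using *[OF assms(1), of m] *[OF assms(2), of n] assms(3) by simp
  moreover from this have "q = r" using assms(3) by simp
  moreover have "Suc m * length q = Suc n * length r" using assms(3) by (metis length_wpow)
  ultimately show ?thesis using assms(1) by (auto simp: primitive_def)
qed

lemma primitive_root_exists:
  assumes "p \<noteq> []"
  shows "\<exists>q m. primitive q \<and> p = wpow q (Suc m)"
  using assms
proof (induction p rule: length_induct)
  case (1 p)
  show ?case
  proof (cases "primitive p")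
    case True
    then show ?thesis by (intro exI[of _ p] exI[of _ 0]) simp
  next
    case False
    then obtain q m where m: "2 \<le> m" "p = wpow q m" using 1 by (auto simp: primitive_def)
    then have "q \<noteq> []" using 1(2) by (auto simp: concat_eq_Nil_conv)
    moreover from this have "length q < length p" using m length_wpow[of m q] by simp
    ultimately obtain r k where r: "primitive r" "q = wpow r (Suc k)" using 1 by blast
    then have "p = wpow r (Suc k * m)" using m(2) wpow_mult by metis
    moreover have "Suc k * m = Suc (Suc k * m - 1)" using m by simp
    ultimately show ?thesis using r by metis
  qed
qed

lemma cyclic_class_eq_image:
  assumes "p \<noteq> []"
  shows "cyclic_class p = (\<lambda>i. rotate i p) ` {..<length p}"
proof -
  have "rotate n p \<in> (\<lambda>i. rotate i p) ` {..<length p}" for n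
    using assms by (intro image_eqI[of _ _ "n mod length p"]) (auto simp: rotate_conv_mod[symmetric])
  then show ?thesis by (auto simp: cyclic_class_def)
qed

lemma cyclic_class_self: "p \<in> cyclic_class p"
  by (auto simp: cyclic_class_def intro: exI[of _ 0])

lemma cyclic_class_eq:
  assumes "q \<in> cyclic_class p"
  shows "cyclic_class q = cyclic_class p"
proof (cases "p = []")
  case True
  then show ?thesis using assms by (auto simp: cyclic_class_def)
next
  case False
  obtain k where k: "q = rotate k p" using assms by (auto simp: cyclic_class_def)
  obtain j where j: "rotate j q = p" using rotate_back[of k p] k by blast
  have "rotate n q \<in> cyclic_class p" for n using k by (auto simp: cyclic_class_def rotate_rotate)
  moreover have "rotate n p \<in> cyclic_class q" for n
    unfolding j[symmetric] by (auto simp: cyclic_class_def rotate_rotate)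
  ultimately show ?thesis by (auto simp: cyclic_class_def)
qed

lemma card_cyclic_class_primitive:
  assumes "primitive p"
  shows "finite (cyclic_class p)" "card (cyclic_class p) = length p"
proof -
  have ne: "p \<noteq> []" using assms by (simp add: primitive_def)
  have inj: "inj_on (\<lambda>i. rotate i p) {..<length p}"
  proof (rule linorder_inj_onI)
    fix i j assume ij: "i < j" "i \<in> {..<length p}" "j \<in> {..<length p}"
    show "rotate i p \<noteq> rotate j p"
    proof
      assume eq: "rotate i p = rotate j p"
      have "rotate (length p - i) (rotate i p) = p" using ij by (simp add: rotate_rotate)
      moreover have "rotate (length p - i) (rotate j p) = rotate (j - i) p"
      proof -
        have "rotate (length p - i) (rotate j p) = rotate (j - i) (rotate (length p) p)"
          unfolding rotate_rotate using ij by (intro arg_cong2[where f=rotate]) auto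
        then show ?thesis by simp
      qed
      ultimately have "rotate (j - i) p = p" using eq by simp
      then have "length p dvd j - i" using period(3)[OF ne, of "j - i"] assms by (simp add: primitive_iff_period)
      then show False using ij by (auto dest: dvd_imp_le)
    qed
  qed auto
  show "finite (cyclic_class p)" "card (cyclic_class p) = length p"
    using card_image[OF inj] by (auto simp: cyclic_class_eq_image[OF ne])
qed

lemma has_sum_minus_Ln:
  fixes z :: complex
  assumes "norm z < 1"
  shows "((\<lambda>m. z ^ Suc m / of_nat (Suc m)) has_sum - Ln (1 - z)) UNIV"
proof (rule norm_summable_imp_has_sum)
  show "summable (\<lambda>m. norm (z ^ Suc m / of_nat (Suc m)))"
  proof (rule summable_comparison_test')
    show "summable (\<lambda>m. norm z ^ m)" using assms by simp
    fix m :: nat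
    have "norm (z ^ Suc m / of_nat (Suc m)) = norm z ^ m * (norm z / real (Suc m))"
      by (simp add: norm_mult norm_power norm_divide del: of_nat_Suc)
    also have "\<dots> \<le> norm z ^ m * 1"
      using assms by (intro mult_left_mono) (auto simp: field_simps)
    finally show "norm (norm (z ^ Suc m / of_nat (Suc m))) \<le> norm z ^ m" by simp
  qed
  have "(\<lambda>n. (-1) ^ Suc n / of_nat n * (- z) ^ n) sums Ln (1 + - z)"
    using assms by (intro Ln_series) simp
  then have "(\<lambda>n. - ((-1) ^ Suc n / of_nat n * (- z) ^ n)) sums - Ln (1 - z)"
    by (intro sums_minus) simp
  moreover have "- ((-1) ^ Suc n / of_nat n * (- z) ^ n) = z ^ n / of_nat n" for n
  proof -
    have "- ((-1) ^ Suc n / of_nat n * (- z) ^ n) = ((-1) ^ n * (- z) ^ n) / of_nat n" by simp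
    also have "(-1) ^ n * (- z) ^ n = z ^ n" unfolding power_mult_distrib[symmetric] by simp
    finally show ?thesis .
  qed
  ultimately have "(\<lambda>n. z ^ n / of_nat n) sums - Ln (1 - z)" by (simp only:)
  then show "(\<lambda>m. z ^ Suc m / of_nat (Suc m)) sums - Ln (1 - z)"
    using sums_Suc_iff[of "\<lambda>n. z ^ n / of_nat n"] by simp
qed

text \<open>
  A set of words closed under rotation, powers and roots, with a multiplicative weight \<open>g\<close>. The
  summability assumption concerns the sum that becomes the logarithm of the product over primes.
\<close>

locale cyclic_language =
  fixes C :: "'e list set" and g :: "'e list \<Rightarrow> complex"
  assumes nonempty: "[] \<notin> C"
    and rotate1_closed: "p \<in> C \<Longrightarrow> rotate1 p \<in> C"
    and wpow_iff: "0 < m \<Longrightarrow> wpow q m \<in> C \<longleftrightarrow> q \<in> C"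
    and g_rotate1: "g (rotate1 p) = g p"
    and g_wpow: "g (wpow q m) = g q ^ m"
    and g_less: "p \<in> C \<Longrightarrow> norm (g p) < 1"
    and g_summable: "(\<lambda>p. norm (g p / of_nat (length p))) summable_on C"
begin

definition primes :: "'e list set set" where
  "primes = {c. (\<exists>p\<in>C. c = cyclic_class p) \<and> \<not> (\<exists>q m. q \<in> C \<and> 2 \<le> m \<and> c = cyclic_class (wpow q m))}"

lemma rotate_closed: "p \<in> C \<Longrightarrow> rotate k p \<in> C"
  by (induction k) (auto intro: rotate1_closed)

lemma g_rotate: "g (rotate k p) = g p"
  by (induction k) (auto simp: g_rotate1)

lemma primes_eq: "primes = cyclic_class ` {p \<in> C. primitive p}"
proof (intro equalityI subsetI)
  fix c assume "c \<in> primes"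
  then obtain p where p: "p \<in> C" "c = cyclic_class p" and
    np: "\<And>q m. q \<in> C \<Longrightarrow> 2 \<le> m \<Longrightarrow> c \<noteq> cyclic_class (wpow q m)"
    by (auto simp: primes_def)
  have "primitive p" unfolding primitive_def
  proof (intro conjI allI impI notI)
    fix q m assume m: "2 \<le> m" "p = wpow q m"
    then have "q \<in> C" using wpow_iff[of m q] p by simp
    then show False using np m p by blast
  qed (use p nonempty in auto)
  then show "c \<in> cyclic_class ` {p \<in> C. primitive p}" using p by auto
next
  fix c assume "c \<in> cyclic_class ` {p \<in> C. primitive p}"
  then obtain p where p: "p \<in> C" "primitive p" "c = cyclic_class p" by auto
  have False if "q \<in> C" "2 \<le> m" "c = cyclic_class (wpow q m)" for q m
  proof -
    have "p \<in> cyclic_class (wpow q m)" using that p cyclic_class_self by blast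
    then obtain k where "p = wpow (rotate k q) m" by (auto simp: cyclic_class_def rotate_wpow)
    then show False using p that by (auto simp: primitive_def)
  qed
  then show "c \<in> primes" using p by (auto simp: primes_def)
qed

lemma mem_prime:
  assumes "c \<in> primes" "q \<in> c"
  shows "q \<in> C" "primitive q" "c = cyclic_class q"
proof -
  obtain p where p: "p \<in> C" "primitive p" "c = cyclic_class p" using assms(1) by (auto simp: primes_eq)
  then obtain k where "q = rotate k p" using assms(2) by (auto simp: cyclic_class_def)
  with p show "q \<in> C" "primitive q" by (auto simp: rotate_closed primitive_rotate)
  show "c = cyclic_class q" using cyclic_class_eq[of q p] assms(2) p by simp
qed

text \<open>
  Every word is a power, in exactly one way, of a primitive word, and each primitive word lies in
  exactly one prime class.
\<close>

lemma bij_powers: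
  "bij_betw (\<lambda>(c, q, m). wpow q (Suc m)) (Sigma primes (\<lambda>c. c \<times> UNIV)) C"
  unfolding bij_betw_def
proof
  show "inj_on (\<lambda>(c, q, m). wpow q (Suc m)) (Sigma primes (\<lambda>c. c \<times> UNIV))"
  proof (rule inj_onI)
    fix x y
    assume xy: "x \<in> Sigma primes (\<lambda>c. c \<times> UNIV)" "y \<in> Sigma primes (\<lambda>c. c \<times> UNIV)"
      "(\<lambda>(c, q, m). wpow q (Suc m)) x = (\<lambda>(c, q, m). wpow q (Suc m)) y"
    obtain c q m c' q' m' where eq: "x = (c, q, m)" "y = (c', q', m')" by (metis prod_cases3)
    with xy have *: "c \<in> primes" "q \<in> c" "c' \<in> primes" "q' \<in> c'" "wpow q (Suc m) = wpow q' (Suc m')"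
      by auto
    then have "q = q' \<and> m = m'" by (intro primitive_root_unique) (auto dest: mem_prime)
    moreover from this have "c = c'" using * mem_prime(3)[of c q] mem_prime(3)[of c' q'] by simp
    ultimately show "x = y" by (simp add: eq)
  qed
  show "(\<lambda>(c, q, m). wpow q (Suc m)) ` Sigma primes (\<lambda>c. c \<times> UNIV) = C"
  proof (intro equalityI subsetI)
    fix p assume "p \<in> (\<lambda>(c, q, m). wpow q (Suc m)) ` Sigma primes (\<lambda>c. c \<times> UNIV)"
    then obtain c q m where "c \<in> primes" "q \<in> c" "p = wpow q (Suc m)" by auto
    then show "p \<in> C" using wpow_iff[of "Suc m" q] mem_prime(1) by auto
  next
    fix p assume p: "p \<in> C"
    then have "p \<noteq> []" using nonempty by auto
    then obtain q m where q: "primitive q" "p = wpow q (Suc m)" using primitive_root_exists by blast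
    then have "q \<in> C" using wpow_iff[of "Suc m" q] p by auto
    then have "(cyclic_class q, q, m) \<in> Sigma primes (\<lambda>c. c \<times> UNIV)"
      using q cyclic_class_self by (auto simp: primes_eq)
    then show "p \<in> (\<lambda>(c, q, m). wpow q (Suc m)) ` Sigma primes (\<lambda>c. c \<times> UNIV)"
      using q(2) by (intro image_eqI) auto
  qed
qed

text \<open>
  A prime class \<open>c\<close> consists of \<open>n\<close> words of length \<open>n\<close>, all of the same weight \<open>z\<close>. The \<open>m\<close>-th powers of these
  words contribute \<open>n * z ^ m / (m * n)\<close>, and summation over \<open>m\<close> gives \<open>- Ln (1 - z)\<close>.
\<close>

theorem has_sum_primes:
  "((\<lambda>c. - Ln (1 - g (SOME p. p \<in> c))) has_sum (\<Sum>\<^sub>\<infinity>p\<in>C. g p / of_nat (length p))) primes"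
proof -
  let ?\<phi> = "\<lambda>p. g p / of_nat (length p)"
  let ?f = "\<lambda>(c :: 'e list set, q, m). ?\<phi> (wpow q (Suc m))"
  have summ: "?\<phi> summable_on C" using g_summable by (rule abs_summable_summable)
  have s1: "?f summable_on Sigma primes (\<lambda>c. c \<times> UNIV)"
    using summable_on_reindex_bij_betw[OF bij_powers, of ?\<phi>] summ by (simp add: case_prod_unfold)
  have e1: "(\<Sum>\<^sub>\<infinity>p\<in>C. ?\<phi> p) = (\<Sum>\<^sub>\<infinity>x\<in>Sigma primes (\<lambda>c. c \<times> UNIV). ?f x)"
    using infsum_reindex_bij_betw[OF bij_powers, of ?\<phi>] by (simp add: case_prod_unfold)
  have inner: "(\<Sum>\<^sub>\<infinity>(q, m)\<in>c \<times> UNIV. ?\<phi> (wpow q (Suc m))) = - Ln (1 - g (SOME p. p \<in> c))"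
    if c: "c \<in> primes" for c
  proof -
    define z where "z = g (SOME p. p \<in> c)"
    obtain p where p: "p \<in> C" "primitive p" "c = cyclic_class p" using c by (auto simp: primes_eq)
    have gq: "g q = z" "length q = length p" if "q \<in> c" for q
    proof -
      have "(SOME p. p \<in> c) \<in> c" using that by (rule someI)
      then show "g q = z" using that p unfolding z_def by (auto simp: cyclic_class_def g_rotate)
      show "length q = length p" using that p by (auto simp: cyclic_class_def)
    qed
    have z: "norm z < 1" using g_less[OF p(1)] gq[of p] p cyclic_class_self by auto
    have len: "0 < length p" using p nonempty by auto
    have "(\<lambda>(q, m). ?\<phi> (wpow q (Suc m))) summable_on c \<times> UNIV"
      using summable_on_SigmaD1[of "\<lambda>c (q, m). ?\<phi> (wpow q (Suc m))" primes "\<lambda>c. c \<times> UNIV" c] s1 c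
      by (simp add: case_prod_unfold)
    then have "(\<Sum>\<^sub>\<infinity>(q, m)\<in>c \<times> UNIV. ?\<phi> (wpow q (Suc m))) = (\<Sum>\<^sub>\<infinity>q\<in>c. \<Sum>\<^sub>\<infinity>m. ?\<phi> (wpow q (Suc m)))"
      by (rule infsum_Sigma'_banach[symmetric])
    also have "\<dots> = (\<Sum>\<^sub>\<infinity>q\<in>c. - Ln (1 - z) / of_nat (length p))"
    proof (rule infsum_cong)
      fix q assume q: "q \<in> c"
      have "?\<phi> (wpow q (Suc m)) = z ^ Suc m / of_nat (Suc m) / of_nat (length p)" for m
        by (simp only: g_wpow gq[OF q] length_wpow of_nat_mult divide_divide_eq_left)
      then show "(\<Sum>\<^sub>\<infinity>m. ?\<phi> (wpow q (Suc m))) = - Ln (1 - z) / of_nat (length p)"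
        using infsumI[OF has_sum_cmult_left[OF has_sum_minus_Ln[OF z], of "inverse (of_nat (length p))"]]
          by (simp only: divide_inverse)
    qed
    also have "\<dots> = - Ln (1 - z)"
      using card_cyclic_class_primitive[OF p(2)] p(3) len by (simp add: infsum_finite)
    finally show ?thesis by (simp add: z_def)
  qed
  let ?h = "\<lambda>c :: 'e list set. \<lambda>(q, m). ?\<phi> (wpow q (Suc m))"
  have s2: "(\<lambda>(c, y). ?h c y) summable_on Sigma primes (\<lambda>c. c \<times> UNIV)" using s1 .
  have "((\<lambda>c. \<Sum>\<^sub>\<infinity>y\<in>c \<times> UNIV. ?h c y) has_sum (\<Sum>\<^sub>\<infinity>p\<in>C. ?\<phi> p)) primes"
    using has_sum_infsum[OF summable_on_Sigma_banach[OF s2]]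
    by (simp only: infsum_Sigma'_banach[OF s2] e1)
  then show ?thesis by (subst (asm) has_sum_cong[OF inner])
qed

end

section \<open>Weights of closed words\<close>

definition cyclic_weight :: "('i \<Rightarrow> 'i \<Rightarrow> real) \<Rightarrow> 'i list \<Rightarrow> real" where
  "cyclic_weight t p = prod_list (map2 t p (rotate1 p))"

definition walk_weight :: "('i \<Rightarrow> 'i \<Rightarrow> real) \<Rightarrow> 'i list \<Rightarrow> 'i \<Rightarrow> real" where
  "walk_weight t p y = prod_list (map2 t p (tl p @ [y]))"

lemma cyclic_weight_Cons: "cyclic_weight t (x # xs) = walk_weight t (x # xs) x"
  by (simp add: cyclic_weight_def walk_weight_def)

lemma zip_rotate1: "length xs = length ys \<Longrightarrow> zip (rotate1 xs) (rotate1 ys) = rotate1 (zip xs ys)"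
  by (cases xs; cases ys) auto

lemma prod_list_rotate1: "prod_list (rotate1 xs) = prod_list (xs :: real list)"
  by (cases xs) auto

lemma cyclic_weight_rotate1: "cyclic_weight t (rotate1 p) = cyclic_weight t p"
proof -
  have "map2 t (rotate1 p) (rotate1 (rotate1 p)) = rotate1 (map2 t p (rotate1 p))"
    by (simp add: zip_rotate1 rotate1_map)
  then show ?thesis by (simp add: cyclic_weight_def prod_list_rotate1)
qed

lemma cyclic_weight_rotate: "cyclic_weight t (rotate k p) = cyclic_weight t p"
  by (induction k) (auto simp: cyclic_weight_rotate1)

lemma zip_wpow: "length xs = length ys \<Longrightarrow> zip (wpow xs m) (wpow ys m) = wpow (zip xs ys) m"
  by (induction m) auto

lemma cyclic_weight_wpow: "cyclic_weight t (wpow q m) = cyclic_weight t q ^ m"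
proof -
  have "map2 t (wpow q m) (rotate1 (wpow q m)) = wpow (map2 t q (rotate1 q)) m"
    by (simp add: rotate1_wpow zip_wpow map_concat)
  moreover have "prod_list (wpow xs m) = prod_list xs ^ m" for xs :: "real list"
    by (induction m) auto
  ultimately show ?thesis by (simp add: cyclic_weight_def)
qed

definition words_of_length :: "'i set \<Rightarrow> nat \<Rightarrow> 'i list set" where
  "words_of_length F n = {p. set p \<subseteq> F \<and> length p = n}"

lemma finite_words_of_length: "finite F \<Longrightarrow> finite (words_of_length F n)"
  unfolding words_of_length_def by (rule finite_lists_length_eq)

lemma sum_words_of_length_Suc:
  "(\<Sum>p\<in>words_of_length F (Suc n). f p) = (\<Sum>x\<in>F. \<Sum>xs\<in>words_of_length F n. f (x # xs))"
proof -
  have eq: "words_of_length F (Suc n) = (\<lambda>(x, xs). x # xs) ` (F \<times> words_of_length F n)"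
    by (auto simp: words_of_length_def length_Suc_conv image_iff)
  have "inj_on (\<lambda>(x, xs). x # xs) (F \<times> words_of_length F n)" by (auto simp: inj_on_def)
  then show ?thesis unfolding eq
    by (subst sum.reindex) (auto simp: sum.cartesian_product case_prod_unfold intro!: sum.cong)
qed

lemma sum_walk_weight:
  assumes "finite F" "y \<in> F"
  shows "(\<Sum>xs\<in>words_of_length F n. walk_weight t (x # xs) y) = tpow F t (Suc n) x y"
proof (induction n arbitrary: x)
  case 0
  have "words_of_length F 0 = {[]}" by (auto simp: words_of_length_def)
  then show ?case using assms by (simp add: walk_weight_def if_distrib cong: if_cong)
next
  case (Suc n)
  have "(\<Sum>xs\<in>words_of_length F (Suc n). walk_weight t (x # xs) y) = (\<Sum>k\<in>F. t x k * (\<Sum>ys\<in>words_of_length F n. walk_weight t (k # ys) y))"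
    by (simp add: sum_words_of_length_Suc walk_weight_def sum_distrib_left)
  then show ?case by (simp only: Suc.IH) simp
qed

lemma cyclic_weight_nonzero_ascends:
  assumes "cyclic_weight t p \<noteq> 0" "x \<in> set p"
  shows "\<exists>y\<in>set p. t x y \<noteq> 0"
proof -
  from assms(2) obtain i where i: "i < length p" "x = p ! i" by (auto simp: in_set_conv_nth)
  have "(p ! i, rotate1 p ! i) \<in> set (zip p (rotate1 p))"
    using i by (auto simp: set_zip)
  then have "t (p ! i) (rotate1 p ! i) \<in> set (map2 t p (rotate1 p))"
    by (force simp del: set_zip)
  then have "t x (rotate1 p ! i) \<noteq> 0"
    using assms(1) i unfolding cyclic_weight_def prod_list_zero_iff by metis
  moreover have "rotate1 p ! i \<in> set p" using i nth_mem[of i "rotate1 p"] by simp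
  ultimately show ?thesis by blast
qed

text \<open>
  Outside the finite set \<open>F1\<close>, nonzero transitions increase the height \<open>h\<close>. So no closed word of nonzero
  weight avoids \<open>F1\<close>.
\<close>

locale triangular_weights = bounded_weights +
  fixes F1 :: "'a set" and h :: "'a \<Rightarrow> real"
  assumes finite_F1: "finite F1" and F1_sub: "F1 \<subseteq> I"
    and ascending: "\<And>i j. i \<in> I - F1 \<Longrightarrow> j \<in> I - F1 \<Longrightarrow> t i j \<noteq> 0 \<Longrightarrow> h i < h j"
begin

lemma cyclic_weight_nonneg: "set p \<subseteq> I \<Longrightarrow> 0 \<le> cyclic_weight t p"
  unfolding cyclic_weight_def
proof (rule prod_list_nonneg)
  fix x assume "set p \<subseteq> I" "x \<in> set (map2 t p (rotate1 p))"
  moreover from this obtain a b where "(a, b) \<in> set (zip p (rotate1 p))" "x = t a b" by auto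
  ultimately show "0 \<le> x"
    using set_zip_leftD[of a b p "rotate1 p"] set_zip_rightD[of a b p "rotate1 p"]
    by (auto intro!: t_nonneg simp del: set_zip)
qed

lemma diagonal_zero: "i \<in> I - F1 \<Longrightarrow> t i i = 0"
  using ascending[of i i] by auto

text \<open>
  Otherwise the letter of greatest height would be followed by one of greater height.
\<close>

lemma cyclic_weight_nonzero_meets_F1:
  assumes "set p \<subseteq> I" "p \<noteq> []" "cyclic_weight t p \<noteq> 0"
  shows "set p \<inter> F1 \<noteq> {}"
proof
  assume empty: "set p \<inter> F1 = {}"
  have "Max (h ` set p) \<in> h ` set p" using assms by (intro Max_in) auto
  then obtain x where x: "x \<in> set p" "h x = Max (h ` set p)" by auto
  then obtain y where y: "y \<in> set p" "t x y \<noteq> 0" using cyclic_weight_nonzero_ascends assms by metis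
  then have "h x < h y" using ascending[of x y] x assms empty by auto
  moreover have "h y \<le> h x" unfolding x(2) using y by (intro Max_ge) auto
  ultimately show False by simp
qed

lemma sum_cyclic_weight: 
  assumes "finite F"
  shows "(\<Sum>p\<in>words_of_length F (Suc n). cyclic_weight t p) = trace_pow F (Suc n)"
  unfolding trace_pow_def sum_words_of_length_Suc cyclic_weight_Cons using assms by (intro sum.cong refl sum_walk_weight)

text \<open>
  Among the \<open>n + 1\<close> rotations of a word that contributes, at least one begins in \<open>F1\<close>. The words beginning at
  a given letter sum up to a diagonal entry of the \<open>(n + 1)\<close>-st power, which is at most \<open>B ^ Suc n\<close>.
  The bound does not depend on \<open>F\<close>.
\<close>

lemma sum_cyclic_weight_le:
  assumes "finite F" "F \<subseteq> I"
  shows "(\<Sum>p\<in>words_of_length F (Suc n). cyclic_weight t p) \<le> real (Suc n) * (real (card F1) * B ^ Suc n)"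
proof -
  let ?W = "words_of_length F (Suc n)"
  let ?d = "\<lambda>p. (if p ! 0 \<in> F1 then cyclic_weight t p else 0)"
  have nn: "0 \<le> cyclic_weight t p" if "p \<in> ?W" for p using that assms by (intro cyclic_weight_nonneg) (auto simp: words_of_length_def)
  have "(\<Sum>p\<in>?W. cyclic_weight t p) \<le> (\<Sum>p\<in>?W. \<Sum>k<Suc n. ?d (rotate k p))"
  proof (rule sum_mono)
    fix p assume p: "p \<in> ?W"
    show "cyclic_weight t p \<le> (\<Sum>k<Suc n. ?d (rotate k p))"
    proof (cases "cyclic_weight t p = 0")
      case True
      then show ?thesis by (auto intro!: sum_nonneg simp: cyclic_weight_rotate)
    next
      case False
      have "set p \<inter> F1 \<noteq> {}" using p assms False by (intro cyclic_weight_nonzero_meets_F1) (auto simp: words_of_length_def)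
      then obtain k where k: "k < length p" "p ! k \<in> F1" by (auto simp: in_set_conv_nth)
      then have "rotate k p ! 0 = p ! k" by (subst nth_rotate) auto
      then have "cyclic_weight t p = ?d (rotate k p)" using k by (simp add: cyclic_weight_rotate)
      also have "\<dots> \<le> (\<Sum>k<Suc n. ?d (rotate k p))"
        using k p nn by (intro member_le_sum) (auto simp: words_of_length_def cyclic_weight_rotate)
      finally show ?thesis .
    qed
  qed
  also have "\<dots> = (\<Sum>k<Suc n. \<Sum>p\<in>?W. ?d (rotate k p))" by (rule sum.swap)
  also have "\<dots> = (\<Sum>k<Suc n. \<Sum>p\<in>?W. ?d p)"
  proof (rule sum.cong[OF refl])
    fix k
    have "inj_on (rotate k) ?W"
    proof (rule inj_onI)
      fix p q assume pq: "p \<in> ?W" "q \<in> ?W" "rotate k p = rotate k q"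
      have "rotate (Suc n - k mod Suc n) (rotate k p) = p" if "p \<in> ?W" for p
      proof -
        have len: "length p = Suc n" using that by (simp add: words_of_length_def)
        have "rotate (Suc n - k mod Suc n) (rotate (k mod Suc n) p) = rotate (Suc n) p"
          unfolding rotate_rotate by (simp add: mod_le_divisor)
        then show ?thesis using len by (metis rotate_conv_mod rotate_id mod_self)
      qed
      then show "p = q" using pq by metis
    qed
    moreover have "rotate k ` ?W \<subseteq> ?W" by (auto simp: words_of_length_def)
    ultimately have "bij_betw (rotate k) ?W ?W"
      using finite_words_of_length[OF assms(1)] by (simp add: bij_betw_def endo_inj_surj)
    then show "(\<Sum>p\<in>?W. ?d (rotate k p)) = (\<Sum>p\<in>?W. ?d p)"
      by (rule sum.reindex_bij_betw)
  qed
  also have "(\<Sum>p\<in>?W. ?d p) = (\<Sum>x\<in>F. if x \<in> F1 then tpow F t (Suc n) x x else 0)"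
    unfolding sum_words_of_length_Suc using assms(1)
    by (intro sum.cong refl) (auto simp: cyclic_weight_Cons sum_walk_weight simp del: tpow.simps)
  also have "\<dots> = (\<Sum>x\<in>F \<inter> F1. tpow F t (Suc n) x x)"
    using assms by (simp add: sum.inter_restrict del: tpow.simps)
  also have "\<dots> \<le> (\<Sum>x\<in>F \<inter> F1. B ^ Suc n)"
    using assms by (intro sum_mono tpow_le) auto
  also have "\<dots> \<le> real (card F1) * B ^ Suc n"
    using B_pos finite_F1 by (simp add: card_mono mult_right_mono)
  finally show ?thesis by (simp add: sum_distrib_left mult_left_mono)
qed

definition closed_words :: "'a set \<Rightarrow> 'a list set" where
  "closed_words F = {p. p \<noteq> [] \<and> set p \<subseteq> F}"

lemma summable_cyclic_weight:
  assumes "0 \<le> \<rho>" "\<rho> * B < 1"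
  shows "(\<lambda>p. cyclic_weight t p * \<rho> ^ length p / length p) summable_on closed_words I"
proof (rule nonneg_bdd_above_summable_on)
  show "0 \<le> cyclic_weight t p * \<rho> ^ length p / length p" if "p \<in> closed_words I" for p
    using that assms by (auto simp: closed_words_def intro!: mult_nonneg_nonneg divide_nonneg_nonneg cyclic_weight_nonneg)
  show "bdd_above (sum (\<lambda>p. cyclic_weight t p * \<rho> ^ length p / length p) ` {P. P \<subseteq> closed_words I \<and> finite P})"
  proof (rule bdd_aboveI2)
    fix P assume "P \<in> {P. P \<subseteq> closed_words I \<and> finite P}"
    then have P: "P \<subseteq> closed_words I" "finite P" by auto
    define F where "F = \<Union> (set ` P)"
    define n where "n = Max (insert 0 (length ` P))"
    have F: "finite F" "F \<subseteq> I" using P by (auto simp: F_def closed_words_def)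
    have sub: "P \<subseteq> (\<Union>m<n. words_of_length F (Suc m))"
    proof
      fix p assume p: "p \<in> P"
      then have "length p \<le> n" "p \<noteq> []" using P by (auto simp: n_def closed_words_def)
      then have "length p - 1 < n" "Suc (length p - 1) = length p" by (cases p; simp)+
      moreover have "p \<in> words_of_length F (length p)" using p by (auto simp: words_of_length_def F_def)
      ultimately show "p \<in> (\<Union>m<n. words_of_length F (Suc m))" by (metis UN_I lessThan_iff)
    qed
    have "sum (\<lambda>p. cyclic_weight t p * \<rho> ^ length p / length p) P \<le>
        sum (\<lambda>p. cyclic_weight t p * \<rho> ^ length p / length p) (\<Union>m<n. words_of_length F (Suc m))"
    proof (rule sum_mono2)
      show "finite (\<Union>m<n. words_of_length F (Suc m))" using F by (intro finite_UN_I finite_words_of_length) auto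
      show "0 \<le> cyclic_weight t p * \<rho> ^ length p / length p" if "p \<in> (\<Union>m<n. words_of_length F (Suc m)) - P" for p
        using that F assms(1)
        by (auto intro!: cyclic_weight_nonneg mult_nonneg_nonneg divide_nonneg_nonneg simp: words_of_length_def)
    qed (rule sub)
    also have "\<dots> = (\<Sum>m<n. \<Sum>p\<in>words_of_length F (Suc m). cyclic_weight t p * \<rho> ^ length p / length p)"
      using F by (intro sum.UNION_disjoint) (auto intro: finite_words_of_length, auto simp: words_of_length_def)
    also have "\<dots> = (\<Sum>m<n. \<rho> ^ Suc m / Suc m * (\<Sum>p\<in>words_of_length F (Suc m). cyclic_weight t p))"
      by (intro sum.cong refl) (auto simp: words_of_length_def sum_distrib_left intro!: sum.cong)
    also have "\<dots> \<le> (\<Sum>m<n. \<rho> ^ Suc m / Suc m * (real (Suc m) * (real (card F1) * B ^ Suc m)))"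
      using F assms(1) by (intro sum_mono mult_left_mono sum_cyclic_weight_le) auto
    also have "\<dots> = real (card F1) * (\<rho> * B) * (\<Sum>m<n. (\<rho> * B) ^ m)"
      unfolding sum_distrib_left
      by (intro sum.cong refl) (simp add: power_mult_distrib field_simps del: of_nat_Suc)
    also have "\<dots> \<le> real (card F1) * (\<rho> * B) * (\<Sum>m. (\<rho> * B) ^ m)"
      using assms B_pos by (intro mult_left_mono sum_le_suminf summable_geometric) auto
    finally show "sum (\<lambda>p. cyclic_weight t p * \<rho> ^ length p / length p) P
        \<le> real (card F1) * (\<rho> * B) * (\<Sum>m. (\<rho> * B) ^ m)" .
  qed
qed

definition cyc_term :: "complex \<Rightarrow> 'a list \<Rightarrow> complex" where
  "cyc_term u p = of_real (cyclic_weight t p) * u ^ length p / of_nat (length p)"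

lemma abs_summable_cyc_term:
  assumes "norm u * B < 1" "C \<subseteq> closed_words I"
  shows "(\<lambda>p. norm (cyc_term u p)) summable_on C"
proof -
  have "(\<lambda>p. cyclic_weight t p * norm u ^ length p / length p) summable_on C"
    using summable_on_subset_banach[OF summable_cyclic_weight assms(2)] assms by simp
  moreover have "norm (cyc_term u p) = cyclic_weight t p * norm u ^ length p / length p" if "p \<in> C" for p
    using that assms cyclic_weight_nonneg[of p] by (auto simp: cyc_term_def closed_words_def norm_mult norm_divide norm_power)
  ultimately show ?thesis by (subst summable_on_cong) auto
qed

lemma summable_cyc_term:
  assumes "norm u * B < 1" "F \<subseteq> I"
  shows "cyc_term u summable_on closed_words F"
  by (rule abs_summable_summable, rule abs_summable_cyc_term)
    (use assms in \<open>auto simp: closed_words_def\<close>)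

lemma Det_eq_exp_closed_words:
  assumes "finite F" "F \<subseteq> I" "norm u * B < 1"
  shows "Det F (char_matrix t u) = exp (- (\<Sum>\<^sub>\<infinity>p\<in>closed_words F. cyc_term u p))"
proof -
  let ?a = "\<lambda>n. of_real (trace_pow F n / real n) * u ^ n"
  let ?S = "Sigma UNIV (\<lambda>n. words_of_length F (Suc n))"
  have bij: "bij_betw snd ?S (closed_words F)"
    unfolding bij_betw_def
  proof
    show "inj_on snd ?S" by (auto simp: inj_on_def words_of_length_def)
    show "snd ` ?S = closed_words F"
    proof (intro equalityI subsetI)
      fix p assume "p \<in> closed_words F"
      then have "(length p - 1, p) \<in> ?S" by (auto simp: closed_words_def words_of_length_def)
      then show "p \<in> snd ` ?S" by force
    qed (auto simp: closed_words_def words_of_length_def)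
  qed
  have "cyc_term u summable_on closed_words F"
    using assms by (intro summable_cyc_term)
  then have s: "(\<lambda>(n, p). cyc_term u p) summable_on ?S"
    using summable_on_reindex_bij_betw[OF bij, of "cyc_term u"] by (simp add: case_prod_unfold)
  have fin: "(\<Sum>\<^sub>\<infinity>p\<in>words_of_length F (Suc n). cyc_term u p) = ?a (Suc n)" for n
  proof -
    have "(\<Sum>\<^sub>\<infinity>p\<in>words_of_length F (Suc n). cyc_term u p) = (\<Sum>p\<in>words_of_length F (Suc n). cyc_term u p)"
      using finite_words_of_length assms by (intro infsum_finite) auto
    also have "\<dots> = (\<Sum>p\<in>words_of_length F (Suc n). of_real (cyclic_weight t p)) * u ^ Suc n / of_nat (Suc n)"
      unfolding sum_distrib_right sum_divide_distrib
      by (intro sum.cong refl) (auto simp: cyc_term_def words_of_length_def)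
    finally show ?thesis using sum_cyclic_weight[OF assms(1), of n] by (simp flip: of_real_sum)
  qed
  have "((\<lambda>n. \<Sum>\<^sub>\<infinity>p\<in>words_of_length F (Suc n). cyc_term u p) has_sum
      (\<Sum>\<^sub>\<infinity>n. \<Sum>\<^sub>\<infinity>p\<in>words_of_length F (Suc n). cyc_term u p)) UNIV"
    using has_sum_infsum[OF summable_on_Sigma_banach[OF s]] .
  then have "((\<lambda>n. ?a (Suc n)) has_sum (\<Sum>\<^sub>\<infinity>p\<in>closed_words F. cyc_term u p)) UNIV"
    using infsum_Sigma'_banach[OF s] infsum_reindex_bij_betw[OF bij, of "cyc_term u"]
    by (simp only: fin case_prod_unfold)
  then have "(\<lambda>n. ?a (Suc n)) sums (\<Sum>\<^sub>\<infinity>p\<in>closed_words F. cyc_term u p)"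
    by (rule has_sum_imp_sums)
  then have "?a sums (\<Sum>\<^sub>\<infinity>p\<in>closed_words F. cyc_term u p)"
    using sums_Suc_iff[of ?a] by simp
  then show ?thesis using Det_char_matrix_eq_exp[OF assms] by (simp add: sums_iff)
qed

text \<open>
  A finite set of closed words carrying all but \<open>\<epsilon>\<close> of the sum only uses finitely many letters, so the
  exponents for finite \<open>F\<close> converge to the one for \<open>I\<close>.
\<close>

lemma Det_tendsto:
  assumes u: "norm u * B < 1"
  shows "((\<lambda>F. Det F (char_matrix t u)) \<longlongrightarrow> exp (- (\<Sum>\<^sub>\<infinity>p\<in>closed_words I. cyc_term u p)))
    (finite_subsets_at_top I)"
proof -
  let ?L = "\<lambda>F. \<Sum>\<^sub>\<infinity>p\<in>closed_words F. cyc_term u p"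
  have summ: "cyc_term u summable_on closed_words F" if "F \<subseteq> I" for F
    using u that by (rule summable_cyc_term)
  have "(?L \<longlongrightarrow> ?L I) (finite_subsets_at_top I)"
  proof (rule tendstoI)
    fix \<epsilon> :: real assume "\<epsilon> > 0"
    have hs: "(cyc_term u has_sum ?L I) (closed_words I)" using summ[of I] by simp
    have "eventually (\<lambda>P. dist (sum (cyc_term u) P) (?L I) < \<epsilon> / 2)
        (finite_subsets_at_top (closed_words I))"
      using hs \<open>\<epsilon> > 0\<close> unfolding has_sum_def by (intro tendstoD) auto
    then obtain P0 where P0: "finite P0" "P0 \<subseteq> closed_words I"
      "\<And>P. finite P \<Longrightarrow> P0 \<subseteq> P \<Longrightarrow> P \<subseteq> closed_words I \<Longrightarrow> dist (sum (cyc_term u) P) (?L I) \<le> \<epsilon> / 2"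
      unfolding eventually_finite_subsets_at_top by (metis less_imp_le)
    have "dist (?L F) (?L I) < \<epsilon>" if F: "finite F" "F \<subseteq> I" "\<Union> (set ` P0) \<subseteq> F" for F
    proof -
      have sub: "P0 \<subseteq> closed_words F" "closed_words F \<subseteq> closed_words I"
        using P0(2) F by (auto simp: closed_words_def)
      have "(sum (cyc_term u) \<longlongrightarrow> ?L F) (finite_subsets_at_top (closed_words F))"
        using has_sum_infsum[OF summ[OF F(2)]] by (simp add: has_sum_def)
      then have "((\<lambda>P. dist (sum (cyc_term u) P) (?L I)) \<longlongrightarrow> dist (?L F) (?L I))
          (finite_subsets_at_top (closed_words F))"
        by (intro tendsto_intros)
      moreover have "eventually (\<lambda>P. dist (sum (cyc_term u) P) (?L I) \<le> \<epsilon> / 2)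
          (finite_subsets_at_top (closed_words F))"
        unfolding eventually_finite_subsets_at_top using P0 sub
        by (intro exI[of _ P0]) blast
      ultimately have "dist (?L F) (?L I) \<le> \<epsilon> / 2"
        by (rule tendsto_upperbound) (rule finite_subsets_at_top_neq_bot)
      then show ?thesis using \<open>\<epsilon> > 0\<close> by simp
    qed
    then show "eventually (\<lambda>F. dist (?L F) (?L I) < \<epsilon>) (finite_subsets_at_top I)"
      unfolding eventually_finite_subsets_at_top using P0
      by (intro exI[of _ "\<Union> (set ` P0)"]) (auto simp: closed_words_def)
  qed
  then have "((\<lambda>F. exp (- ?L F)) \<longlongrightarrow> exp (- ?L I)) (finite_subsets_at_top I)"
    by (intro tendsto_intros)
  moreover have "eventually (\<lambda>F. Det F (char_matrix t u) = exp (- ?L F)) (finite_subsets_at_top I)"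
    unfolding eventually_finite_subsets_at_top using u
    by (intro exI[of _ "{}"]) (auto intro: Det_eq_exp_closed_words)
  ultimately show ?thesis by (subst tendsto_cong)
qed

lemma Perm_bound:
  assumes "finite F" "F1 \<subseteq> F" "F \<subseteq> I" "0 \<le> \<rho>" "\<rho> * B \<le> 1"
  shows "Perm F (\<lambda>i j. (if i = j then 1 else 0) + \<rho> * t i j) \<le> 2 ^ card F1"
proof -
  have "Perm (F1 \<union> (F - F1)) (\<lambda>i j. (if i = j then 1 else 0) + \<rho> * t i j) \<le> (1 + \<rho> * B) ^ card F1"
  proof (rule Perm_le_of_triangular[where h = h])
    fix i assume "i \<in> F1 \<union> (F - F1)"
    then have "i \<in> I" "F1 \<union> (F - F1) = F" using assms by auto
    then show "(\<Sum>j\<in>F1 \<union> (F - F1). \<rho> * t i j) \<le> \<rho> * B"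
      using row_sum[of i F] assms by (simp add: sum_distrib_left[symmetric] mult_left_mono)
  next
    fix i j assume ij: "i \<in> F - F1" "j \<in> F - F1" "\<rho> * t i j \<noteq> 0"
    then show "h i < h j" using ascending[of i j] assms by auto
  qed (use assms finite_F1 B_pos in \<open>auto intro!: mult_nonneg_nonneg t_nonneg\<close>)
  also have "(1 + \<rho> * B) ^ card F1 \<le> 2 ^ card F1"
    using assms B_pos by (intro power_mono) auto
  finally show ?thesis using assms by (simp add: Un_absorb1)
qed

end

section \<open>Determinant class and the product over prime cycles\<close>

lemma pairing_basis: "pairing a (basis j) = a j"
proof -
  have "{i. basis j i \<noteq> (0::complex)} = {j}" by (auto simp: basis_def)
  then show ?thesis by (simp add: pairing_def basis_def)
qed

lemma fin_det_compression:
  assumes "\<And>i j. i \<in> F \<Longrightarrow> j \<in> F \<Longrightarrow> A (basis i) j = M i j"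
  shows "fin_det F (compression F A) = Det F M"
  unfolding fin_det_def Det_def
  by (intro sum.cong arg_cong2[where f="(*)"] prod.cong refl)
    (auto simp: pairing_basis compression_def permutes_in_image assms)

lemma has_net_prod_finite_support:
  assumes "finite K" "K \<subseteq> I" "\<And>i. i \<in> I - K \<Longrightarrow> f i = 1"
  shows "has_net_prod f I (prod f K)"
proof -
  have "eventually (\<lambda>F. prod f F = prod f K) (finite_subsets_at_top I)"
    unfolding eventually_finite_subsets_at_top
  proof (intro exI[of _ K] conjI allI impI)
    fix F assume "finite F \<and> K \<subseteq> F \<and> F \<subseteq> I"
    then show "prod f F = prod f K" using assms by (intro prod.mono_neutral_right) auto
  qed (use assms in auto)
  then show ?thesis unfolding has_net_prod_def by (rule tendsto_eventually)
qed

lemma net_prod_eqI: "has_net_prod f I z \<Longrightarrow> net_prod f I = z"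
  unfolding has_net_prod_def net_prod_def by (intro tendsto_Lim finite_subsets_at_top_neq_bot)

context triangular_weights
begin

lemma det_class_of_char_matrix:
  assumes A: "linear_SP I A" "\<And>i j. i \<in> I \<Longrightarrow> j \<in> I \<Longrightarrow> A (basis i) j = char_matrix t u i j"
    and u: "norm u * B < 1"
  shows "det_class I A" "net_det I A = exp (- (\<Sum>\<^sub>\<infinity>p\<in>closed_words I. cyc_term u p))"
proof -
  let ?z = "exp (- (\<Sum>\<^sub>\<infinity>p\<in>closed_words I. cyc_term u p))"
  have "eventually (\<lambda>F. Det F (char_matrix t u) = fin_det F (compression F A)) (finite_subsets_at_top I)"
    unfolding eventually_finite_subsets_at_top
    by (intro exI[of _ "{}"]) (auto intro!: fin_det_compression[symmetric] A(2))
  from Lim_transform_eventually[OF Det_tendsto[OF u] this]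
  have lim: "((\<lambda>F. fin_det F (compression F A)) \<longlongrightarrow> ?z) (finite_subsets_at_top I)" .
  show "det_class I A" unfolding det_class_def using A(1) lim by (intro conjI exI[of _ ?z]) auto
  show "net_det I A = ?z" unfolding net_det_def
    by (intro tendsto_Lim finite_subsets_at_top_neq_bot lim)
qed

text \<open>
  A finite set of finitely supported permutations lives on a finite set \<open>K\<close> containing \<open>F1\<close>, so its
  contribution is at most the permanent of \<open>1 + |u| t\<close> on \<open>K\<close>, which is bounded independently of \<open>K\<close>.
\<close>

lemma strong_det_class_of_char_matrix:
  assumes A: "linear_SP I A" "\<And>i j. i \<in> I \<Longrightarrow> j \<in> I \<Longrightarrow> A (basis i) j = char_matrix t u i j"
    and u: "norm u * B < 1"
  shows "strong_det_class I A"
proof -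
  have diag: "pairing (A (basis i)) (basis i) = 1" if "i \<in> I - F1" for i
    using that A(2)[of i i] diagonal_zero by (simp add: pairing_basis char_matrix_def)
  have i: "\<exists>F\<subseteq>I. finite F \<and> (\<forall>i\<in>I - F. pairing (A (basis i)) (basis i) \<noteq> 0) \<and>
        (\<lambda>i. cmod (Ln (pairing (A (basis i)) (basis i)))) summable_on (I - F)"
  proof (intro exI[of _ F1] conjI ballI)
    show "(\<lambda>i. cmod (Ln (pairing (A (basis i)) (basis i)))) summable_on (I - F1)"
      by (subst summable_on_cong[of _ _ "\<lambda>_. 0"]) (auto simp: diag)
  qed (use diag finite_F1 F1_sub in auto)
  let ?S = "{\<sigma>. \<sigma> permutes I \<and> finite {i. \<sigma> i \<noteq> i}}"
  let ?f = "\<lambda>\<sigma>. cmod (net_prod (\<lambda>i. pairing (A (basis i)) (basis (\<sigma> i))) I)"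
  have eq: "?f \<sigma> = (\<Prod>i\<in>K. cmod (char_matrix t u i (\<sigma> i)))"
    if \<sigma>: "\<sigma> permutes I" and K: "finite K" "F1 \<union> {i. \<sigma> i \<noteq> i} \<subseteq> K" "K \<subseteq> I" for \<sigma> K
  proof -
    have "has_net_prod (\<lambda>i. pairing (A (basis i)) (basis (\<sigma> i))) I
        (\<Prod>i\<in>K. pairing (A (basis i)) (basis (\<sigma> i)))"
    proof (rule has_net_prod_finite_support)
      fix i assume "i \<in> I - K"
      then have "\<sigma> i = i" "i \<in> I - F1" using K by auto
      then show "pairing (A (basis i)) (basis (\<sigma> i)) = 1" using diag by simp
    qed (use K in auto)
    then have "?f \<sigma> = cmod (\<Prod>i\<in>K. pairing (A (basis i)) (basis (\<sigma> i)))"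
      by (simp add: net_prod_eqI)
    also have "(\<Prod>i\<in>K. pairing (A (basis i)) (basis (\<sigma> i))) = (\<Prod>i\<in>K. char_matrix t u i (\<sigma> i))"
      using K by (intro prod.cong refl) (auto simp: pairing_basis permutes_in_image[OF \<sigma>] intro!: A(2))
    finally show ?thesis by (simp add: prod_norm)
  qed
  have "?f summable_on ?S"
  proof (rule nonneg_bdd_above_summable_on)
    show "bdd_above (sum ?f ` {Q. Q \<subseteq> ?S \<and> finite Q})"
    proof (rule bdd_aboveI2)
      fix Q assume "Q \<in> {Q. Q \<subseteq> ?S \<and> finite Q}"
      then have Q: "Q \<subseteq> ?S" "finite Q" by auto
      define K where "K = F1 \<union> (\<Union>\<sigma>\<in>Q. {i. \<sigma> i \<noteq> i})"
      have K: "finite K" "F1 \<subseteq> K" "K \<subseteq> I"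
        using Q finite_F1 F1_sub permutes_not_in by (fastforce simp: K_def)+
      have "sum ?f Q \<le> (\<Sum>\<sigma>\<in>Q. \<Prod>i\<in>K. (if i = \<sigma> i then 1 else 0) + norm u * t i (\<sigma> i))"
      proof (rule sum_mono)
        fix \<sigma> assume \<sigma>: "\<sigma> \<in> Q"
        then have p: "\<sigma> permutes I" using Q by auto
        have "?f \<sigma> = (\<Prod>i\<in>K. cmod (char_matrix t u i (\<sigma> i)))"
          using \<sigma> K by (intro eq p) (auto simp: K_def)
        also have "\<dots> \<le> (\<Prod>i\<in>K. (if i = \<sigma> i then 1 else 0) + norm u * t i (\<sigma> i))"
        proof (intro prod_mono conjI)
          fix i assume "i \<in> K"
          then have "0 \<le> t i (\<sigma> i)" using K by (intro t_nonneg) (auto simp: permutes_in_image[OF p])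
          then have "cmod (u * of_real (t i (\<sigma> i))) = norm u * t i (\<sigma> i)" by (simp add: norm_mult)
          moreover have "cmod (char_matrix t u i (\<sigma> i)) \<le>
              cmod (if i = \<sigma> i then 1 else 0) + cmod (u * of_real (t i (\<sigma> i)))"
            unfolding char_matrix_def by (rule norm_triangle_ineq4)
          ultimately show "cmod (char_matrix t u i (\<sigma> i)) \<le> (if i = \<sigma> i then 1 else 0) + norm u * t i (\<sigma> i)"
            by (simp split: if_splits)
        qed auto
        finally show "?f \<sigma> \<le> (\<Prod>i\<in>K. (if i = \<sigma> i then 1 else 0) + norm u * t i (\<sigma> i))" .
      qed
      also have "\<dots> \<le> Perm K (\<lambda>i j. (if i = j then 1 else 0) + norm u * t i j)"
        unfolding Perm_def
      proof (rule sum_mono2)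
        show "finite {\<sigma>. \<sigma> permutes K}" using K by (simp add: finite_permutations)
        show "Q \<subseteq> {\<sigma>. \<sigma> permutes K}"
        proof
          fix \<sigma> assume \<sigma>: "\<sigma> \<in> Q"
          then have "\<sigma> permutes I" "\<And>x. x \<in> I - K \<Longrightarrow> \<sigma> x = x" using Q by (auto simp: K_def)
          then show "\<sigma> \<in> {\<sigma>. \<sigma> permutes K}" using permutes_superset by blast
        qed
        fix \<sigma> assume "\<sigma> \<in> {\<sigma>. \<sigma> permutes K} - Q"
        then have "\<sigma> permutes K" by auto
        then show "0 \<le> (\<Prod>i\<in>K. (if i = \<sigma> i then 1 else 0) + norm u * t i (\<sigma> i))"
          using K by (intro prod_nonneg add_nonneg_nonneg mult_nonneg_nonneg)
            (auto intro!: t_nonneg simp: permutes_in_image)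
      qed
      also have "\<dots> \<le> 2 ^ card F1" using K u by (intro Perm_bound) auto
      finally show "sum ?f Q \<le> 2 ^ card F1" .
    qed
  qed auto
  with i A(1) show ?thesis unfolding strong_det_class_def by blast
qed

text \<open>
  For \<open>|u| * B < 1\<close> this makes \<open>|w(p) u ^ l(p)| < 1\<close>, as needed for the logarithms.
\<close>

lemma cyclic_weight_le:
  assumes "set p \<subseteq> I"
  shows "cyclic_weight t p \<le> B ^ length p"
proof -
  have t_le: "t i j \<le> B" if "i \<in> I" "j \<in> I" for i j
    using row_sum[of i "{j}"] that by simp
  have "prod_list (map2 t xs ys) \<le> B ^ length xs \<and> 0 \<le> prod_list (map2 t xs ys)"
    if "length xs = length ys" "set xs \<subseteq> I" "set ys \<subseteq> I" for xs ys
    using that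
    by (induction xs ys rule: list_induct2) (auto intro!: mult_mono t_le t_nonneg mult_nonneg_nonneg simp: B_pos less_imp_le)
  from this[of p "rotate1 p"] show ?thesis using assms by (simp add: cyclic_weight_def)
qed

text \<open>
  The partial products are the exponentials of the partial sums of logarithms over prime classes.
\<close>

lemma has_net_prod_primes:
  assumes C: "C \<subseteq> closed_words I" "\<And>p. p \<in> C \<Longrightarrow> rotate1 p \<in> C"
      "\<And>q m. 0 < m \<Longrightarrow> wpow q m \<in> C \<longleftrightarrow> q \<in> C"
      "\<And>p. p \<in> closed_words I \<Longrightarrow> p \<notin> C \<Longrightarrow> cyclic_weight t p = 0"
    and u: "norm u * B < 1"
    and P: "P = {c. (\<exists>p\<in>C. c = cyclic_class p) \<and> \<not> (\<exists>q m. q \<in> C \<and> 2 \<le> m \<and> c = cyclic_class (wpow q m))}"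
  shows "has_net_prod (\<lambda>c. inverse (1 - of_real (cyclic_weight t (SOME p. p \<in> c)) * u ^ length (SOME p. p \<in> c))) P
    (exp (\<Sum>\<^sub>\<infinity>p\<in>closed_words I. cyc_term u p))"
proof -
  define g where "g p = of_real (cyclic_weight t p) * u ^ length p" for p
  have g_less: "norm (g p) < 1" if "p \<in> C" for p
  proof -
    have p: "set p \<subseteq> I" "p \<noteq> []" using that C(1) by (auto simp: closed_words_def)
    have "norm (g p) = cyclic_weight t p * norm u ^ length p"
      using cyclic_weight_nonneg[OF p(1)] by (simp add: g_def norm_mult norm_power)
    also have "\<dots> \<le> B ^ length p * norm u ^ length p" by (intro mult_right_mono cyclic_weight_le p) auto
    also have "\<dots> = (norm u * B) ^ length p" by (simp add: power_mult_distrib mult.commute)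
    also have "\<dots> < 1" using u p(2) B_pos by (simp add: power_less_one_iff)
    finally show ?thesis .
  qed
  interpret L: cyclic_language C g
  proof
    show "(\<lambda>p. norm (g p / of_nat (length p))) summable_on C"
      using abs_summable_cyc_term[OF u C(1)] by (simp add: cyc_term_def g_def)
  qed (use C g_less in \<open>auto simp: g_def cyclic_weight_rotate1 cyclic_weight_wpow length_wpow power_mult_distrib closed_words_def
      power_mult[symmetric] mult.commute\<close>)
  have P: "P = L.primes" unfolding P L.primes_def by simp
  have val: "(\<Sum>\<^sub>\<infinity>p\<in>C. g p / of_nat (length p)) = (\<Sum>\<^sub>\<infinity>p\<in>closed_words I. cyc_term u p)"
    using C by (intro infsum_cong_neutral) (auto simp: cyc_term_def g_def)
  have "(sum (\<lambda>c. - Ln (1 - g (SOME p. p \<in> c))) \<longlongrightarrow> (\<Sum>\<^sub>\<infinity>p\<in>closed_words I. cyc_term u p)) (finite_subsets_at_top P)"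
    using L.has_sum_primes unfolding P val has_sum_def .
  then have "((\<lambda>F. exp (sum (\<lambda>c. - Ln (1 - g (SOME p. p \<in> c))) F)) \<longlongrightarrow> exp (\<Sum>\<^sub>\<infinity>p\<in>closed_words I. cyc_term u p)) (finite_subsets_at_top P)"
    by (intro tendsto_intros)
  moreover have "eventually (\<lambda>F. exp (sum (\<lambda>c. - Ln (1 - g (SOME p. p \<in> c))) F) = (\<Prod>c\<in>F. inverse (1 - g (SOME p. p \<in> c)))) (finite_subsets_at_top P)"
    unfolding eventually_finite_subsets_at_top
  proof (intro exI[of _ "{}"] conjI allI impI)
    fix F assume F: "finite F \<and> {} \<subseteq> F \<and> F \<subseteq> P"
    have "exp (sum (\<lambda>c. - Ln (1 - g (SOME p. p \<in> c))) F) = (\<Prod>c\<in>F. exp (- Ln (1 - g (SOME p. p \<in> c))))"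
      using F by (intro exp_sum) auto
    also have "\<dots> = (\<Prod>c\<in>F. inverse (1 - g (SOME p. p \<in> c)))"
    proof (intro prod.cong refl)
      fix c assume "c \<in> F"
      then have "c \<in> L.primes" using F P by auto
      moreover from this have "(SOME p. p \<in> c) \<in> c"
        using cyclic_class_self by (force simp: L.primes_eq some_in_eq)
      ultimately have "norm (g (SOME p. p \<in> c)) < 1" using L.mem_prime g_less by blast
      then have "1 - g (SOME p. p \<in> c) \<noteq> 0" by auto
      then show "exp (- Ln (1 - g (SOME p. p \<in> c))) = inverse (1 - g (SOME p. p \<in> c))"
        by (simp add: exp_minus)
    qed
    finally show "exp (sum (\<lambda>c. - Ln (1 - g (SOME p. p \<in> c))) F) = (\<Prod>c\<in>F. inverse (1 - g (SOME p. p \<in> c)))" .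
  qed auto
  ultimately show ?thesis unfolding has_net_prod_def g_def by (rule Lim_transform_eventually)
qed

end

section \<open>Rational functions on a disc\<close>

definition rational_on :: "real \<Rightarrow> (complex \<Rightarrow> complex) \<Rightarrow> bool" where
  "rational_on r g \<longleftrightarrow> (\<exists>p q :: complex poly. \<forall>u. norm u < r \<longrightarrow> poly q u \<noteq> 0 \<and> g u = poly p u / poly q u)"

lemma rational_on_const: "rational_on r (\<lambda>u. c)"
  unfolding rational_on_def by (intro exI[of _ "[:c:]"] exI[of _ 1]) auto

lemma rational_on_ident: "rational_on r (\<lambda>u. u)"
  unfolding rational_on_def by (intro exI[of _ "[:0, 1:]"] exI[of _ 1]) auto

lemma rational_on_add:
  assumes "rational_on r g" "rational_on r g'"
  shows "rational_on r (\<lambda>u. g u + g' u)"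
proof -
  obtain p q p' q' where "\<And>u. norm u < r \<Longrightarrow> poly q u \<noteq> 0 \<and> g u = poly p u / poly q u"
    "\<And>u. norm u < r \<Longrightarrow> poly q' u \<noteq> 0 \<and> g' u = poly p' u / poly q' u"
    using assms unfolding rational_on_def by metis
  then show ?thesis unfolding rational_on_def
    by (intro exI[of _ "p * q' + p' * q"] exI[of _ "q * q'"]) (auto simp: add_frac_eq)
qed

lemma rational_on_mult:
  assumes "rational_on r g" "rational_on r g'"
  shows "rational_on r (\<lambda>u. g u * g' u)"
proof -
  obtain p q p' q' where "\<And>u. norm u < r \<Longrightarrow> poly q u \<noteq> 0 \<and> g u = poly p u / poly q u"
    "\<And>u. norm u < r \<Longrightarrow> poly q' u \<noteq> 0 \<and> g' u = poly p' u / poly q' u"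
    using assms unfolding rational_on_def by metis
  then show ?thesis unfolding rational_on_def
    by (intro exI[of _ "p * p'"] exI[of _ "q * q'"]) auto
qed

lemma rational_on_uminus: "rational_on r g \<Longrightarrow> rational_on r (\<lambda>u. - g u)"
  using rational_on_mult[OF rational_on_const[of r "-1"]] by simp

lemma rational_on_diff:
  "rational_on r g \<Longrightarrow> rational_on r g' \<Longrightarrow> rational_on r (\<lambda>u. g u - g' u)"
  using rational_on_add[OF _ rational_on_uminus] by simp

lemma rational_on_divide:
  assumes "rational_on r g" "rational_on r g'" "\<And>u. norm u < r \<Longrightarrow> g' u \<noteq> 0"
  shows "rational_on r (\<lambda>u. g u / g' u)"
proof -
  obtain p q p' q' where *: "\<And>u. norm u < r \<Longrightarrow> poly q u \<noteq> 0 \<and> g u = poly p u / poly q u"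
    "\<And>u. norm u < r \<Longrightarrow> poly q' u \<noteq> 0 \<and> g' u = poly p' u / poly q' u"
    using assms unfolding rational_on_def by metis
  then have "\<And>u. norm u < r \<Longrightarrow> poly p' u \<noteq> 0" using assms(3) by force
  with * show ?thesis unfolding rational_on_def
    by (intro exI[of _ "p * q'"] exI[of _ "q * p'"]) auto
qed

lemma rational_on_sum: "(\<And>i. i \<in> A \<Longrightarrow> rational_on r (g i)) \<Longrightarrow> rational_on r (\<lambda>u. \<Sum>i\<in>A. g i u)"
  by (induction A rule: infinite_finite_induct) (auto intro: rational_on_const rational_on_add)

lemma rational_on_prod: "(\<And>i. i \<in> A \<Longrightarrow> rational_on r (g i)) \<Longrightarrow> rational_on r (\<lambda>u. \<Prod>i\<in>A. g i u)"
  by (induction A rule: infinite_finite_induct) (auto intro: rational_on_const rational_on_mult)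

lemma rational_on_cong:
  "(\<And>u. norm u < r \<Longrightarrow> g u = g' u) \<Longrightarrow> rational_on r g \<longleftrightarrow> rational_on r g'"
  unfolding rational_on_def by (intro ex_cong1 all_cong1) auto

lemma rational_on_Det:
  assumes "\<And>i j. rational_on r (\<lambda>u. A u i j)"
  shows "rational_on r (\<lambda>u. Det F (A u))"
  unfolding Det_def
  by (intro rational_on_sum rational_on_mult rational_on_prod rational_on_const assms)

section \<open>Continued sums with periodic coefficients\<close>

text \<open>
  The infinite nested expression \<open>\<alpha> n + \<beta> n * (\<alpha> (n + 1) + \<beta> (n + 1) * (\<dots>))\<close>, multiplied out.
\<close>

definition tail_sum :: "(nat \<Rightarrow> complex) \<Rightarrow> (nat \<Rightarrow> complex) \<Rightarrow> nat \<Rightarrow> complex" where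
  "tail_sum \<alpha> \<beta> n = (\<Sum>k. \<alpha> (n + k) * (\<Prod>j<k. \<beta> (n + j)))"

lemma tail_sum_summable:
  fixes \<alpha> \<beta> :: "nat \<Rightarrow> complex"
  assumes "\<And>k. norm (\<alpha> k) \<le> M" "\<And>k. norm (\<beta> k) \<le> \<theta>" "\<theta> < 1"
  shows "summable (\<lambda>k. \<alpha> (n + k) * (\<Prod>j<k. \<beta> (n + j)))"
proof (rule summable_comparison_test')
  have "0 \<le> \<theta>" using assms(2)[of 0] norm_ge_zero order_trans by blast
  then show "summable (\<lambda>k. M * \<theta> ^ k)" using assms by (intro summable_mult summable_geometric) auto
  have "0 \<le> M" using assms(1)[of 0] norm_ge_zero order_trans by blast
  fix k
  have "norm (\<Prod>j<k. \<beta> (n + j)) \<le> (\<Prod>j<k. \<theta>)"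
    unfolding prod_norm[symmetric] by (intro prod_mono) (auto intro: assms)
  then show "norm (\<alpha> (n + k) * (\<Prod>j<k. \<beta> (n + j))) \<le> M * \<theta> ^ k"
    using assms(1) \<open>0 \<le> M\<close> by (auto simp: norm_mult intro!: mult_mono)
qed

lemma tail_sum_split:
  fixes \<alpha> \<beta> :: "nat \<Rightarrow> complex"
  assumes "\<And>k. norm (\<alpha> k) \<le> M" "\<And>k. norm (\<beta> k) \<le> \<theta>" "\<theta> < 1"
  shows "tail_sum \<alpha> \<beta> n = (\<Sum>k<m. \<alpha> (n + k) * (\<Prod>j<k. \<beta> (n + j))) + (\<Prod>j<m. \<beta> (n + j)) * tail_sum \<alpha> \<beta> (n + m)"
proof -
  have "(\<Prod>j<k + m. \<beta> (n + j)) = (\<Prod>j<m. \<beta> (n + j)) * (\<Prod>j<k. \<beta> (n + m + j))" for k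
    by (induction k) (auto simp: mult_ac add_ac)
  then have "(\<Sum>k. \<alpha> (n + (k + m)) * (\<Prod>j<k + m. \<beta> (n + j))) =
     (\<Sum>k. (\<Prod>j<m. \<beta> (n + j)) * (\<alpha> (n + m + k) * (\<Prod>j<k. \<beta> (n + m + j))))"
    by (intro suminf_cong) (simp add: mult_ac add_ac)
  also have "\<dots> = (\<Prod>j<m. \<beta> (n + j)) * tail_sum \<alpha> \<beta> (n + m)"
    unfolding tail_sum_def by (rule suminf_mult[OF tail_sum_summable[of \<alpha> M \<beta> \<theta>, OF assms]])
  finally show ?thesis
    using suminf_split_initial_segment[OF tail_sum_summable[of \<alpha> M \<beta> \<theta> n, OF assms], of m]
    by (simp add: tail_sum_def)
qed

lemma nested_tendsto:
  fixes \<alpha> \<beta> :: "nat \<Rightarrow> complex"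
  assumes "\<And>k. norm (\<alpha> k) \<le> M" "\<And>k. norm (\<beta> k) \<le> \<theta>" "\<theta> < 1"
  shows "(\<lambda>n. nested \<alpha> \<beta> n (\<alpha> n)) \<longlonglongrightarrow> tail_sum \<alpha> \<beta> 0"
proof -
  let ?a = "\<lambda>k. \<alpha> k * (\<Prod>j<k. \<beta> j)"
  have "summable ?a" using tail_sum_summable[of \<alpha> M \<beta> \<theta> 0, OF assms] by simp
  then have "(\<lambda>n. \<Sum>k<Suc n. ?a k) \<longlonglongrightarrow> suminf ?a"
    by (intro LIMSEQ_Suc summable_LIMSEQ)
  then show ?thesis by (simp add: nested_eq_sum tail_sum_def mult_ac)
qed

text \<open>
  Past the preperiod \<open>N\<close>, the sum \<open>\<tau>\<close> reproduces itself after one period: \<open>\<tau> = S + P * \<tau>\<close> with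
  polynomials \<open>S\<close> and \<open>P\<close>. Since \<open>|P| < 1\<close> on the disc, \<open>\<tau> = S / (1 - P)\<close> without poles there.
\<close>

lemma rational_on_tail_sum:
  fixes a b :: "nat \<Rightarrow> real"
  assumes ab: "\<And>k. 0 \<le> a k" "\<And>k. a k \<le> B" "\<And>k. 0 \<le> b k" "\<And>k. b k \<le> B"
    and r: "0 \<le> B" "r * B < 1" "0 < r" "r \<le> 1"
    and per: "0 < p" "\<And>n. N \<le> n \<Longrightarrow> a (n + p) = a n" "\<And>n. N \<le> n \<Longrightarrow> b (n + p) = b n"
  shows "rational_on r (\<lambda>u. tail_sum (\<lambda>k. u * of_real (a k)) (\<lambda>k. u * (u * of_real (b k))) 0)"
proof -
  let ?\<alpha> = "\<lambda>u k. u * of_real (a k) :: complex" and ?\<beta> = "\<lambda>u k. u * (u * of_real (b k)) :: complex"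
  have bounds: "norm (?\<alpha> u k) \<le> B" "norm (?\<beta> u k) \<le> r * B" if u: "norm u < r" for u k
  proof -
    have "norm u * a k \<le> 1 * B" using u r ab by (intro mult_mono) auto
    then show "norm (?\<alpha> u k) \<le> B" using ab by (simp add: norm_mult)
    have "norm u * (norm u * b k) \<le> 1 * (r * B)" using u r ab by (intro mult_mono mult_nonneg_nonneg) auto
    then show "norm (?\<beta> u k) \<le> r * B" using ab by (simp add: norm_mult)
  qed
  let ?S = "\<lambda>u n m. \<Sum>k<m. ?\<alpha> u (n + k) * (\<Prod>j<k. ?\<beta> u (n + j))"
  let ?P = "\<lambda>u n m. \<Prod>j<m. ?\<beta> u (n + j)"
  note R = rational_on_sum rational_on_mult rational_on_prod rational_on_const rational_on_ident
    rational_on_add rational_on_diff rational_on_divide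
  have RS: "rational_on r (\<lambda>u. ?S u n m)" and RP: "rational_on r (\<lambda>u. ?P u n m)" for n m
    by (intro R)+
  have Pless: "norm (?P u N p) < 1" if u: "norm u < r" for u
  proof -
    have "norm (?P u N p) \<le> (\<Prod>j<p. r * B)"
      unfolding prod_norm[symmetric] using bounds(2)[OF u] by (intro prod_mono) auto
    also have "\<dots> < 1" using r per by (simp add: power_less_one_iff)
    finally show ?thesis .
  qed
  have nz: "1 - ?P u N p \<noteq> 0" if "norm u < r" for u
    using Pless[OF that] by auto
  have "tail_sum (?\<alpha> u) (?\<beta> u) 0 = ?S u 0 N + ?P u 0 N * (?S u N p / (1 - ?P u N p))"
    if u: "norm u < r" for u
  proof -
    let ?\<tau> = "tail_sum (?\<alpha> u) (?\<beta> u)"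
    have "?\<tau> (N + p) = ?\<tau> N"
    proof -
      have "a (N + p + k) = a (N + k)" "b (N + p + k) = b (N + k)" for k
        using per(2,3)[of "N + k"] by (auto simp: add_ac)
      then show ?thesis unfolding tail_sum_def by (simp only:)
    qed
    then have "?\<tau> N = ?S u N p + ?P u N p * ?\<tau> N"
      using tail_sum_split[of "?\<alpha> u" B "?\<beta> u" "r * B" N p, OF bounds[OF u] r(2)] by simp
    then have "?\<tau> N = ?S u N p / (1 - ?P u N p)" using nz[OF u] by (simp add: field_simps)
    then show ?thesis using tail_sum_split[of "?\<alpha> u" B "?\<beta> u" "r * B" 0 N, OF bounds[OF u] r(2)] by simp
  qed
  moreover have "rational_on r (\<lambda>u. ?S u 0 N + ?P u 0 N * (?S u N p / (1 - ?P u N p)))"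
    by (intro rational_on_add rational_on_mult rational_on_divide rational_on_diff rational_on_const RS RP nz)
  ultimately show ?thesis by (subst rational_on_cong)
qed

section \<open>Graphs with finitely many periodic cusps\<close>

text \<open>
  The combinatorics of the quotient graph: \<open>e r n\<close> and \<open>f r n\<close> are the outward and inward edges of
  the cusp section \<open>r\<close>. The layer \<open>n = 0\<close> belongs to the finite part \<open>F1\<close>, and the rest of the section is
  attached to \<open>F1\<close> through this layer only.
\<close>

locale cusp_weights = bounded_weights I t B
  for I :: "'i set" and t B +
  fixes F1 :: "'i set" and R :: "'r set" and e f :: "'r \<Rightarrow> nat \<Rightarrow> 'i"
  assumes finite_F1: "finite F1" and F1_sub: "F1 \<subseteq> I" and finite_R: "finite R"
    and I_eq: "I = F1 \<union> (\<Union>r\<in>R. range (\<lambda>n. e r (Suc n)) \<union> range (\<lambda>n. f r (Suc n)))"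
    and base: "\<And>r. r \<in> R \<Longrightarrow> e r 0 \<in> F1" "\<And>r. r \<in> R \<Longrightarrow> f r 0 \<in> F1"
    and outside: "\<And>r n. r \<in> R \<Longrightarrow> e r (Suc n) \<notin> F1" "\<And>r n. r \<in> R \<Longrightarrow> f r (Suc n) \<notin> F1"
    and e_inj: "\<And>r r' m n. r \<in> R \<Longrightarrow> r' \<in> R \<Longrightarrow> e r m = e r' n \<Longrightarrow> r = r' \<and> m = n"
    and f_inj: "\<And>r r' m n. r \<in> R \<Longrightarrow> r' \<in> R \<Longrightarrow> f r m = f r' n \<Longrightarrow> r = r' \<and> m = n"
    and e_f: "\<And>r r' m n. r \<in> R \<Longrightarrow> r' \<in> R \<Longrightarrow> e r m \<noteq> f r' n"
    and out: "\<And>r n. r \<in> R \<Longrightarrow> t (e r n) (e r (Suc n)) = 1"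
    and row_e: "\<And>r n j. r \<in> R \<Longrightarrow> j \<in> I \<Longrightarrow> t (e r (Suc n)) j \<noteq> 0 \<Longrightarrow> j = e r (Suc (Suc n)) \<or> j = f r (Suc n)"
    and row_f: "\<And>r n j. r \<in> R \<Longrightarrow> j \<in> I \<Longrightarrow> t (f r (Suc n)) j \<noteq> 0 \<Longrightarrow> j = f r n"
    and col_e: "\<And>r n i. r \<in> R \<Longrightarrow> i \<in> I \<Longrightarrow> t i (e r (Suc n)) \<noteq> 0 \<Longrightarrow> i = e r n"
    and col_f: "\<And>r n i. r \<in> R \<Longrightarrow> i \<in> I \<Longrightarrow> t i (f r (Suc n)) \<noteq> 0 \<Longrightarrow> i = e r (Suc n) \<or> i = f r (Suc (Suc n))"
    and periodic: "\<And>r. r \<in> R \<Longrightarrow> \<exists>p>0. \<exists>N. \<forall>n\<ge>N. t (e r (n + p)) (f r (n + p)) = t (e r n) (f r n) \<and>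
        t (f r (Suc (n + p))) (f r (n + p)) = t (f r (Suc n)) (f r n)"
begin

text \<open>
  Negative and increasing to \<open>0\<close> along \<open>e\<close>, positive and decreasing to \<open>0\<close> along \<open>f\<close>: a path moves up in
  height on its way out, when it turns, and on its way back.
\<close>

definition height :: "'i \<Rightarrow> real" where
  "height i = (if \<exists>r\<in>R. \<exists>n. i = e r n then - inverse (real (Suc (THE n. \<exists>r\<in>R. i = e r n)))
     else inverse (real (Suc (THE n. \<exists>r\<in>R. i = f r n))))"

lemma height_e: "r \<in> R \<Longrightarrow> height (e r n) = - inverse (real (Suc n))"
proof -
  assume r: "r \<in> R"
  have "(THE m. \<exists>r'\<in>R. e r n = e r' m) = n" using r e_inj by (intro the_equality) blast+
  then show ?thesis using r by (auto simp: height_def)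
qed

lemma height_f: "r \<in> R \<Longrightarrow> height (f r n) = inverse (real (Suc n))"
proof -
  assume r: "r \<in> R"
  have "(THE m. \<exists>r'\<in>R. f r n = f r' m) = n" using r f_inj by (intro the_equality) blast+
  moreover have "\<not> (\<exists>r'\<in>R. \<exists>m. f r n = e r' m)" using r e_f by metis
  ultimately show ?thesis by (simp add: height_def)
qed

lemma height_ascending:
  assumes "i \<in> I - F1" "j \<in> I - F1" "t i j \<noteq> 0"
  shows "height i < height j"
proof -
  obtain r n where r: "r \<in> R" "i = e r (Suc n) \<or> i = f r (Suc n)"
    using assms(1) I_eq by auto
  from r(2) show ?thesis
  proof
    assume i: "i = e r (Suc n)"
    then have "j = e r (Suc (Suc n)) \<or> j = f r (Suc n)" using row_e r assms by auto
    then show ?thesis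
      using r i by (auto simp: height_e height_f intro: less_trans[of _ 0] simp del: of_nat_Suc)
  next
    assume i: "i = f r (Suc n)"
    then have "j = f r n" using row_f r assms by auto
    then show ?thesis using r i by (auto simp: height_f)
  qed
qed

sublocale triangular_weights I t B F1 height
  using finite_F1 F1_sub height_ascending by unfold_locales

abbreviation coeff_a :: "complex \<Rightarrow> 'r \<Rightarrow> nat \<Rightarrow> complex" where
  "coeff_a u r \<equiv> \<lambda>n. u * of_real (t (e r n) (f r n))"

abbreviation coeff_b :: "complex \<Rightarrow> 'r \<Rightarrow> nat \<Rightarrow> complex" where
  "coeff_b u r \<equiv> \<lambda>n. u * of_real (t (f r (Suc n)) (f r n))"

text \<open>
  The matrix of \<open>1 - u T\<close> after the cusp sections \<open>r \<in> Q\<close> have been eliminated, each of which leaves the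
  entry \<open>- s r\<close> at its base.
\<close>

definition cusp_matrix :: "complex \<Rightarrow> 'r set \<Rightarrow> ('r \<Rightarrow> complex) \<Rightarrow> 'i \<Rightarrow> 'i \<Rightarrow> complex" where
  "cusp_matrix u Q s i j = (if \<exists>r\<in>Q. i = e r 0 \<and> j = f r 0 then - s (THE r. r \<in> Q \<and> i = e r 0)
     else char_matrix t u i j)"

definition truncation :: "'r set \<Rightarrow> nat \<Rightarrow> 'i set" where
  "truncation Q n = F1 \<union> (\<Union>r\<in>Q. e r ` {1..n} \<union> f r ` {1..n})"

lemma e_mem_I: "r \<in> R \<Longrightarrow> e r n \<in> I" and f_mem_I: "r \<in> R \<Longrightarrow> f r n \<in> I"
proof -
  assume "r \<in> R"
  then show "e r n \<in> I" "f r n \<in> I"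
    using base[of r] F1_sub by (cases n; force simp: I_eq)+
qed

lemma truncation_sub: "Q \<subseteq> R \<Longrightarrow> truncation Q n \<subseteq> I"
  using F1_sub e_mem_I f_mem_I by (auto simp: truncation_def subset_iff)

lemma finite_truncation: "Q \<subseteq> R \<Longrightarrow> finite (truncation Q n)"
  using finite_subset[of Q R] finite_R finite_F1 by (auto simp: truncation_def)

lemma cusp_matrix_with_entry:
  assumes "r \<in> R" "Q \<subseteq> R" "r \<notin> Q"
  shows "with_entry (cusp_matrix u Q s) (e r 0) (f r 0) (- s r) = cusp_matrix u (insert r Q) s"
proof (intro ext)
  fix i j
  have the: "(THE r'. r' \<in> Q' \<and> e r'' 0 = e r' 0) = r''" if "r'' \<in> Q'" "Q' \<subseteq> R" for Q' r''
    using that e_inj by (intro the_equality) blast+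
  have ex: "(\<exists>r'\<in>Q'. e r'' 0 = e r' 0 \<and> f r'' 0 = f r' 0) \<longleftrightarrow> r'' \<in> Q'" if "r'' \<in> R" "Q' \<subseteq> R" for Q' r''
    using that e_inj by blast
  show "with_entry (cusp_matrix u Q s) (e r 0) (f r 0) (- s r) i j = cusp_matrix u (insert r Q) s i j"
  proof (cases "i = e r 0 \<and> j = f r 0")
    case True
    then show ?thesis using assms the[of r "insert r Q"] by (auto simp: with_entry_def cusp_matrix_def)
  next
    case False
    then have 1: "with_entry (cusp_matrix u Q s) (e r 0) (f r 0) (- s r) i j = cusp_matrix u Q s i j"
      by (auto simp: with_entry_def)
    show ?thesis
    proof (cases "\<exists>r'\<in>Q. i = e r' 0 \<and> j = f r' 0")
      case True
      then obtain r' where r': "r' \<in> Q" "i = e r' 0" "j = f r' 0" by auto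
      then show ?thesis unfolding 1
        using the[of r' Q] the[of r' "insert r Q"] assms by (auto simp: cusp_matrix_def)
    next
      case False': False
      then show ?thesis unfolding 1 using False by (auto simp: cusp_matrix_def)
    qed
  qed
qed

text \<open>
  The cusp sections are eliminated one after the other; \<open>Q'\<close> collects those that are already gone.
\<close>

lemma Det_truncation:
  assumes "finite Q" "Q \<subseteq> R" "Q' \<subseteq> R" "Q \<inter> Q' = {}"
  shows "Det (truncation Q n) (cusp_matrix u Q' (\<lambda>r. nested (coeff_a u r) (\<lambda>n. u * coeff_b u r n) n (coeff_a u r n))) =
    Det F1 (cusp_matrix u (Q \<union> Q') (\<lambda>r. nested (coeff_a u r) (\<lambda>n. u * coeff_b u r n) n (coeff_a u r n)))"
  using assms
proof (induction Q arbitrary: Q' rule: finite_induct)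
  case empty
  then show ?case by (simp add: truncation_def)
next
  case (insert r Q)
  let ?s = "\<lambda>r. nested (coeff_a u r) (\<lambda>n. u * coeff_b u r n) n (coeff_a u r n)"
  let ?A = "cusp_matrix u Q' ?s" and ?G = "truncation Q n"
  have r: "r \<in> R" "r \<notin> Q'" "Q \<subseteq> R" "r \<notin> Q" using insert by auto
  have all: "?G \<union> range (e r) \<union> range (f r) \<subseteq> I"
    using truncation_sub[OF r(3)] e_mem_I f_mem_I r by auto
  have e_eq: "e r m = e r n' \<longleftrightarrow> m = n'" and f_eq: "f r m = f r n' \<longleftrightarrow> m = n'" for m n'
    using e_inj[OF r(1,1)] f_inj[OF r(1,1)] by blast+
  have ef: "e r m \<noteq> f r n'" "f r n' \<noteq> e r m" for m n' using e_f[OF r(1,1)] by metis+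
  have not_base: "e r' 0 \<noteq> e r (Suc m)" "f r' 0 \<noteq> e r (Suc m)" "f r' 0 \<noteq> f r (Suc m)" "e r' 0 \<noteq> f r (Suc m)"
    if "r' \<in> R" for r' m
    using base[OF that] outside[OF r(1), of m] by auto
  have A_row: "?A (e r (Suc m)) j = char_matrix t u (e r (Suc m)) j"
     "?A (f r (Suc m)) j = char_matrix t u (f r (Suc m)) j"
     "?A j (e r (Suc m)) = char_matrix t u j (e r (Suc m))"
     "?A j (f r (Suc m)) = char_matrix t u j (f r (Suc m))" for m j
  proof -
    have "\<not> (\<exists>r'\<in>Q'. e r (Suc m) = e r' 0 \<and> j = f r' 0)" "\<not> (\<exists>r'\<in>Q'. f r (Suc m) = e r' 0 \<and> j = f r' 0)"
      "\<not> (\<exists>r'\<in>Q'. j = e r' 0 \<and> e r (Suc m) = f r' 0)" "\<not> (\<exists>r'\<in>Q'. j = e r' 0 \<and> f r (Suc m) = f r' 0)"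
      using insert.prems(2) not_base by (metis subsetD)+
    then show "?A (e r (Suc m)) j = char_matrix t u (e r (Suc m)) j"
     "?A (f r (Suc m)) j = char_matrix t u (f r (Suc m)) j"
     "?A j (e r (Suc m)) = char_matrix t u j (e r (Suc m))"
     "?A j (f r (Suc m)) = char_matrix t u j (f r (Suc m))"
      unfolding cusp_matrix_def by (simp_all only: if_False)
  qed
  have A0: "?A (e r 0) (f r 0) = - coeff_a u r 0"
  proof -
    have "\<not> (\<exists>r'\<in>Q'. e r 0 = e r' 0)" using e_inj[OF r(1)] insert.prems r by blast
    then show ?thesis by (auto simp: cusp_matrix_def char_matrix_def ef)
  qed
  have with_entry_trivial: "with_entry ?A (e r n) (f r n) (- coeff_a u r n) = ?A"
  proof -
    have "?A (e r n) (f r n) = - coeff_a u r n"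
      using A0 A_row(1)[of "n - 1" "f r n"] by (cases n) (auto simp: char_matrix_def ef)
    then show ?thesis by (auto simp: with_entry_def fun_eq_iff)
  qed
  have "truncation (insert r Q) n = ?G \<union> e r ` {1..n} \<union> f r ` {1..n}"
    by (auto simp: truncation_def)
  then have "Det (truncation (insert r Q) n) ?A =
      Det (?G \<union> e r ` {1..n} \<union> f r ` {1..n}) (with_entry ?A (e r n) (f r n) (- coeff_a u r n))"
    by (simp only: with_entry_trivial)
  also have "\<dots> = Det ?G (with_entry ?A (e r 0) (f r 0) (- ?s r))"
  proof (rule Det_chain)
    show "finite ?G" using finite_truncation r by auto
    show "e r 0 \<in> ?G" "f r 0 \<in> ?G" using base r by (auto simp: truncation_def)
    show "e r (Suc m) \<notin> ?G" "f r (Suc m) \<notin> ?G" for m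
    proof -
      have ne: "e r (Suc m) \<noteq> e r' k" "f r (Suc m) \<noteq> f r' k" if "r' \<in> Q" for r' k
        using that r e_inj[OF r(1), of r' "Suc m" k] f_inj[OF r(1), of r' "Suc m" k] by auto
      have ne': "e r (Suc m) \<noteq> f r' k" "f r (Suc m) \<noteq> e r' k" if "r' \<in> Q" for r' k
        using that r e_f[OF r(1), of r' "Suc m" k] e_f[OF _ r(1), of r' k "Suc m"] by auto
      show "e r (Suc m) \<notin> ?G" "f r (Suc m) \<notin> ?G"
        using outside[OF r(1), of m] ne ne' unfolding truncation_def by blast+
    qed
    show "inj (e r)" "inj (f r)" by (auto simp: inj_def e_eq f_eq)
    show "e r m \<noteq> f r n'" for m n' by (rule ef)
    show "?A (e r 0) (f r 0) = - coeff_a u r 0" by (rule A0)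
    fix m i assume "i \<in> ?G \<union> range (e r) \<union> range (f r)"
    then have i: "i \<in> I" using all by auto
    show "?A i (e r (Suc m)) = (if i = e r (Suc m) then 1 else if i = e r m then - u else 0)"
      using col_e[OF r(1) i, of m] out[OF r(1), of m]
      by (cases "t i (e r (Suc m)) = 0") (auto simp: A_row char_matrix_def e_eq)
    show "?A i (f r (Suc m)) = (if i = f r (Suc m) then 1 else if i = e r (Suc m) then - coeff_a u r (Suc m)
          else if i = f r (Suc (Suc m)) then - coeff_b u r (Suc m) else 0)"
      using col_f[OF r(1) i, of m]
      by (cases "t i (f r (Suc m)) = 0") (auto simp: A_row char_matrix_def f_eq ef)
    show "?A (e r (Suc m)) i = (if i = e r (Suc m) then 1 else if i = e r (Suc (Suc m)) then - u
          else if i = f r (Suc m) then - coeff_a u r (Suc m) else 0)"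
      using row_e[OF r(1) i, of m] out[OF r(1), of "Suc m"]
      by (cases "t (e r (Suc m)) i = 0") (auto simp: A_row char_matrix_def e_eq ef)
    show "?A (f r (Suc m)) i = (if i = f r (Suc m) then 1 else if i = f r m then - coeff_b u r m else 0)"
      using row_f[OF r(1) i, of m]
      by (cases "t (f r (Suc m)) i = 0") (auto simp: A_row char_matrix_def f_eq)
  qed
  also have "\<dots> = Det ?G (cusp_matrix u (insert r Q') ?s)"
    using insert.prems r by (subst cusp_matrix_with_entry) auto
  also have "\<dots> = Det F1 (cusp_matrix u (Q \<union> insert r Q') ?s)"
    using insert r by (intro insert.IH) auto
  finally show ?case by simp
qed

lemma filterlim_truncation: "filterlim (truncation R) (finite_subsets_at_top I) sequentially"
  unfolding filterlim_finite_subsets_at_top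
proof (intro allI impI)
  fix X assume X: "finite X \<and> X \<subseteq> I"
  have "eventually (\<lambda>n. \<forall>x\<in>X. x \<in> truncation R n) sequentially"
  proof (rule eventually_ball_finite)
    show "finite X" using X by simp
    show "\<forall>x\<in>X. eventually (\<lambda>n. x \<in> truncation R n) sequentially"
    proof
      fix x assume "x \<in> X"
      then consider "x \<in> F1" | r m where "r \<in> R" "x = e r (Suc m)" | r m where "r \<in> R" "x = f r (Suc m)"
        using X I_eq by auto
      then show "eventually (\<lambda>n. x \<in> truncation R n) sequentially"
      proof cases
        case 1
        then show ?thesis by (auto simp: truncation_def)
      next
        case 2
        then have "x \<in> truncation R n" if "Suc m \<le> n" for n
          using that unfolding truncation_def by (intro UnI2 UN_I[of r] UnI1) auto
        then show ?thesis by (rule eventually_sequentiallyI)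
      next
        case 3
        then have "x \<in> truncation R n" if "Suc m \<le> n" for n
          using that unfolding truncation_def by (intro UnI2 UN_I[of r] UnI2) auto
        then show ?thesis by (rule eventually_sequentiallyI)
      qed
    qed
  qed
  then show "eventually (\<lambda>n. finite (truncation R n) \<and> X \<subseteq> truncation R n \<and> truncation R n \<subseteq> I) sequentially"
    by eventually_elim (use finite_truncation truncation_sub in auto)
qed

text \<open>
  The determinant is the limit along the truncations of all cusp sections to \<open>n\<close> layers. These
  truncated determinants equal determinants over \<open>F1\<close> in which only the entries at \<open>(e r 0, f r 0)\<close>
  depend on \<open>n\<close>.
\<close>

theorem rational_on_net_det:
  assumes r: "r * B < 1" "0 < r" "r \<le> 1"
    and A: "\<And>u. linear_SP I (A u)" "\<And>u i j. i \<in> I \<Longrightarrow> j \<in> I \<Longrightarrow> A u (basis i) j = char_matrix t u i j"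
  shows "rational_on r (\<lambda>u. net_det I (A u))"
proof -
  define s where "s u q = tail_sum (coeff_a u q) (\<lambda>n. u * coeff_b u q n) 0" for u q
  have le: "0 \<le> t i j" "t i j \<le> B" if "i \<in> I" "j \<in> I" for i j
    using t_nonneg[OF that] row_sum[of i "{j}"] that by auto
  have R: "rational_on r (\<lambda>u. s u q)" if q: "q \<in> R" for q
  proof -
    obtain p N where "p > 0" "\<And>n. n \<ge> N \<Longrightarrow> t (e q (n + p)) (f q (n + p)) = t (e q n) (f q n) \<and>
        t (f q (Suc (n + p))) (f q (n + p)) = t (f q (Suc n)) (f q n)"
      using periodic[OF q] by metis
    then show ?thesis unfolding s_def
      using q r B_pos by (intro rational_on_tail_sum[of _ B _ _ p N]) (auto intro!: le e_mem_I f_mem_I)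
  qed
  have "net_det I (A u) = Det F1 (cusp_matrix u R (s u))" if u: "norm u < r" for u
  proof -
    let ?s = "\<lambda>n r. nested (coeff_a u r) (\<lambda>n. u * coeff_b u r n) n (coeff_a u r n)"
    have "norm u * B \<le> r * B" using u B_pos by (intro mult_right_mono) auto
    then have uB: "norm u * B < 1" using r by simp
    have u1: "norm u \<le> 1" using u r by simp
    have "(\<lambda>n. Det (truncation R n) (char_matrix t u)) \<longlonglongrightarrow> net_det I (A u)"
      using filterlim_compose[OF Det_tendsto[OF uB] filterlim_truncation]
        det_class_of_char_matrix(2)[OF A uB] by simp
    moreover have "Det (truncation R n) (char_matrix t u) = Det F1 (cusp_matrix u R (?s n))" for n
      using Det_truncation[of R "{}" n u] finite_R by (simp add: cusp_matrix_def[of u "{}", abs_def])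
    moreover have "(\<lambda>n. ?s n q) \<longlonglongrightarrow> s u q" if q: "q \<in> R" for q
      unfolding s_def
    proof (rule nested_tendsto)
      show "norm (coeff_a u q k) \<le> B" for k
        using mult_mono[OF u1 le(2)[OF e_mem_I f_mem_I, OF q q]] le(1)[OF e_mem_I f_mem_I, OF q q] B_pos
        by (simp add: norm_mult)
      show "norm (u * coeff_b u q k) \<le> norm u * B" for k
      proof -
        have "norm u * t (f q (Suc k)) (f q k) \<le> 1 * B"
          using u1 le[OF f_mem_I f_mem_I, OF q q] by (intro mult_mono) auto
        then have "norm u * (norm u * t (f q (Suc k)) (f q k)) \<le> norm u * B" by (intro mult_left_mono) auto
        then show ?thesis using le(1)[OF f_mem_I f_mem_I, OF q q] by (simp add: norm_mult)
      qed
    qed (rule uB)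
    then have "(\<lambda>n. cusp_matrix u R (?s n) i j) \<longlonglongrightarrow> cusp_matrix u R (s u) i j" for i j
    proof (cases "\<exists>q\<in>R. i = e q 0 \<and> j = f q 0")
      case True
      then obtain q where q: "q \<in> R" "i = e q 0" "j = f q 0" by auto
      moreover have "(THE r. r \<in> R \<and> e q 0 = e r 0) = q" using q e_inj by (intro the_equality) blast+
      ultimately show ?thesis
        using \<open>\<And>q. q \<in> R \<Longrightarrow> (\<lambda>n. ?s n q) \<longlonglongrightarrow> s u q\<close>[of q] True
        by (auto simp: cusp_matrix_def intro!: tendsto_minus)
    next
      case False
      then have "cusp_matrix u R s' i j = char_matrix t u i j" for s'
        unfolding cusp_matrix_def by (rule if_not_P)
      then show ?thesis by simp
    qed
    then have "(\<lambda>n. Det F1 (cusp_matrix u R (?s n))) \<longlonglongrightarrow> Det F1 (cusp_matrix u R (s u))"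
      unfolding Det_def by (intro tendsto_intros)
    ultimately show ?thesis using LIMSEQ_unique by (simp only:)
  qed
  moreover have "rational_on r (\<lambda>u. Det F1 (cusp_matrix u R (s u)))"
  proof (rule rational_on_Det)
    fix i j
    show "rational_on r (\<lambda>u. cusp_matrix u R (s u) i j)"
    proof (cases "\<exists>q\<in>R. i = e q 0 \<and> j = f q 0")
      case True
      then obtain q where q: "q \<in> R" "i = e q 0" "j = f q 0" by auto
      moreover have "(THE r. r \<in> R \<and> e q 0 = e r 0) = q" using q e_inj by (intro the_equality) blast+
      ultimately show ?thesis using True R[of q]
        by (auto simp: cusp_matrix_def intro!: rational_on_uminus)
    next
      case False
      then have "cusp_matrix u R s' i j = char_matrix t u i j" for u s'
        unfolding cusp_matrix_def by (rule if_not_P)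
      then show ?thesis
        by (simp only: char_matrix_def)
          (intro rational_on_mult rational_on_diff rational_on_const rational_on_ident)
    qed
  qed
  ultimately show ?thesis by (subst rational_on_cong)
qed

end

section \<open>Reduced walks in trees\<close>

locale tree_graph =
  fixes Y :: "'v pair_pre_digraph"
  assumes is_tree: "is_tree Y"
begin

abbreviation V where "V \<equiv> pverts Y"
abbreviation E where "E \<equiv> parcs Y"

sublocale pair_bidirected_digraph Y
  using is_tree by (simp add: is_tree_def)

lemma E_sym: "(x, y) \<in> E \<Longrightarrow> (y, x) \<in> E"
  using pair_sym_arcs arcs_ends_symmetric[of "with_proj Y"] by (simp add: with_proj_simps)

lemma E_V: "(x, y) \<in> E \<Longrightarrow> x \<in> V" "(x, y) \<in> E \<Longrightarrow> y \<in> V"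
  by (auto dest: in_arcsD1 in_arcsD2)

lemma connected_induct [consumes 2, case_names base step]:
  assumes "x \<in> V" "y \<in> V" "P x" "\<And>y z. P y \<Longrightarrow> (y, z) \<in> E \<Longrightarrow> P z"
  shows "P y"
proof -
  have "(x, y) \<in> rtrancl_on V (E\<^sup>s)"
    using is_tree assms by (simp add: is_tree_def connected_conv)
  from this assms(3) show ?thesis
  proof (induction rule: rtrancl_on.induct)
    case (rtrancl_on_into_rtrancl_on a b c)
    then have "(b, c) \<in> E" by (auto simp: symcl_def intro: E_sym)
    with rtrancl_on_into_rtrancl_on show ?case using assms(4) by blast
  qed
qed

lemma no_reduced_closed_walk: "awalk x p x \<Longrightarrow> reduced p \<Longrightarrow> p = []"
  using is_tree unfolding is_tree_def by blast

lemma reduced_reverse: "reduced p \<Longrightarrow> reduced (rev (map prod.swap p))"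
  unfolding reduced_def successively_rev successively_map
  by (erule successively_mono) auto

lemma awalk_reverse: "awalk x p y \<Longrightarrow> awalk y (rev (map prod.swap p)) x"
proof (induction p arbitrary: x)
  case (Cons a p)
  then have "awalk y (rev (map prod.swap p)) (snd a)" "a \<in> E" "fst a = x"
    by (auto simp: awalk_Cons_iff)
  moreover have "awalk (snd a) [prod.swap a] (fst a)"
    using \<open>a \<in> E\<close> by (cases a) (auto simp: awalk_Cons_iff awalk_Nil_iff E_V intro: E_sym)
  ultimately show ?case by (auto intro: awalk_appendI)
qed (simp add: awalk_Nil_iff)

text \<open>
  If the last edges agree, remove them. Otherwise one walk followed by the reverse of the other is a
  reduced closed walk.
\<close>

lemma reduced_walk_unique:
  assumes "awalk x p y" "awalk x q y" "reduced p" "reduced q"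
  shows "p = q"
  using assms
proof (induction p arbitrary: q y rule: rev_induct)
  case Nil
  then show ?case using no_reduced_closed_walk[of x q] by (auto simp: awalk_Nil_iff)
next
  case (snoc a p)
  show ?case
  proof (cases q rule: rev_cases)
    case Nil
    then show ?thesis using no_reduced_closed_walk[of x "p @ [a]"] snoc.prems by (auto simp: awalk_Nil_iff)
  next
    case q: (snoc q' b)
    show ?thesis
    proof (cases "a = b")
      case True
      have "awalk x p (fst a)" "awalk x q' (fst a)" "reduced p" "reduced q'"
        using snoc.prems q True by (auto simp: awalk_append_iff awalk_Cons_iff reduced_def successively_append_iff)
      then show ?thesis using snoc.IH q True by blast
    next
      case False
      have w: "awalk x ((p @ [a]) @ rev (map prod.swap q)) x"
        using snoc.prems awalk_reverse by (blast intro: awalk_appendI)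
      have "reduced ((p @ [a]) @ rev (map prod.swap q))"
        using snoc.prems(3) reduced_reverse[OF snoc.prems(4)] False q
        unfolding reduced_def successively_append_iff[of _ "p @ [a]"] by (cases a, cases b) auto
      from no_reduced_closed_walk[OF w this] show ?thesis by simp
    qed
  qed
qed

section \<open>Rays and ends\<close>

lemma ray_edge: "r \<in> rays Y \<Longrightarrow> (fst (r n), fst (r (Suc n))) \<in> E"
  and ray_snd: "r \<in> rays Y \<Longrightarrow> snd (r n) = fst (r (Suc n))"
  and ray_no_back: "r \<in> rays Y \<Longrightarrow> fst (r (Suc (Suc n))) \<noteq> fst (r n)"
proof -
  assume r: "r \<in> rays Y"
  then have *: "r n \<in> E" "snd (r n) = fst (r (Suc n))" "r (Suc n) \<noteq> prod.swap (r n)"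
    "snd (r (Suc n)) = fst (r (Suc (Suc n)))" by (auto simp: rays_def)
  then show "snd (r n) = fst (r (Suc n))" by simp
  show "(fst (r n), fst (r (Suc n))) \<in> E" using * by (cases "r n") auto
  show "fst (r (Suc (Suc n))) \<noteq> fst (r n)" using * by (cases "r n"; cases "r (Suc n)") auto
qed

lemma ray_awalk:
  assumes "r \<in> rays Y"
  shows "awalk (fst (r m)) (map r [m..<m + n]) (fst (r (m + n)))" "reduced (map r [m..<m + n])"
proof -
  show "awalk (fst (r m)) (map r [m..<m + n]) (fst (r (m + n)))"
  proof (induction n)
    case 0
    then show ?case using ray_edge[OF assms, of m] by (auto simp: awalk_Nil_iff E_V)
  next
    case (Suc n)
    have "awalk (fst (r (m + n))) [r (m + n)] (fst (r (Suc (m + n))))"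
      using assms ray_edge[OF assms, of "m + n"] by (auto simp: awalk_Cons_iff awalk_Nil_iff rays_def E_V)
    then show ?case using Suc by (auto intro: awalk_appendI)
  qed
  show "reduced (map r [m..<m + n])"
    using assms unfolding reduced_def successively_map successively_conv_nth by (auto simp: rays_def)
qed

lemma ray_inj:
  assumes "r \<in> rays Y" "fst (r m) = fst (r n)"
  shows "m = n"
proof -
  have *: "m = n" if "m \<le> n" "fst (r m) = fst (r n)" for m n
    using no_reduced_closed_walk[of "fst (r m)" "map r [m..<m + (n - m)]"] ray_awalk[OF assms(1), of m "n - m"] that
    by auto
  then show ?thesis using assms(2) by (metis nat_le_linear)
qed

lemma ray_shift: "r \<in> rays Y \<Longrightarrow> (\<lambda>n. r (a + n)) \<in> rays Y"
  by (auto simp: rays_def)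

lemma ray_equiv_iff:
  "(r, s) \<in> ray_equiv Y \<longleftrightarrow> r \<in> rays Y \<and> s \<in> rays Y \<and> (\<exists>a b. \<forall>n. r (a + n) = s (b + n))"
proof -
  have "(\<exists>N. \<exists>k::int. \<forall>j\<ge>N. int j + k \<ge> 0 \<and> r (nat (int j + k)) = s j) \<longleftrightarrow> (\<exists>a b. \<forall>n. r (a + n) = s (b + n))"
  proof
    assume "\<exists>N. \<exists>k::int. \<forall>j\<ge>N. int j + k \<ge> 0 \<and> r (nat (int j + k)) = s j"
    then obtain N and k :: int where Nk: "\<And>j. j \<ge> N \<Longrightarrow> int j + k \<ge> 0 \<and> r (nat (int j + k)) = s j" by blast
    have "r (nat (int N + k) + n) = s (N + n)" for n
    proof -
      have "nat (int N + k) + n = nat (int (N + n) + k)" using Nk[of N] by auto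
      then show ?thesis using Nk[of "N + n"] by simp
    qed
    then show "\<exists>a b. \<forall>n. r (a + n) = s (b + n)" by blast
  next
    assume "\<exists>a b. \<forall>n. r (a + n) = s (b + n)"
    then obtain a b where ab: "\<And>n. r (a + n) = s (b + n)" by blast
    have "int j + (int a - int b) \<ge> 0 \<and> r (nat (int j + (int a - int b))) = s j" if "j \<ge> b" for j
    proof -
      have "nat (int j + (int a - int b)) = a + (j - b)" using that by auto
      then show ?thesis using ab[of "j - b"] that by auto
    qed
    then show "\<exists>N. \<exists>k::int. \<forall>j\<ge>N. int j + k \<ge> 0 \<and> r (nat (int j + k)) = s j" by blast
  qed
  then show ?thesis by (simp add: ray_equiv_def)
qed

lemma equiv_ray_equiv: "equiv (rays Y) (ray_equiv Y)"
proof (rule equivI)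
  show "ray_equiv Y \<subseteq> rays Y \<times> rays Y" by (auto simp: ray_equiv_def)
  show "refl_on (rays Y) (ray_equiv Y)" by (auto simp: refl_on_def ray_equiv_iff)
  show "sym (ray_equiv Y)" by (rule symI) (auto simp: ray_equiv_iff, metis)
  show "trans (ray_equiv Y)"
  proof (rule transI)
    fix r s q assume "(r, s) \<in> ray_equiv Y" "(s, q) \<in> ray_equiv Y"
    then obtain a b c d where *: "\<And>n. r (a + n) = s (b + n)" "\<And>n. s (c + n) = q (d + n)" "r \<in> rays Y" "q \<in> rays Y"
      unfolding ray_equiv_iff by blast
    have "r ((a + c) + n) = q ((d + b) + n)" for n
      using *(1)[of "c + n"] *(2)[of "b + n"] by (simp add: add_ac)
    then show "(r, q) \<in> ray_equiv Y" using * unfolding ray_equiv_iff by blast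
  qed
qed

end

locale tree_end = tree_graph +
  fixes c
  assumes c: "c \<in> boundary Y"
begin

lemma mem_c_rays: "r \<in> c \<Longrightarrow> r \<in> rays Y"
  using c in_quotient_imp_subset[OF equiv_ray_equiv] by (auto simp: boundary_def)

lemma mem_c_equiv:
  assumes "r \<in> c"
  shows "s \<in> c \<longleftrightarrow> s \<in> rays Y \<and> (\<exists>a b. \<forall>n. r (a + n) = s (b + n))"
proof -
  have "s \<in> c \<longleftrightarrow> (r, s) \<in> ray_equiv Y"
    using c assms quotient_eq_iff[OF equiv_ray_equiv, of c c r s]
      in_quotient_imp_closed[OF equiv_ray_equiv, of c r s] unfolding boundary_def by blast
  then show ?thesis using mem_c_rays[OF assms] by (simp add: ray_equiv_iff)
qed

lemma c_nonempty: "c \<noteq> {}"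
  using c in_quotient_imp_non_empty[OF equiv_ray_equiv] by (auto simp: boundary_def)

lemma ray_neighbour:
  assumes s: "s \<in> c" and yz: "(fst (s 0), z) \<in> E"
  shows "(snd (s 0) = z \<and> (\<lambda>n. s (Suc n)) \<in> c) \<or> case_nat (z, fst (s 0)) s \<in> c"
proof (cases "snd (s 0) = z")
  case True
  have "(\<lambda>n. s (Suc n)) \<in> rays Y" using mem_c_rays[OF s] by (auto simp: rays_def)
  moreover have "\<forall>n. s (1 + n) = s (Suc (0 + n))" by simp
  ultimately show ?thesis using True mem_c_equiv[OF s] by blast
next
  case False
  have "case_nat (z, fst (s 0)) s \<in> rays Y"
    using mem_c_rays[OF s] False E_sym[OF yz] by (cases "s 0") (auto simp: rays_def split: nat.splits)
  moreover have "\<forall>n. s (0 + n) = case_nat (z, fst (s 0)) s (1 + n)" by simp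
  ultimately show ?thesis using mem_c_equiv[OF s] by blast
qed

text \<open>
  Having a ray in \<open>c\<close> passes from a vertex to its neighbours, by dropping or prepending an edge.
\<close>

lemma ray_exists:
  assumes "x \<in> V"
  shows "\<exists>r\<in>c. fst (r 0) = x"
proof -
  obtain r where r: "r \<in> c" using c_nonempty by auto
  have "fst (r 0) \<in> V" using ray_edge[OF mem_c_rays[OF r], of 0] by (auto simp: E_V)
  from this assms show ?thesis
  proof (induction rule: connected_induct)
    case base
    then show ?case using r by blast
  next
    case (step y z)
    then obtain s where s: "s \<in> c" "fst (s 0) = y" by blast
    have "(fst (s 0), z) \<in> E" using step s by simp
    from ray_neighbour[OF s(1) this] show ?case
    proof
      assume "snd (s 0) = z \<and> (\<lambda>n. s (Suc n)) \<in> c"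
      moreover have "snd (s 0) = fst (s (Suc 0))" using ray_snd[OF mem_c_rays[OF s(1)], of 0] .
      ultimately show ?thesis by (intro bexI[of _ "\<lambda>n. s (Suc n)"]) auto
    next
      assume "case_nat (z, fst (s 0)) s \<in> c"
      then show ?thesis by (intro bexI[of _ "case_nat (z, fst (s 0)) s"]) auto
    qed
  qed
qed

lemma ray_unique:
  assumes "r \<in> c" "s \<in> c" "fst (r 0) = fst (s 0)"
  shows "r = s"
proof -
  obtain a b where ab: "\<And>n. r (a + n) = s (b + n)" using mem_c_equiv[OF assms(1)] assms(2) by blast
  have "map r [0..<a] = map s [0..<b]"
    using ray_awalk[OF mem_c_rays[OF assms(1)], of 0 a] ray_awalk[OF mem_c_rays[OF assms(2)], of 0 b]
      assms(3) ab[of 0] by (intro reduced_walk_unique[of "fst (r 0)" _ "fst (r a)"]) auto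
  moreover from this have "a = b" by (metis length_map length_upt minus_nat.diff_0)
  ultimately have "r n = s n" if "n < a" for n using that by (metis diff_zero nth_map_upt add_0)
  moreover have "r n = s n" if "n \<ge> a" for n using ab[of "n - a"] \<open>a = b\<close> that by simp
  ultimately show ?thesis by (metis ext not_le)
qed

text \<open>
  The first step from \<open>x\<close> towards the end \<open>c\<close>. Together with the uniqueness of rays it replaces rays in \<open>c\<close> by
  iterates of a single map, and horocycles by the relation of having a common iterate at the same
  step.
\<close>

definition par :: "'a \<Rightarrow> 'a" where
  "par x = (if x \<in> V then snd ((THE r. r \<in> c \<and> fst (r 0) = x) 0) else x)"

lemma ray_par:
  assumes "r \<in> c"
  shows "fst (r n) = (par ^^ n) (fst (r 0))"
proof (induction n)
  case (Suc n)
  have s: "(\<lambda>k. r (n + k)) \<in> c"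
    by (rule iffD2[OF mem_c_equiv[OF assms]], intro conjI ray_shift[OF mem_c_rays[OF assms]]
        exI[of _ n] exI[of _ 0]) simp
  have "(THE q. q \<in> c \<and> fst (q 0) = fst (r n)) = (\<lambda>k. r (n + k))"
  proof (rule the_equality)
    show "(\<lambda>k. r (n + k)) \<in> c \<and> fst (r (n + 0)) = fst (r n)" using s by simp
    fix q assume "q \<in> c \<and> fst (q 0) = fst (r n)"
    then show "q = (\<lambda>k. r (n + k))" by (intro ray_unique) (simp_all add: s)
  qed
  moreover have "fst (r n) \<in> V" using ray_edge[OF mem_c_rays[OF assms], of n] by (auto simp: E_V)
  ultimately have "par (fst (r n)) = fst (r (Suc n))"
    using ray_snd[OF mem_c_rays[OF assms], of n] by (simp add: par_def)
  then show ?case using Suc by simp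
qed simp

definition ray_from :: "'a \<Rightarrow> nat \<Rightarrow> 'a \<times> 'a" where
  "ray_from x n = ((par ^^ n) x, (par ^^ Suc n) x)"

lemma mem_c_eq: "r \<in> c \<Longrightarrow> r = ray_from (fst (r 0))"
  unfolding ray_from_def
  by (rule ext) (metis mem_c_rays prod.collapse ray_par ray_snd)

lemma ray_from_mem: "x \<in> V \<Longrightarrow> ray_from x \<in> c"
  using ray_exists mem_c_eq by metis

lemma par_iter_V: "x \<in> V \<Longrightarrow> (par ^^ n) x \<in> V"
  using ray_edge[OF mem_c_rays[OF ray_from_mem], of x n] by (auto simp: ray_from_def E_V)

lemma par_edge: "x \<in> V \<Longrightarrow> (x, par x) \<in> E"
  using ray_edge[OF mem_c_rays[OF ray_from_mem], of x 0] by (simp add: ray_from_def)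

lemma par_iter_inj: "x \<in> V \<Longrightarrow> (par ^^ m) x = (par ^^ n) x \<Longrightarrow> m = n"
  using ray_inj[OF mem_c_rays[OF ray_from_mem], of x m n] by (simp add: ray_from_def)

lemma edge_par:
  assumes "(x, y) \<in> E"
  shows "y = par x \<or> x = par y"
proof -
  have x: "x \<in> V" using assms E_V by blast
  have "(snd (ray_from x 0) = y \<and> (\<lambda>n. ray_from x (Suc n)) \<in> c) \<or> case_nat (y, fst (ray_from x 0)) (ray_from x) \<in> c"
    using ray_neighbour[OF ray_from_mem[OF x], of y] assms by (simp add: ray_from_def)
  then show ?thesis
  proof
    assume "case_nat (y, fst (ray_from x 0)) (ray_from x) \<in> c"
    from ray_par[OF this, of 1] show ?thesis by (simp add: ray_from_def)
  qed (simp add: ray_from_def)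
qed

lemma par_merge:
  assumes "x \<in> V" "y \<in> V"
  shows "\<exists>a b. (par ^^ a) x = (par ^^ b) y"
proof -
  obtain a b where "\<And>n. ray_from x (a + n) = ray_from y (b + n)"
    using mem_c_equiv[OF ray_from_mem[OF assms(1)], of "ray_from y"] ray_from_mem[OF assms(2)] by blast
  from this[of 0] show ?thesis by (auto simp: ray_from_def)
qed

lemma same_horocycle_iff:
  assumes "x \<in> V" "y \<in> V"
  shows "same_horocycle c x y \<longleftrightarrow> (\<exists>n. (par ^^ n) x = (par ^^ n) y)"
  unfolding same_horocycle_def
  using ray_from_mem[OF assms(1)] ray_from_mem[OF assms(2)] ray_par
  by (metis fst_conv funpow_0 ray_from_def)

end

section \<open>Group actions on trees\<close>

locale tree_action = tree_graph Y
  for \<Gamma> :: "('g, 'm) monoid_scheme" and \<phi> :: "'g \<Rightarrow> 'v \<Rightarrow> 'v" and Y :: "'v pair_pre_digraph" +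
  assumes lattice: "tree_lattice \<Gamma> \<phi> Y" and orient: "orientation_preserving \<Gamma> \<phi> Y"
begin

abbreviation G where "G \<equiv> carrier \<Gamma>"
abbreviation gmult (infixl "\<cdot>" 70) where "g \<cdot> h \<equiv> g \<otimes>\<^bsub>\<Gamma>\<^esub> h"
abbreviation ginv where "ginv g \<equiv> inv\<^bsub>\<Gamma>\<^esub> g"

sublocale act: group_action \<Gamma> V \<phi>
  using lattice by (simp add: tree_lattice_def)

lemma group: "group \<Gamma>"
  using act.group_hom group_hom.axioms(1) by blast

lemma one_G: "\<one>\<^bsub>\<Gamma>\<^esub> \<in> G" and mult_G: "g \<in> G \<Longrightarrow> h \<in> G \<Longrightarrow> g \<cdot> h \<in> G"
  and inv_G: "g \<in> G \<Longrightarrow> ginv g \<in> G"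
  using group by (auto simp: group.is_monoid monoid.one_closed group.inv_closed monoid.m_closed)

lemma act_V: "g \<in> G \<Longrightarrow> x \<in> V \<Longrightarrow> \<phi> g x \<in> V"
  using act.element_image by blast

lemma act_one: "x \<in> V \<Longrightarrow> \<phi> \<one>\<^bsub>\<Gamma>\<^esub> x = x"
  using act.id_eq_one by (metis restrict_apply')

lemma act_mult: "g \<in> G \<Longrightarrow> h \<in> G \<Longrightarrow> x \<in> V \<Longrightarrow> \<phi> (g \<cdot> h) x = \<phi> g (\<phi> h x)"
  using act.composition_rule by blast

lemma act_inv: "g \<in> G \<Longrightarrow> x \<in> V \<Longrightarrow> \<phi> (ginv g) (\<phi> g x) = x"
  using act.orbit_sym_aux by blast

lemma act_inv': "g \<in> G \<Longrightarrow> x \<in> V \<Longrightarrow> \<phi> g (\<phi> (ginv g) x) = x"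
  using act_inv[of "ginv g" x] group group.inv_inv inv_G by fastforce

lemma act_inj: "g \<in> G \<Longrightarrow> x \<in> V \<Longrightarrow> y \<in> V \<Longrightarrow> \<phi> g x = \<phi> g y \<longleftrightarrow> x = y"
  using act_inv by metis

lemma act_aut: "g \<in> G \<Longrightarrow> \<phi> g \<in> automorphisms Y"
  using lattice by (auto simp: tree_lattice_def)

lemma act_E: "g \<in> G \<Longrightarrow> x \<in> V \<Longrightarrow> y \<in> V \<Longrightarrow> (\<phi> g x, \<phi> g y) \<in> E \<longleftrightarrow> (x, y) \<in> E"
  using act_aut by (auto simp: automorphisms_def)

text \<open>
  An inversion would exchange an edge of the orientation with its reverse.
\<close>

lemma no_inversion:
  assumes "g \<in> G" "(x, y) \<in> E" "\<phi> g x = y" "\<phi> g y = x"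
  shows False
proof -
  obtain D where D: "D \<subseteq> E" "\<forall>e\<in>E. e \<in> D \<longleftrightarrow> prod.swap e \<notin> D" "\<forall>g\<in>G. \<forall>e\<in>D. edge_act \<phi> g e \<in> D"
    using orient unfolding orientation_preserving_def by blast
  have "edge_act \<phi> g (x, y) = (y, x)" "edge_act \<phi> g (y, x) = (x, y)"
    using assms by (auto simp: edge_act_def)
  moreover have "(x, y) \<in> D \<longleftrightarrow> (y, x) \<notin> D" using D(2) assms(2) by (metis prod.swap_def fst_conv snd_conv)
  ultimately show False using D(3) assms(1) by metis
qed

definition nbrs :: "'v \<Rightarrow> 'v set" where
  "nbrs x = {y. (x, y) \<in> E}"

lemma out_arcs_eq: "out_arcs (with_proj Y) x = Pair x ` nbrs x"
  by (auto simp: out_arcs_def nbrs_def)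

lemma finite_nbrs: "finite (nbrs x)"
proof (cases "x \<in> V")
  case True
  then have "finite (Pair x ` nbrs x)"
    using lattice out_arcs_eq[of x] by (auto simp: tree_lattice_def locally_finite_def)
  then show ?thesis by (rule finite_imageD) (auto simp: inj_on_def)
next
  case False
  then have "nbrs x = {}" using E_V(1) unfolding nbrs_def by blast
  then show ?thesis by simp
qed

lemma out_degree_eq: "out_degree (with_proj Y) x = card (nbrs x)"
  unfolding out_degree_def out_arcs_eq by (rule card_image) (auto simp: inj_on_def)

text \<open>
  An element of the vertex stabilizer is determined, up to the finite edge stabilizer, by the
  neighbour to which it moves \<open>y\<close>.
\<close>

lemma finite_stabilizer:
  assumes "(x, y) \<in> E"
  shows "finite {g \<in> G. \<phi> g x = x}"
proof -
  have xy: "x \<in> V" "y \<in> V" using assms E_V by auto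
  let ?S = "{g \<in> G. \<phi> g x = x}"
  have "finite {g \<in> ?S. \<phi> g y = z}" for z
  proof (cases "\<exists>h\<in>?S. \<phi> h y = z")
    case True
    then obtain h where h: "h \<in> G" "\<phi> h x = x" "\<phi> h y = z" by auto
    have fin: "finite (stabilizer \<Gamma> (edge_act \<phi>) (x, y))" using lattice assms by (auto simp: tree_lattice_def)
    have "{g \<in> ?S. \<phi> g y = z} \<subseteq> (\<lambda>k. h \<cdot> k) ` stabilizer \<Gamma> (edge_act \<phi>) (x, y)"
    proof
      fix g assume g: "g \<in> {g \<in> ?S. \<phi> g y = z}"
      let ?k = "ginv h \<cdot> g"
      have "\<phi> ?k x = x" "\<phi> ?k y = y"
        using g h xy act_inv[of h x] act_inv[of h y] by (auto simp: act_mult inv_G)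
      then have "?k \<in> stabilizer \<Gamma> (edge_act \<phi>) (x, y)"
        using g h by (auto simp: stabilizer_def edge_act_def intro: mult_G inv_G)
      moreover have "g = h \<cdot> ?k"
        using g h group by (simp add: group.inv_closed group.is_monoid monoid.m_assoc[symmetric] group.r_inv monoid.l_one)
      ultimately show "g \<in> (\<lambda>k. h \<cdot> k) ` stabilizer \<Gamma> (edge_act \<phi>) (x, y)" by blast
    qed
    then show ?thesis using fin finite_subset by blast
  next
    case False
    then have "{g \<in> ?S. \<phi> g y = z} = {}" by blast
    then show ?thesis by (simp only: finite.emptyI)
  qed
  then have "finite (\<Union>z\<in>nbrs x. {g \<in> ?S. \<phi> g y = z})" using finite_nbrs by blast
  moreover have "?S \<subseteq> (\<Union>z\<in>nbrs x. {g \<in> ?S. \<phi> g y = z})"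
    using act_E xy assms by (auto simp: nbrs_def) metis
  ultimately show ?thesis using finite_subset by blast
qed

definition same_orbit :: "'v \<Rightarrow> 'v \<Rightarrow> bool" where
  "same_orbit x y \<longleftrightarrow> (\<exists>g\<in>G. \<phi> g x = y)"

lemma same_orbit_refl: "x \<in> V \<Longrightarrow> same_orbit x x"
  unfolding same_orbit_def using one_G act_one by blast

lemma same_orbit_sym: "x \<in> V \<Longrightarrow> same_orbit x y \<Longrightarrow> same_orbit y x"
  unfolding same_orbit_def using inv_G act_inv by metis

lemma same_orbit_trans: "x \<in> V \<Longrightarrow> same_orbit x y \<Longrightarrow> same_orbit y z \<Longrightarrow> same_orbit x z"
  unfolding same_orbit_def using mult_G act_mult by metis

lemma same_orbit_act: "g \<in> G \<Longrightarrow> same_orbit x (\<phi> g x)"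
  unfolding same_orbit_def by blast

end

section \<open>Cusps\<close>

lemma funpow_funpow: "(f ^^ m) ((f ^^ n) x) = (f ^^ (m + n)) x"
  by (simp add: funpow_add)

locale cusp_action = tree_action \<Gamma> \<phi> Y + tree_end Y c
  for \<Gamma> :: "('g, 'm) monoid_scheme" and \<phi> :: "'g \<Rightarrow> 'v \<Rightarrow> 'v" and Y :: "'v pair_pre_digraph" and c +
  assumes cusp: "is_cusp \<Gamma> \<phi> Y c"
begin

lemma par_act:
  assumes "\<phi> g \<in> P_stab Y c" "x \<in> V"
  shows "\<phi> g (par x) = par (\<phi> g x)"
proof -
  have "(\<lambda>j. map_prod (\<phi> g) (\<phi> g) (ray_from x j)) \<in> c"
    using assms(1) ray_from_mem[OF assms(2)] unfolding P_stab_def by blast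
  from ray_par[OF this, of 1] show ?thesis by (simp add: ray_from_def)
qed

lemma par_iter_act:
  assumes "\<phi> g \<in> P_stab Y c" "x \<in> V"
  shows "\<phi> g ((par ^^ n) x) = (par ^^ n) (\<phi> g x)"
  by (induction n) (use assms par_act par_iter_V in auto)

text \<open>
  Any two rays of the class share a tail, so it is enough that one of them is carried into the class.
\<close>

lemma P_stabI:
  assumes g: "g \<in> G" and x: "x \<in> V" and comm: "\<And>n. \<phi> g ((par ^^ n) x) = (par ^^ n) (\<phi> g x)"
  shows "\<phi> g \<in> P_stab Y c"
proof -
  \<comment> \<open>Stated for all \<open>g\<close> and \<open>x\<close>, as the opposite inclusion uses the inverse at \<open>\<phi> g x\<close>.\<close>
  have maps: "(\<lambda>j. map_prod (\<phi> g) (\<phi> g) (s j)) \<in> c"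
    if g: "g \<in> G" and x: "x \<in> V" and comm: "\<And>n. \<phi> g ((par ^^ n) x) = (par ^^ n) (\<phi> g x)" and s: "s \<in> c"
    for g x s
  proof (rule iffD2[OF mem_c_equiv[OF ray_from_mem[OF act_V[OF g x]]]], intro conjI)
    have *: "s n \<in> E" "snd (s n) = fst (s (Suc n))" "s (Suc n) \<noteq> prod.swap (s n)" "fst (s n) \<in> V" "snd (s n) \<in> V" for n
      using mem_c_rays[OF s] arc_fst_in_verts arc_snd_in_verts by (auto simp: rays_def)
    show "(\<lambda>j. map_prod (\<phi> g) (\<phi> g) (s j)) \<in> rays Y"
      unfolding rays_def
    proof (intro CollectI allI conjI)
      fix j
      show "map_prod (\<phi> g) (\<phi> g) (s j) \<in> E"
        using *(1,4,5)[of j] act_E[OF g, of "fst (s j)" "snd (s j)"] by (cases "s j") auto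
      show "snd (map_prod (\<phi> g) (\<phi> g) (s j)) = fst (map_prod (\<phi> g) (\<phi> g) (s (Suc j)))"
        using *(2)[of j] by (cases "s j"; cases "s (Suc j)") auto
      show "map_prod (\<phi> g) (\<phi> g) (s (Suc j)) \<noteq> prod.swap (map_prod (\<phi> g) (\<phi> g) (s j))"
        using *(2,3,4,5)[of j] *(4,5)[of "Suc j"] act_inj[OF g] by (cases "s j"; cases "s (Suc j)") auto
    qed
    obtain a b where ab: "\<And>n. ray_from x (a + n) = s (b + n)"
      using mem_c_equiv[OF ray_from_mem[OF x], of s] s by blast
    have "ray_from (\<phi> g x) (a + n) = map_prod (\<phi> g) (\<phi> g) (s (b + n))" for n
      using comm[of "a + n"] comm[of "Suc (a + n)"] by (simp add: ab[symmetric] ray_from_def)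
    then show "\<exists>a b. \<forall>n. ray_from (\<phi> g x) (a + n) = map_prod (\<phi> g) (\<phi> g) (s (b + n))" by blast
  qed
  let ?f = "\<lambda>r j. map_prod (\<phi> g) (\<phi> g) (r j)"
  let ?i = "ginv g"
  have "?f ` c = c"
  proof (intro equalityI subsetI)
    fix s assume "s \<in> ?f ` c" then show "s \<in> c" using maps[OF g x comm] by blast
  next
    fix s assume s: "s \<in> c"
    have "\<phi> ?i ((par ^^ n) (\<phi> g x)) = (par ^^ n) (\<phi> ?i (\<phi> g x))" for n
      unfolding comm[symmetric] using g x par_iter_V by (simp add: act_inv)
    from maps[OF inv_G[OF g] act_V[OF g x] this s]
    have "(\<lambda>j. map_prod (\<phi> ?i) (\<phi> ?i) (s j)) \<in> c" .
    moreover have "?f (\<lambda>j. map_prod (\<phi> ?i) (\<phi> ?i) (s j)) = s"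
    proof
      fix j
      have "fst (s j) \<in> V" "snd (s j) \<in> V"
        using mem_c_rays[OF s] arc_fst_in_verts arc_snd_in_verts by (auto simp: rays_def)
      then show "?f (\<lambda>j. map_prod (\<phi> ?i) (\<phi> ?i) (s j)) j = s j"
        using g by (cases "s j") (auto simp: act_inv')
    qed
    ultimately show "s \<in> ?f ` c" by (metis imageI)
  qed
  then show ?thesis using act_aut[OF g] by (simp add: P_stab_def)
qed

text \<open>
  An element that preserves one horocycle preserves all of them, because the ray of any vertex
  eventually joins the ray of a vertex of that horocycle.
\<close>

lemma N_stab_level:
  assumes g: "g \<in> G" "\<phi> g \<in> N_stab Y c" and x: "x \<in> V"
  shows "\<exists>n. (par ^^ n) (\<phi> g x) = (par ^^ n) x"
proof -
  have P: "\<phi> g \<in> P_stab Y c" using g by (simp add: N_stab_def)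
  obtain H where "H \<in> horocycles Y c" "\<phi> g ` H = H" using g by (auto simp: N_stab_def)
  then obtain z where z: "z \<in> V" "\<phi> g ` {y \<in> V. same_horocycle c z y} = {y \<in> V. same_horocycle c z y}"
    by (auto simp: horocycles_def)
  have "same_horocycle c z z" using same_horocycle_iff z by blast
  then have "same_horocycle c z (\<phi> g z)" using z by blast
  then obtain n where n: "(par ^^ n) z = (par ^^ n) (\<phi> g z)" using same_horocycle_iff z act_V g by blast
  obtain a b where ab: "(par ^^ a) x = (par ^^ b) z" using par_merge x z by blast
  have "(par ^^ (n + a)) (\<phi> g x) = (par ^^ n) (\<phi> g ((par ^^ a) x))"
    using par_iter_act[OF P x] by (simp add: funpow_add)
  also have "\<dots> = (par ^^ b) ((par ^^ n) (\<phi> g z))"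
    unfolding ab par_iter_act[OF P z(1)] funpow_funpow by (simp only: add.commute)
  also have "\<dots> = (par ^^ n) ((par ^^ b) z)"
    unfolding n[symmetric] funpow_funpow by (simp only: add.commute)
  also have "\<dots> = (par ^^ (n + a)) x"
    unfolding ab[symmetric] funpow_funpow ..
  finally show ?thesis by blast
qed

text \<open>
  A base point of a horocycle on which the stabilizer of the cusp is transitive.
\<close>

definition x0 :: 'v where
  "x0 = (SOME x. x \<in> V \<and> (\<forall>y\<in>V. \<forall>n. (par ^^ n) y = (par ^^ n) x \<longrightarrow>
     (\<exists>g\<in>G. \<phi> g \<in> N_stab Y c \<and> \<phi> g x = y)))"

lemma x0: "x0 \<in> V" "\<And>y n. y \<in> V \<Longrightarrow> (par ^^ n) y = (par ^^ n) x0 \<Longrightarrow> \<exists>g\<in>G. \<phi> g \<in> N_stab Y c \<and> \<phi> g x0 = y"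
proof -
  obtain H where H: "H \<in> horocycles Y c" "\<forall>x\<in>H. \<forall>y\<in>H. \<exists>g\<in>G. \<phi> g \<in> N_stab Y c \<and> \<phi> g x = y"
    using cusp by (auto simp: is_cusp_def)
  then obtain x where x: "x \<in> V" "H = {y \<in> V. same_horocycle c x y}" by (auto simp: horocycles_def)
  have "\<exists>g\<in>G. \<phi> g \<in> N_stab Y c \<and> \<phi> g x = y" if "y \<in> V" "(par ^^ n) y = (par ^^ n) x" for y n
  proof -
    have "x \<in> H" "y \<in> H" using x that same_horocycle_iff by auto (metis)
    then show ?thesis using H(2) by blast
  qed
  then have "\<exists>x. x \<in> V \<and> (\<forall>y\<in>V. \<forall>n. (par ^^ n) y = (par ^^ n) x \<longrightarrow> (\<exists>g\<in>G. \<phi> g \<in> N_stab Y c \<and> \<phi> g x = y))"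
    using x(1) by blast
  from someI_ex[OF this, folded x0_def]
  show "x0 \<in> V" "\<And>y n. y \<in> V \<Longrightarrow> (par ^^ n) y = (par ^^ n) x0 \<Longrightarrow> \<exists>g\<in>G. \<phi> g \<in> N_stab Y c \<and> \<phi> g x0 = y"
    by blast+
qed

definition axis :: "nat \<Rightarrow> 'v" where "axis j = (par ^^ j) x0"

lemma axis_V: "axis j \<in> V" and axis_edge: "(axis j, axis (Suc j)) \<in> E" and axis_Suc: "axis (Suc j) = par (axis j)"
  and axis_inj: "axis i = axis j \<longleftrightarrow> i = j" and par_axis: "(par ^^ m) (axis j) = axis (m + j)"
  using par_iter_V[OF x0(1)] par_edge par_iter_inj[OF x0(1)] by (auto simp: axis_def funpow_add)

text \<open>
  Transitivity on the horocycle of \<open>x0\<close>, in terms of rays: the ray of \<open>x0\<close> can be moved onto that of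
  any vertex at the same level, by an element compatible with \<open>par\<close>.
\<close>

lemma axis_descendant:
  assumes "y \<in> V" "(par ^^ n) y = axis n"
  shows "\<exists>g\<in>G. \<phi> g \<in> P_stab Y c \<and> \<phi> g x0 = y \<and> (\<forall>j. \<phi> g (axis j) = (par ^^ j) y)"
proof -
  obtain g where g: "g \<in> G" "\<phi> g \<in> N_stab Y c" "\<phi> g x0 = y" using x0(2)[of y n] assms by (auto simp: axis_def)
  then have "\<phi> g \<in> P_stab Y c" by (simp add: N_stab_def)
  then show ?thesis using g par_iter_act[OF _ x0(1)] by (auto simp: axis_def)
qed

text \<open>
  Suppose the orbit of \<open>v\<close> contains infinitely many \<open>axis j\<close>. The descendants \<open>D j\<close> of \<open>axis j\<close> at the level of
  \<open>x0\<close> form an orbit of a subgroup of the stabilizer of \<open>axis j\<close>, so their number is bounded by the order of the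
  stabilizer of \<open>v\<close>, and \<open>D j = D J\<close> for all large \<open>j\<close>. Hence no infinite path branches off the axis
  beyond \<open>J\<close>. By the pigeonhole principle some \<open>\<gamma>\<close> moves an edge of the axis beyond \<open>J\<close> to a later one;
  as there is no other way to continue, it shifts the whole ray along itself. So \<open>\<gamma>\<close> fixes the cusp but
  preserves no horocycle, contrary to the definition of a cusp.
\<close>

lemma axis_proper:
  assumes v: "v \<in> V"
  shows "finite {j. same_orbit v (axis j)}"
proof (rule ccontr)
  let ?S = "{j. same_orbit v (axis j)}" and ?St = "{g \<in> G. \<phi> g v = v}"
  assume inf: "infinite ?S"
  define D where "D j = {y \<in> V. (par ^^ j) y = axis j}" for j
  obtain w where "(v, w) \<in> E" using par_edge v by blast
  then have finSt: "finite ?St" by (rule finite_stabilizer)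
  have D_mono: "D i \<subseteq> D j" if "i \<le> j" for i j
  proof
    fix y assume "y \<in> D i"
    then have "y \<in> V" "(par ^^ (j - i + i)) y = axis (j - i + i)"
      using par_axis[of "j - i" i] by (auto simp: D_def funpow_add)
    then show "y \<in> D j" using that by (simp add: D_def)
  qed
  have bound_S: "finite (D j) \<and> card (D j) \<le> card ?St" if jS: "j \<in> ?S" for j
  proof -
    obtain h where h: "h \<in> G" "\<phi> h v = axis j" using jS by (auto simp: same_orbit_def)
    let ?u = "\<phi> (ginv h) x0"
    have sub: "D j \<subseteq> (\<lambda>k. \<phi> h (\<phi> k ?u)) ` ?St"
    proof
      fix y assume y: "y \<in> D j"
      then obtain g where g: "g \<in> G" "\<phi> g x0 = y" "\<phi> g (axis j) = (par ^^ j) y"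
        using axis_descendant[of y j] by (auto simp: D_def)
      have gX: "\<phi> g (axis j) = axis j" using g y by (simp add: D_def)
      let ?k = "ginv h \<cdot> (g \<cdot> h)"
      have k: "\<phi> ?k z = \<phi> (ginv h) (\<phi> g (\<phi> h z))" if "z \<in> V" for z
        using that g h by (simp add: act_mult inv_G mult_G)
      have "\<phi> ?k v = v" using k[OF v] h gX act_inv[OF h(1) v] by simp
      then have kSt: "?k \<in> ?St" using g h by (auto intro: mult_G inv_G)
      have "\<phi> h (\<phi> ?k ?u) = y"
        using k[of ?u] g h y x0(1) act_inv'[of h] by (simp add: act_V inv_G D_def)
      then show "y \<in> (\<lambda>k. \<phi> h (\<phi> k ?u)) ` ?St"
        by (intro image_eqI[where x = ?k, OF _ kSt]) (rule sym)
    qed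
    show ?thesis using finite_surj[OF finSt sub] surj_card_le[OF finSt sub] by blast
  qed
  have bound: "finite (D j)" "card (D j) \<le> card ?St" for j
  proof -
    obtain j' where "j \<le> j'" "j' \<in> ?S" using inf unfolding infinite_nat_iff_unbounded_le by blast
    then have "D j \<subseteq> D j'" "finite (D j')" "card (D j') \<le> card ?St" using D_mono bound_S by auto
    then show "finite (D j)" "card (D j) \<le> card ?St"
      using finite_subset card_mono order_trans by metis+
  qed
  obtain J where J: "\<And>j. card (D j) \<le> card (D J)"
    using ex_has_greatest_nat[of "\<lambda>_. True" 0 "\<lambda>j. card (D j)" "Suc (card ?St)"] bound(2)
    by (auto simp: less_Suc_eq_le)
  have DJ: "D j = D J" if "J \<le> j" for j
    using card_seteq[OF bound(1)[of j] D_mono[OF that]] J[of j] by auto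
  \<comment> \<open>Beyond \<open>J\<close>, a descendant of the axis at the level of \<open>x0\<close> descends from the axis all the way.\<close>
  have star: "(par ^^ k) y = axis k" if "J \<le> k" "y \<in> V" "(par ^^ Suc k) y = axis (Suc k)" for k y
  proof -
    have "y \<in> D (Suc k)" using that by (simp add: D_def)
    then have "y \<in> D k" using DJ[of k] DJ[of "Suc k"] that by simp
    then show ?thesis by (simp add: D_def)
  qed
  have "\<forall>j\<in>?S. \<exists>g. g \<in> G \<and> \<phi> g v = axis j" by (auto simp: same_orbit_def)
  from bchoice[OF this] obtain h where h: "\<And>j. j \<in> ?S \<Longrightarrow> h j \<in> G \<and> \<phi> (h j) v = axis j" by blast
  let ?A = "{j \<in> ?S. J \<le> j}" and ?f = "\<lambda>j. \<phi> (ginv (h j)) (axis (Suc j))"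
  have infA: "infinite ?A"
  proof
    assume "finite ?A"
    then have "finite (?A \<union> {..<J})" by simp
    moreover have "?S \<subseteq> ?A \<union> {..<J}" by auto
    ultimately show False using inf finite_subset by blast
  qed
  have "?f ` ?A \<subseteq> nbrs v"
  proof
    fix z assume "z \<in> ?f ` ?A"
    then obtain j where j: "j \<in> ?S" "z = ?f j" by auto
    then have "(\<phi> (ginv (h j)) (axis j), z) \<in> E" using h axis_edge[of j] axis_V by (auto simp: act_E inv_G)
    moreover have "\<phi> (ginv (h j)) (axis j) = v" using h[OF j(1)] act_inv[of "h j" v] v by auto
    ultimately show "z \<in> nbrs v" by (simp add: nbrs_def)
  qed
  then have "finite (?f ` ?A)" using finite_nbrs finite_subset by blast
  then obtain i where i: "i \<in> ?A" "infinite {j \<in> ?A. ?f j = ?f i}"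
    using pigeonhole_infinite[OF infA] by blast
  then obtain j where j: "i < j" "j \<in> ?A" "?f j = ?f i" unfolding infinite_nat_iff_unbounded by blast
  define \<gamma> where "\<gamma> = h j \<cdot> ginv (h i)"
  have hi: "h i \<in> G" "\<phi> (h i) v = axis i" and hj: "h j \<in> G" "\<phi> (h j) v = axis j" using h i j by auto
  have \<gamma>: "\<gamma> \<in> G" using hi hj by (auto simp: \<gamma>_def intro: mult_G inv_G)
  have \<gamma>_act: "\<phi> \<gamma> z = \<phi> (h j) (\<phi> (ginv (h i)) z)" if "z \<in> V" for z
    using that hi hj by (simp add: \<gamma>_def act_mult inv_G)
  have start: "\<phi> \<gamma> (axis i) = axis j" "\<phi> \<gamma> (axis (Suc i)) = axis (Suc j)"
    unfolding \<gamma>_act[OF axis_V] j(3)[symmetric]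
    using act_inv[OF hi(1) v] hi hj act_inv'[OF hj(1) axis_V] by simp_all
  have along: "\<phi> \<gamma> (axis (i + m)) = axis (j + m) \<and> \<phi> \<gamma> (axis (Suc (i + m))) = axis (Suc (j + m))" for m
  proof (induction m)
    case 0
    then show ?case using start by simp
  next
    case (Suc m)
    let ?w = "\<lambda>l. \<phi> \<gamma> (axis (Suc (Suc (i + m)) + l))"
    have wV: "?w l \<in> V" for l using act_V \<gamma> axis_V by blast
    have "?w 0 = axis (Suc (Suc (j + m)))"
    proof (rule ccontr)
      assume neq: "?w 0 \<noteq> axis (Suc (Suc (j + m)))"
      have edge: "(\<phi> \<gamma> (axis k), \<phi> \<gamma> (axis (Suc k))) \<in> E" for k using axis_edge axis_V \<gamma> act_E by blast
      have "(axis (Suc (j + m)), ?w 0) \<in> E" using edge[of "Suc (i + m)"] Suc by simp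
      from edge_par[OF this] neq have w0: "par (?w 0) = axis (Suc (j + m))" by (auto simp: axis_Suc)
      have step: "par (?w (Suc l)) = ?w l" for l
      proof (induction l)
        case 0
        have "?w 1 \<noteq> axis (Suc (j + m))"
          using act_inj[OF \<gamma> axis_V axis_V, of "Suc (Suc (i + m)) + 1" "Suc (i + m)"] Suc axis_inj by auto
        then show ?case using edge_par[OF edge[of "Suc (Suc (i + m))"]] w0 by auto
      next
        case (Suc l)
        have "?w (Suc (Suc l)) \<noteq> ?w l"
          using act_inj[OF \<gamma> axis_V axis_V] axis_inj by auto
        then show ?case using edge_par[OF edge[of "Suc (Suc (i + m)) + Suc l"]] Suc by auto
      qed
      \<comment> \<open>Having left the axis, the image of the ray descends forever and reaches the level of \<open>x0\<close>.\<close>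
      have desc: "(par ^^ l) (?w l) = ?w 0" for l
      proof (induction l)
        case (Suc l)
        have "(par ^^ Suc l) (?w (Suc l)) = (par ^^ l) (par (?w (Suc l)))" by (simp add: funpow_swap1)
        then show ?case using Suc step by simp
      qed simp
      have "(par ^^ Suc (j + m)) (?w (j + m)) = axis (Suc (j + m))" using desc w0 by simp
      then have "(par ^^ (j + m)) (?w (j + m)) = axis (j + m)" using star[of "j + m"] wV j by auto
      then have "?w 0 = \<phi> \<gamma> (axis (i + m))" using desc Suc by simp
      then show False using act_inj[OF \<gamma> axis_V axis_V] axis_inj by auto
    qed
    then show ?case using Suc by simp
  qed
  have "\<phi> \<gamma> \<in> P_stab Y c"
    using along start par_axis by (intro P_stabI[OF \<gamma> axis_V, of i]) (simp add: add.commute)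
  then have "\<phi> \<gamma> \<in> N_stab Y c" using cusp \<gamma> by (auto simp: is_cusp_def)
  then obtain n where "(par ^^ n) (axis j) = (par ^^ n) (axis i)"
    using N_stab_level[OF \<gamma> _ axis_V, of i] start by auto
  then show False using par_axis axis_inj j by auto
qed

text \<open>
  Without leaves, every child has descendants at the level of \<open>x0\<close>, and transitivity there carries over to
  the children.
\<close>

lemma children_same_orbit:
  assumes noleaf: "\<And>x. x \<in> V \<Longrightarrow> \<exists>z\<in>V. par z = x"
    and z: "z \<in> V" "par z = axis (Suc k)"
  shows "\<exists>g\<in>G. \<phi> g (axis (Suc k)) = axis (Suc k) \<and> \<phi> g (axis k) = z"
proof -
  have "\<exists>y\<in>V. (par ^^ n) y = z" for n
  proof (induction n)
    case (Suc n)
    then obtain y where "y \<in> V" "(par ^^ n) y = z" by blast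
    moreover obtain y' where "y' \<in> V" "par y' = y" using noleaf calculation(1) by blast
    ultimately show ?case by (intro bexI[of _ y']) (auto simp: funpow_swap1)
  qed (use z in auto)
  then obtain y where y: "y \<in> V" "(par ^^ k) y = z" by blast
  then have "(par ^^ Suc k) y = axis (Suc k)" using z by simp
  from axis_descendant[OF y(1) this] obtain g where "g \<in> G" "\<forall>j. \<phi> g (axis j) = (par ^^ j) y" by blast
  then show ?thesis using y z by (intro bexI[of _ g]) auto
qed

text \<open>
  Call \<open>k\<close> bad if the stabilizer of \<open>axis k\<close> moves the next vertex. It then acts transitively on all neighbours
  of \<open>axis k\<close>, because it is already transitive on the children. If there were two bad indices, the orbits
  of the axis vertices between them would be closed under adjacency, hence would exhaust the tree,
  and one of these finitely many orbits would contain infinitely many axis vertices.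
\<close>

lemma eventually_fixed:
  assumes noleaf: "\<And>x. x \<in> V \<Longrightarrow> \<exists>z\<in>V. par z = x"
  shows "\<exists>J. \<forall>k\<ge>J. \<forall>g\<in>G. \<phi> g (axis k) = axis k \<longrightarrow> \<phi> g (axis (Suc k)) = axis (Suc k)"
proof -
  define bad where "bad k \<longleftrightarrow> (\<exists>g\<in>G. \<phi> g (axis k) = axis k \<and> \<phi> g (axis (Suc k)) \<noteq> axis (Suc k))" for k
  have False if ij: "bad (Suc i)" "bad j" "Suc i < j" for i j
  proof -
    let ?S = "\<lambda>y. y \<in> V \<and> (\<exists>k\<in>{Suc i..j}. same_orbit (axis k) y)"
    have nb: "?S z" if k: "Suc i \<le> k" "k \<le> j" "(axis k, z) \<in> E" for k z
    proof -
      obtain k' where k': "k = Suc k'" using k by (cases k) auto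
      have zV: "z \<in> V" using k E_V by blast
      have child: "same_orbit (axis k') z" if "par z = axis k" for z
        using children_same_orbit[OF noleaf _ that[unfolded k']] that axis_V
        by (metis same_orbit_def par_def k')
      show ?thesis
      proof (cases "par z = axis k")
        case True
        show ?thesis
        proof (cases "Suc i \<le> k'")
          case True
          then show ?thesis using child[OF \<open>par z = axis k\<close>] k k' zV by (intro conjI bexI[of _ k']) auto
        next
          case False
          then have k_eq: "k = Suc i" using k k' by simp
          obtain g where g: "g \<in> G" "\<phi> g (axis k) = axis k" "\<phi> g (axis (Suc k)) \<noteq> axis (Suc k)"
            using ij(1) by (auto simp: bad_def k_eq)
          have "(axis k, \<phi> g (axis (Suc k))) \<in> E" using axis_edge[of k] g act_E[OF g(1) axis_V axis_V, of k "Suc k"] by simp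
          from edge_par[OF this] have "par (\<phi> g (axis (Suc k))) = axis k" using g by (auto simp: axis_Suc)
          then have "same_orbit (axis k') (\<phi> g (axis (Suc k)))" by (rule child)
          then have "same_orbit (axis (Suc k)) (axis k')"
            using same_orbit_act[OF g(1), of "axis (Suc k)"] same_orbit_sym[OF axis_V] same_orbit_trans[OF axis_V] by blast
          then have "same_orbit (axis (Suc k)) z" using child[OF True] same_orbit_trans[OF axis_V] by blast
          then show ?thesis using zV k_eq ij by (intro conjI bexI[of _ "Suc k"]) auto
        qed
      next
        case False
        then have z: "z = axis (Suc k)" using edge_par[OF k(3)] by (auto simp: axis_Suc)
        show ?thesis
        proof (cases "k < j")
          case True
          then show ?thesis using z k same_orbit_refl[OF axis_V] zV by (intro conjI bexI[of _ "Suc k"]) auto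
        next
          case False
          then have k_eq: "k = j" using k by simp
          obtain g where g: "g \<in> G" "\<phi> g (axis k) = axis k" "\<phi> g (axis (Suc k)) \<noteq> axis (Suc k)"
            using ij(2) by (auto simp: bad_def k_eq)
          have "(axis k, \<phi> g (axis (Suc k))) \<in> E" using axis_edge[of k] g act_E[OF g(1) axis_V axis_V, of k "Suc k"] by simp
          from edge_par[OF this] have "par (\<phi> g (axis (Suc k))) = axis k" using g by (auto simp: axis_Suc)
          then have "same_orbit (axis k') (\<phi> g (axis (Suc k)))" by (rule child)
          then have "same_orbit (axis k') (axis (Suc k))"
            using same_orbit_act[OF g(1), of "axis (Suc k)"] same_orbit_sym[OF axis_V] same_orbit_trans[OF axis_V] by blast
          then show ?thesis using zV z k_eq k' ij by (intro conjI bexI[of _ k']) auto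
        qed
      qed
    qed
    have all: "?S (axis l)" for l
    proof (rule connected_induct[of "axis j" "axis l" ?S])
      show "?S (axis j)" using axis_V same_orbit_refl[OF axis_V] ij by (intro conjI bexI[of _ j]) auto
      fix y z assume y: "?S y" "(y, z) \<in> E"
      then obtain k where k: "Suc i \<le> k" "k \<le> j" "same_orbit (axis k) y" by auto
      then obtain g where g: "g \<in> G" "\<phi> g (axis k) = y" by (auto simp: same_orbit_def)
      have zV: "z \<in> V" using y E_V by blast
      define z' where "z' = \<phi> (ginv g) z"
      have "\<phi> (ginv g) y = axis k" using act_inv[OF g(1) axis_V] g by auto
      then have "(axis k, z') \<in> E" using y act_E[OF inv_G[OF g(1)], of y z] zV by (simp add: z'_def)
      from nb[OF k(1,2) this] obtain k' where k': "k' \<in> {Suc i..j}" "same_orbit (axis k') z'" by blast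
      have "\<phi> g z' = z" using act_inv'[OF g(1) zV] by (simp add: z'_def)
      then have "same_orbit z' z" using g by (auto simp: same_orbit_def)
      then have "same_orbit (axis k') z" using k' same_orbit_trans[OF axis_V] by blast
      then show "?S z" using zV k' by blast
    qed (rule axis_V)+
    have "(UNIV :: nat set) \<subseteq> (\<Union>k\<in>{Suc i..j}. {l. same_orbit (axis k) (axis l)})" using all by blast
    moreover have "finite (\<Union>k\<in>{Suc i..j}. {l. same_orbit (axis k) (axis l)})" using axis_proper[OF axis_V] by blast
    ultimately show False using finite_subset infinite_UNIV_nat by blast
  qed
  then have *: "\<not> (bad i \<and> bad j)" if "0 < i" "i < j" for i j
    using that by (cases i) auto
  have "\<exists>J. \<forall>k\<ge>J. \<not> bad k"
  proof (cases "\<exists>i>0. bad i")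
    case True
    then obtain i where "i > 0" "bad i" by blast
    then show ?thesis using * by (intro exI[of _ "Suc i"]) auto
  next
    case False
    show ?thesis
    proof (intro exI[of _ 1] allI impI)
      fix k :: nat assume "1 \<le> k"
      then have "0 < k" by simp
      then show "\<not> bad k" using False by blast
    qed
  qed
  then show ?thesis by (auto simp: bad_def)
qed

end

context tree_action
begin

text \<open>
  The local form of a cusp section: each vertex stabilizer fixes the next vertex of the ray and,
  from the second vertex on, is transitive on the remaining neighbours, and the ray leaves every orbit. Unlike the definition of a
  cusp, this refers to one ray only and is inherited by its tails.
\<close>

definition cuspidal_ray :: "(nat \<Rightarrow> 'v) \<Rightarrow> bool" where
  "cuspidal_ray x \<longleftrightarrow> (\<forall>k. (x k, x (Suc k)) \<in> E) \<and> (\<forall>k. x (Suc (Suc k)) \<noteq> x k) \<and>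
     (\<forall>k. \<forall>g\<in>G. \<phi> g (x k) = x k \<longrightarrow> \<phi> g (x (Suc k)) = x (Suc k)) \<and>
     (\<forall>k z. (x (Suc k), z) \<in> E \<longrightarrow> z \<noteq> x (Suc (Suc k)) \<longrightarrow>
        (\<exists>g\<in>G. \<phi> g (x (Suc k)) = x (Suc k) \<and> \<phi> g (x k) = z)) \<and>
     (\<forall>v\<in>V. finite {k. same_orbit v (x k)})"

lemma cuspidal_ray_shift:
  assumes "cuspidal_ray x"
  shows "cuspidal_ray (\<lambda>n. x (a + n))"
proof -
  have "finite {k. same_orbit v (x (a + k))}" if "v \<in> V" for v
  proof -
    have "finite {k. same_orbit v (x k)}" using assms that by (auto simp: cuspidal_ray_def)
    then have "finite ((\<lambda>k. a + k) -` {k. same_orbit v (x k)})" by (rule finite_vimageI) (auto simp: inj_on_def)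
    then show ?thesis by (simp add: vimage_def)
  qed
  then show ?thesis using assms by (auto simp: cuspidal_ray_def)
qed

end

context cusp_action
begin

text \<open>
  Every ray of the class eventually follows the axis, where the local properties have been
  established.
\<close>

lemma cuspidal_ray_tail:
  assumes noleaf: "\<And>x y. (x, y) \<in> E \<Longrightarrow> \<exists>z. z \<noteq> y \<and> (x, z) \<in> E" and r: "r \<in> c"
  shows "\<exists>a. cuspidal_ray (\<lambda>n. fst (r (a + n)))"
proof -
  have child: "\<exists>z\<in>V. par z = x" if "x \<in> V" for x
    using noleaf[OF par_edge[OF that]] edge_par E_V by metis
  obtain J where J: "\<And>k g. k \<ge> J \<Longrightarrow> g \<in> G \<Longrightarrow> \<phi> g (axis k) = axis k \<Longrightarrow> \<phi> g (axis (Suc k)) = axis (Suc k)"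
    using eventually_fixed[OF child] by blast
  have "cuspidal_ray (\<lambda>n. axis (J + n))"
    unfolding cuspidal_ray_def
  proof (intro conjI allI ballI impI)
    show "(axis (J + k), axis (J + Suc k)) \<in> E" for k using axis_edge[of "J + k"] by simp
    show "axis (J + Suc (Suc k)) \<noteq> axis (J + k)" for k by (simp add: axis_inj del: add_Suc_right)
    show "\<phi> g (axis (J + Suc k)) = axis (J + Suc k)" if "g \<in> G" "\<phi> g (axis (J + k)) = axis (J + k)" for k g
      using J[of "J + k" g] that by simp
    show "\<exists>g\<in>G. \<phi> g (axis (J + Suc k)) = axis (J + Suc k) \<and> \<phi> g (axis (J + k)) = z"
      if "(axis (J + Suc k), z) \<in> E" "z \<noteq> axis (J + Suc (Suc k))" for k z
    proof -
      have "par z = axis (Suc (J + k))" using edge_par[OF that(1)] that(2) by (auto simp: axis_Suc)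
      from children_same_orbit[OF child _ this] show ?thesis using that E_V by auto
    qed
    show "finite {k. same_orbit v (axis (J + k))}" if "v \<in> V" for v
    proof -
      have "finite ((\<lambda>k. J + k) -` {k. same_orbit v (axis k)})" using axis_proper[OF that] by (rule finite_vimageI) (auto simp: inj_on_def)
      then show ?thesis by (simp add: vimage_def)
    qed
  qed
  moreover obtain a b where ab: "(par ^^ a) (fst (r 0)) = axis b"
  proof -
    have "fst (r 0) \<in> V" using ray_edge[OF mem_c_rays[OF r], of 0] E_V by blast
    then show ?thesis using par_merge[OF _ x0(1)] that by (auto simp: axis_def)
  qed
  have "fst (r (a + n)) = axis (b + n)" for n
  proof -
    have "fst (r (a + n)) = (par ^^ n) ((par ^^ a) (fst (r 0)))"
      unfolding ray_par[OF r, of "a + n"] funpow_funpow by (simp only: add.commute)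
    then show ?thesis using par_axis[of n b] by (simp only: ab add.commute)
  qed
  then have "(\<lambda>n. fst (r (a + J + n))) = (\<lambda>n. axis (J + (b + n)))"
  proof (intro ext)
    fix n
    assume *: "\<And>n. fst (r (a + n)) = axis (b + n)"
    show "fst (r (a + J + n)) = axis (J + (b + n))" using *[of "J + n"] by (simp add: add_ac)
  qed
  ultimately show ?thesis using cuspidal_ray_shift[of "\<lambda>n. axis (J + n)" b] by metis
qed

end

lemma finite_image_representatives:
  assumes "finite (f ` A)"
  obtains S where "S \<subseteq> A" "finite S" "f ` A = f ` S"
  using finite_subset_image[OF assms order_refl] by auto

context tree_action
begin

section \<open>The quotient graph\<close>

definition Arc :: "'v \<Rightarrow> 'v \<Rightarrow> ('v \<times> 'v) set" where
  "Arc x y = Group_Action.orbit \<Gamma> (edge_act \<phi>) (x, y)"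

abbreviation vert :: "'v \<Rightarrow> 'v set" where
  "vert x \<equiv> Group_Action.orbit \<Gamma> \<phi> x"

abbreviation Q where "Q \<equiv> quotient_graph \<Gamma> \<phi> Y"

lemma Arc_eq_set: "Arc x y = {(\<phi> g x, \<phi> g y) |g. g \<in> G}"
  by (auto simp: Arc_def Group_Action.orbit_def edge_act_def)

lemma vert_eq_set: "vert x = {\<phi> g x |g. g \<in> G}"
  by (auto simp: Group_Action.orbit_def)

lemma vert_eq_iff:
  assumes "x \<in> V" "y \<in> V"
  shows "vert x = vert y \<longleftrightarrow> same_orbit x y"
proof
  assume "vert x = vert y"
  moreover have "y \<in> vert y" using act.orbit_refl assms by blast
  ultimately have "y \<in> vert x" by simp
  then show "same_orbit x y" by (auto simp: same_orbit_def vert_eq_set)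
next
  assume "same_orbit x y"
  then obtain g where g: "g \<in> G" "y = \<phi> g x" by (auto simp: same_orbit_def)
  have 1: "\<phi> h y = \<phi> (h \<cdot> g) x" if "h \<in> G" for h using that g assms by (simp add: act_mult)
  have 2: "\<phi> h x = \<phi> (h \<cdot> ginv g) y" if "h \<in> G" for h
    using that g assms by (simp add: act_mult inv_G act_inv)
  show "vert x = vert y"
  proof (intro equalityI subsetI)
    fix z assume "z \<in> vert x"
    then obtain h where "h \<in> G" "z = \<phi> h x" by (auto simp: vert_eq_set)
    then show "z \<in> vert y" unfolding vert_eq_set using 2 mult_G[OF _ inv_G[OF g(1)]] by blast
  next
    fix z assume "z \<in> vert y"
    then obtain h where "h \<in> G" "z = \<phi> h y" by (auto simp: vert_eq_set)
    then show "z \<in> vert x" unfolding vert_eq_set using 1 mult_G[OF _ g(1)] by blast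
  qed
qed

lemma Arc_self: "(x, y) \<in> E \<Longrightarrow> (x, y) \<in> Arc x y"
  unfolding Arc_eq_set using one_G act_one E_V by force

lemma Arc_act:
  assumes "g \<in> G" "(x, y) \<in> E"
  shows "Arc (\<phi> g x) (\<phi> g y) = Arc x y"
proof -
  have V: "x \<in> V" "y \<in> V" using assms E_V by auto
  have 1: "\<phi> h (\<phi> g x) = \<phi> (h \<cdot> g) x \<and> \<phi> h (\<phi> g y) = \<phi> (h \<cdot> g) y" if "h \<in> G" for h
    using that assms V by (simp add: act_mult)
  have 2: "\<phi> h x = \<phi> (h \<cdot> ginv g) (\<phi> g x) \<and> \<phi> h y = \<phi> (h \<cdot> ginv g) (\<phi> g y)" if "h \<in> G" for h
    using that assms V by (simp add: act_mult inv_G act_inv act_V)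
  show ?thesis
  proof (intro equalityI subsetI)
    fix e assume "e \<in> Arc (\<phi> g x) (\<phi> g y)"
    then obtain h where "h \<in> G" "e = (\<phi> h (\<phi> g x), \<phi> h (\<phi> g y))" by (auto simp: Arc_eq_set)
    then show "e \<in> Arc x y" unfolding Arc_eq_set using 1 mult_G[OF _ assms(1)] by blast
  next
    fix e assume "e \<in> Arc x y"
    then obtain h where "h \<in> G" "e = (\<phi> h x, \<phi> h y)" by (auto simp: Arc_eq_set)
    then show "e \<in> Arc (\<phi> g x) (\<phi> g y)" unfolding Arc_eq_set using 2 mult_G[OF _ inv_G[OF assms(1)]] by blast
  qed
qed

lemma arcs_Q: "arcs Q = {Arc x y |x y. (x, y) \<in> E}"
  by (auto simp: quotient_graph_def Group_Action.orbits_def Arc_def)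

lemma Arc_in_arcs: "(x, y) \<in> E \<Longrightarrow> Arc x y \<in> arcs Q"
  unfolding arcs_Q by blast

lemma verts_Q: "verts Q = vert ` V"
  by (auto simp: quotient_graph_def Group_Action.orbits_def)

lemma tail_Arc: "tail Q (Arc x y) = vert x" and head_Arc: "head Q (Arc x y) = vert y"
proof -
  have "fst ` Arc x y = vert x" "snd ` Arc x y = vert y"
    by (force simp: Arc_eq_set vert_eq_set image_iff)+
  then show "tail Q (Arc x y) = vert x" "head Q (Arc x y) = vert y"
    by (simp_all add: quotient_graph_def)
qed

lemma edge_rev_Arc: "edge_rev (Arc x y) = Arc y x"
  by (force simp: edge_rev_def Arc_eq_set image_iff)

definition nbr_orbit :: "'v \<Rightarrow> 'v \<Rightarrow> 'v set" where
  "nbr_orbit x y = {\<phi> g y |g. g \<in> G \<and> \<phi> g x = x}"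

lemma nbr_orbit_sub: "(x, y) \<in> E \<Longrightarrow> nbr_orbit x y \<subseteq> nbrs x"
  using act_E E_V by (auto simp: nbr_orbit_def nbrs_def) metis

lemma nbr_orbit_act:
  assumes h: "h \<in> G" and xy: "x \<in> V" "y \<in> V"
  shows "nbr_orbit (\<phi> h x) (\<phi> h y) = \<phi> h ` nbr_orbit x y"
proof (intro equalityI subsetI)
  fix z assume "z \<in> nbr_orbit (\<phi> h x) (\<phi> h y)"
  then obtain g where g: "g \<in> G" "\<phi> g (\<phi> h x) = \<phi> h x" "z = \<phi> g (\<phi> h y)" by (auto simp: nbr_orbit_def)
  let ?k = "ginv h \<cdot> (g \<cdot> h)"
  have k: "?k \<in> G" "\<phi> ?k w = \<phi> (ginv h) (\<phi> g (\<phi> h w))" if "w \<in> V" for w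
    using that g h by (simp_all add: act_mult inv_G mult_G)
  have "\<phi> ?k x = x" using k(2)[OF xy(1)] g h xy by (simp add: act_inv)
  then have "\<phi> ?k y \<in> nbr_orbit x y" using k(1)[OF xy(1)] by (auto simp: nbr_orbit_def)
  moreover have "\<phi> h (\<phi> ?k y) = z" using k(2)[OF xy(2)] g h xy by (simp add: act_inv' act_V)
  ultimately show "z \<in> \<phi> h ` nbr_orbit x y" by (intro image_eqI[where x = "\<phi> ?k y"]) (auto dest: sym)
next
  fix z assume "z \<in> \<phi> h ` nbr_orbit x y"
  then obtain g where g: "g \<in> G" "\<phi> g x = x" "z = \<phi> h (\<phi> g y)" by (auto simp: nbr_orbit_def)
  let ?k = "h \<cdot> (g \<cdot> ginv h)"
  have k: "?k \<in> G" "\<phi> ?k (\<phi> h w) = \<phi> h (\<phi> g w)" if "w \<in> V" for w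
    using that g h by (simp_all add: act_mult inv_G mult_G act_V act_inv)
  have "\<phi> ?k (\<phi> h x) = \<phi> h x" "z = \<phi> ?k (\<phi> h y)" using k(2)[OF xy(1)] k(2)[OF xy(2)] g by simp_all
  then show "z \<in> nbr_orbit (\<phi> h x) (\<phi> h y)" using k(1)[OF xy(1)] unfolding nbr_orbit_def by blast
qed

text \<open>
  The weight is independent of the representative edge that its definition chooses.
\<close>

lemma edge_weight_Arc:
  assumes xy: "(x, y) \<in> E"
  shows "edge_weight \<Gamma> \<phi> (Arc x y) = card (nbr_orbit x y)"
proof -
  have V: "x \<in> V" "y \<in> V" using xy E_V by auto
  have "(SOME e'. e' \<in> Arc x y) \<in> Arc x y" using Arc_self[OF xy] by (rule someI)
  then obtain h where h: "h \<in> G" "(SOME e'. e' \<in> Arc x y) = (\<phi> h x, \<phi> h y)" by (auto simp: Arc_eq_set)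
  have "(\<lambda>g. edge_act \<phi> g (\<phi> h x, \<phi> h y)) ` stabilizer \<Gamma> \<phi> (\<phi> h x) = Pair (\<phi> h x) ` nbr_orbit (\<phi> h x) (\<phi> h y)"
    by (force simp: stabilizer_def edge_act_def nbr_orbit_def image_iff)
  then have "edge_weight \<Gamma> \<phi> (Arc x y) = card (Pair (\<phi> h x) ` nbr_orbit (\<phi> h x) (\<phi> h y))"
    using h by (simp add: edge_weight_def)
  also have "\<dots> = card (\<phi> h ` nbr_orbit x y)"
    unfolding nbr_orbit_act[OF h(1) V] by (rule card_image) (auto simp: inj_on_def)
  also have "\<dots> = card (nbr_orbit x y)"
  proof (rule card_image)
    have "nbr_orbit x y \<subseteq> V" using nbr_orbit_sub[OF xy] E_V by (auto simp: nbrs_def)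
    then show "inj_on (\<phi> h) (nbr_orbit x y)" using act_inj[OF h(1)] by (auto simp: inj_on_def)
  qed
  finally show ?thesis .
qed

lemma edge_weight_bounds:
  assumes "(x, y) \<in> E"
  shows "1 \<le> edge_weight \<Gamma> \<phi> (Arc x y)" "edge_weight \<Gamma> \<phi> (Arc x y) \<le> card (nbrs x)"
proof -
  have "y \<in> nbr_orbit x y" unfolding nbr_orbit_def using one_G act_one E_V[OF assms] by force
  moreover have "finite (nbr_orbit x y)" using finite_subset[OF nbr_orbit_sub[OF assms] finite_nbrs] .
  ultimately have "card (nbr_orbit x y) > 0" using card_gt_0_iff by blast
  then show "1 \<le> edge_weight \<Gamma> \<phi> (Arc x y)" "edge_weight \<Gamma> \<phi> (Arc x y) \<le> card (nbrs x)"
    using edge_weight_Arc[OF assms] card_mono[OF finite_nbrs nbr_orbit_sub[OF assms]] by auto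
qed

lemma arc_from:
  assumes j: "j \<in> arcs Q" "tail Q j = vert x" and x: "x \<in> V"
  shows "\<exists>z. (x, z) \<in> E \<and> j = Arc x z"
proof -
  obtain a b where ab: "j = Arc a b" "(a, b) \<in> E" using j(1) by (auto simp: arcs_Q)
  then have aV: "a \<in> V" "b \<in> V" using E_V by auto
  have "same_orbit a x" using j(2) vert_eq_iff[OF aV(1) x] by (simp add: ab tail_Arc)
  then obtain g where g: "g \<in> G" "\<phi> g a = x" by (auto simp: same_orbit_def)
  then have "(x, \<phi> g b) \<in> E" using ab act_E[OF g(1) aV] by simp
  moreover have "Arc x (\<phi> g b) = j" using Arc_act[OF g(1) ab(2)] g ab by simp
  ultimately show ?thesis by blast
qed

lemma arc_into:
  assumes i: "i \<in> arcs Q" "head Q i = vert x" and x: "x \<in> V"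
  shows "\<exists>z. (x, z) \<in> E \<and> i = Arc z x"
proof -
  obtain a b where ab: "i = Arc a b" "(a, b) \<in> E" using i(1) by (auto simp: arcs_Q)
  have "Arc b a \<in> arcs Q" "tail Q (Arc b a) = vert x"
    using ab(1) i(2) Arc_in_arcs[OF E_sym[OF ab(2)]] by (simp_all add: tail_Arc head_Arc)
  from arc_from[OF this x] obtain z where "(x, z) \<in> E" "Arc b a = Arc x z" by blast
  then show ?thesis using ab edge_rev_Arc by metis
qed

section \<open>Consequences of uniformity\<close>

lemma id_automorphism: "(\<lambda>x\<in>V. x) \<in> automorphisms Y"
  by (auto simp: automorphisms_def id_Bij)

lemma aut_V: "f \<in> automorphisms Y \<Longrightarrow> x \<in> V \<Longrightarrow> f x \<in> V"
  by (auto simp: automorphisms_def Bij_def bij_betw_def)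

lemma aut_E: "f \<in> automorphisms Y \<Longrightarrow> x \<in> V \<Longrightarrow> y \<in> V \<Longrightarrow> (f x, f y) \<in> E \<longleftrightarrow> (x, y) \<in> E"
  by (auto simp: automorphisms_def)

lemma nbrs_aut:
  assumes f: "f \<in> automorphisms Y" and x: "x \<in> V"
  shows "nbrs (f x) = f ` nbrs x"
proof (intro equalityI subsetI)
  fix z assume z: "z \<in> nbrs (f x)"
  then have "z \<in> V" using E_V by (auto simp: nbrs_def)
  moreover have "f ` V = V" using f by (simp add: automorphisms_def Bij_def bij_betw_def)
  ultimately obtain w where "w \<in> V" "z = f w" by blast
  then show "z \<in> f ` nbrs x" using z aut_E[OF f x] by (auto simp: nbrs_def)
next
  fix z assume "z \<in> f ` nbrs x"
  then show "z \<in> nbrs (f x)" using aut_E[OF f x] E_V by (auto simp: nbrs_def)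
qed

lemma card_nbrs_aut:
  assumes "f \<in> automorphisms Y" "x \<in> V"
  shows "card (nbrs (f x)) = card (nbrs x)"
  unfolding nbrs_aut[OF assms]
proof (rule card_image)
  have "inj_on f V" using assms by (auto simp: automorphisms_def Bij_def bij_betw_def)
  moreover have "nbrs x \<subseteq> V" using E_V by (auto simp: nbrs_def)
  ultimately show "inj_on f (nbrs x)" using inj_on_subset by blast
qed

lemma finite_representatives:
  assumes "uniform Y"
  shows "\<exists>S. finite S \<and> S \<subseteq> V \<and> (\<forall>x\<in>V. \<exists>s\<in>S. \<exists>f\<in>automorphisms Y. x = f s)"
proof -
  let ?orb = "\<lambda>x. {f x |f. f \<in> automorphisms Y}"
  have "verts (quotient_graph (aut_group Y) (\<lambda>f. f) Y) = ?orb ` V"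
    by (auto simp: quotient_graph_def Group_Action.orbits_def Group_Action.orbit_def aut_group_def)
  then have "finite (?orb ` V)" using assms by (simp add: uniform_def)
  then obtain S where S: "S \<subseteq> V" "finite S" "?orb ` V = ?orb ` S"
    by (rule finite_image_representatives)
  have "\<exists>s\<in>S. \<exists>f\<in>automorphisms Y. x = f s" if x: "x \<in> V" for x
  proof -
    have "x \<in> ?orb x" using id_automorphism x by (intro CollectI exI[of _ "\<lambda>x\<in>V. x"]) auto
    moreover have "?orb x \<in> ?orb ` S" using S(3) x by blast
    ultimately show ?thesis by auto
  qed
  then show ?thesis using S by blast
qed

lemma bounded_valency:
  assumes "uniform Y"
  shows "\<exists>\<Delta>. \<forall>x. card (nbrs x) \<le> \<Delta>"
proof -
  obtain S where S: "finite S" "S \<subseteq> V" "\<And>x. x \<in> V \<Longrightarrow> \<exists>s\<in>S. \<exists>f\<in>automorphisms Y. x = f s"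
    using finite_representatives[OF assms] by blast
  have "card (nbrs x) \<le> Max (insert 0 ((\<lambda>s. card (nbrs s)) ` S))" for x
  proof (cases "x \<in> V")
    case True
    then obtain s f where "s \<in> S" "f \<in> automorphisms Y" "x = f s" using S(3) by blast
    then have "card (nbrs x) = card (nbrs s)" using card_nbrs_aut S(2) by blast
    then show ?thesis using \<open>s \<in> S\<close> S(1) by (intro Max_ge) auto
  next
    case False
    then have "nbrs x = {}" using E_V(1) unfolding nbrs_def by blast
    then show ?thesis by simp
  qed
  then show ?thesis by blast
qed

definition leaf :: "'v \<Rightarrow> bool" where
  "leaf x \<longleftrightarrow> x \<in> V \<and> (\<exists>y. nbrs x \<subseteq> {y})"

lemma leaf_aut:
  assumes "leaf x" "f \<in> automorphisms Y"
  shows "leaf (f x)"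
proof -
  obtain y where "x \<in> V" "nbrs x \<subseteq> {y}" using assms by (auto simp: leaf_def)
  then have "nbrs (f x) \<subseteq> {f y}" using nbrs_aut[OF assms(2)] by auto
  then show ?thesis using \<open>x \<in> V\<close> aut_V assms(2) by (auto simp: leaf_def)
qed

text \<open>
  The distance to a given leaf is finite for the finitely many representatives of the vertices
  modulo automorphisms, and automorphisms move leaves to leaves.
\<close>

lemma bounded_distance_to_leaf:
  assumes "uniform Y" and z0: "leaf z0"
  shows "\<exists>D. \<forall>x\<in>V. \<exists>n\<le>D. \<exists>z. leaf z \<and> (z, x) \<in> E ^^ n"
proof -
  obtain S where S: "finite S" "S \<subseteq> V" "\<And>x. x \<in> V \<Longrightarrow> \<exists>s\<in>S. \<exists>f\<in>automorphisms Y. x = f s"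
    using finite_representatives[OF assms(1)] by blast
  have "\<exists>n. (z0, s) \<in> E ^^ n" if "s \<in> V" for s
    using z0[unfolded leaf_def, THEN conjunct1] that
  proof (induction rule: connected_induct)
    case base
    show ?case by (rule exI[of _ 0]) simp
  next
    case (step y z)
    then show ?case by (meson relpow_Suc_I)
  qed
  then obtain d where d: "\<And>s. s \<in> V \<Longrightarrow> (z0, s) \<in> E ^^ d s" by metis
  have aut_path: "(f a, f b) \<in> E ^^ n" if "f \<in> automorphisms Y" "(a, b) \<in> E ^^ n" "a \<in> V" for f a b n
    using that(2)
  proof (induction n arbitrary: b)
    case (Suc n)
    then obtain b' where b': "(a, b') \<in> E ^^ n" "(b', b) \<in> E" by auto
    then have "(f b', f b) \<in> E" using aut_E[OF that(1)] E_V by blast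
    then show ?case using Suc.IH[OF b'(1)] by auto
  qed auto
  have "\<exists>n\<le>Max (insert 0 (d ` S)). \<exists>z. leaf z \<and> (z, x) \<in> E ^^ n" if x: "x \<in> V" for x
  proof -
    obtain s f where s: "s \<in> S" "f \<in> automorphisms Y" "x = f s" using S(3) x by blast
    have "d s \<le> Max (insert 0 (d ` S))" using s S(1) by (intro Max_ge) auto
    moreover have "(f z0, x) \<in> E ^^ d s"
      using aut_path[OF s(2) d[of s]] s S(2) z0 by (auto simp: leaf_def)
    ultimately show ?thesis using leaf_aut[OF z0 s(2)] by blast
  qed
  then show ?thesis by blast
qed

text \<open>
  By local finiteness, finitely many orbits have finitely many orbits of neighbours.
\<close>

lemma finite_orbits_near:
  assumes "finite (vert ` L)" "L \<subseteq> V"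
  shows "finite (vert ` {x. \<exists>z\<in>L. (z, x) \<in> E ^^ n})"
proof (induction n)
  case 0
  have "{x. \<exists>z\<in>L. (z, x) \<in> E ^^ 0} = L" by auto
  then show ?case using assms by simp
next
  case (Suc n)
  let ?B = "{x. \<exists>z\<in>L. (z, x) \<in> E ^^ n}"
  obtain S where S: "S \<subseteq> ?B" "finite S" "vert ` ?B = vert ` S"
    using Suc by (rule finite_image_representatives)
  have BV: "?B \<subseteq> V"
  proof
    fix x assume "x \<in> ?B"
    then obtain z where "z \<in> L" "(z, x) \<in> E ^^ n" by blast
    then show "x \<in> V" using assms(2) E_V by (cases n) auto
  qed
  have "vert ` {x. \<exists>z\<in>L. (z, x) \<in> E ^^ Suc n} \<subseteq> (\<Union>s\<in>S. vert ` nbrs s)"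
  proof
    fix v assume "v \<in> vert ` {x. \<exists>z\<in>L. (z, x) \<in> E ^^ Suc n}"
    then obtain x b where x: "v = vert x" "b \<in> ?B" "(b, x) \<in> E" by auto
    then have "vert b \<in> vert ` S" using S(3) by blast
    then obtain s where s: "s \<in> S" "vert b = vert s" by auto
    then have V: "b \<in> V" "s \<in> V" "x \<in> V" using BV S(1) x E_V by auto
    then obtain g where g: "g \<in> G" "\<phi> g b = s" using s vert_eq_iff by (auto simp: same_orbit_def)
    then have "\<phi> g x \<in> nbrs s" using x act_E V by (auto simp: nbrs_def)
    moreover have "vert x = vert (\<phi> g x)" using vert_eq_iff V act_V g same_orbit_act by blast
    ultimately show "v \<in> (\<Union>s\<in>S. vert ` nbrs s)" using s x by auto
  qed
  then show ?case by (rule finite_subset) (intro finite_UN_I finite_imageI finite_nbrs S(2))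
qed

text \<open>
  A leaf can occur on a cusp ray only as its first vertex, so there are finitely many orbits of
  leaves. If there were a leaf, all vertices would lie within a bounded distance of leaves, hence in finitely
  many orbits, whereas the vertices of a cusp ray lie in infinitely many.
\<close>

lemma no_leaf:
  assumes "uniform Y" and c: "is_cusp \<Gamma> \<phi> Y c"
    and R: "finite R" "R \<subseteq> rays Y" and fin: "finite H" "verts Q = H \<union> (\<Union>r\<in>R. \<Union>j. {vert (fst (r j))})"
  shows "\<not> leaf z0"
proof
  assume z0: "leaf z0"
  interpret C: cusp_action \<Gamma> \<phi> Y c
    by unfold_locales (use c in \<open>auto simp: is_cusp_def\<close>)
  let ?L = "{z. leaf z}"
  have not_inner: "\<not> same_orbit z (fst (r (Suc j)))" if z: "leaf z" and r: "r \<in> rays Y" for z r j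
  proof
    assume "same_orbit z (fst (r (Suc j)))"
    then obtain g where "g \<in> G" "\<phi> g z = fst (r (Suc j))" by (auto simp: same_orbit_def)
    then have "leaf (fst (r (Suc j)))" using leaf_aut[OF z] act_aut by metis
    moreover have "fst (r j) \<in> nbrs (fst (r (Suc j)))" "fst (r (Suc (Suc j))) \<in> nbrs (fst (r (Suc j)))"
      using ray_edge[OF r, of j] ray_edge[OF r, of "Suc j"] E_sym by (auto simp: nbrs_def)
    ultimately show False using ray_no_back[OF r, of j] by (auto simp: leaf_def)
  qed
  have "vert ` ?L \<subseteq> H \<union> (\<lambda>r. vert (fst (r 0))) ` R"
  proof
    fix v assume "v \<in> vert ` ?L"
    then obtain z where z: "leaf z" "v = vert z" by auto
    then have "v \<in> verts Q" by (auto simp: verts_Q leaf_def)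
    then consider "v \<in> H" | r j where "r \<in> R" "v = vert (fst (r j))" using fin by blast
    then show "v \<in> H \<union> (\<lambda>r. vert (fst (r 0))) ` R"
    proof cases
      case (2 r j)
      have rays: "r \<in> rays Y" using 2 R by auto
      have "fst (r j) \<in> V" using ray_edge[OF rays, of j] E_V by blast
      then have "same_orbit z (fst (r j))" using vert_eq_iff[of z "fst (r j)"] z 2 by (simp add: leaf_def)
      then have "j = 0" using not_inner[OF z(1) rays] by (cases j) auto
      then show ?thesis using 2 by auto
    qed auto
  qed
  then have L: "finite (vert ` ?L)" by (rule finite_subset) (use fin(1) R(1) in simp)
  obtain D where D: "\<And>x. x \<in> V \<Longrightarrow> \<exists>n\<le>D. \<exists>z. leaf z \<and> (z, x) \<in> E ^^ n"
    using bounded_distance_to_leaf[OF assms(1) z0] by blast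
  have "vert ` V \<subseteq> (\<Union>n\<le>D. vert ` {x. \<exists>z\<in>?L. (z, x) \<in> E ^^ n})"
  proof
    fix v assume "v \<in> vert ` V"
    then obtain x where "x \<in> V" "v = vert x" by blast
    moreover from D[OF this(1)] obtain n z where "n \<le> D" "leaf z" "(z, x) \<in> E ^^ n" by blast
    ultimately show "v \<in> (\<Union>n\<le>D. vert ` {x. \<exists>z\<in>?L. (z, x) \<in> E ^^ n})"
      by (intro UN_I[of n] image_eqI[of _ _ x]) auto
  qed
  moreover have "finite (\<Union>n\<le>D. vert ` {x. \<exists>z\<in>?L. (z, x) \<in> E ^^ n})"
    by (intro finite_UN_I finite_orbits_near[OF L]) (auto simp: leaf_def)
  ultimately have "finite (vert ` V)" by (rule finite_subset)
  then obtain S where S: "S \<subseteq> V" "finite S" "vert ` V = vert ` S"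
    by (rule finite_image_representatives)
  have "(UNIV :: nat set) \<subseteq> (\<Union>s\<in>S. {j. same_orbit s (C.axis j)})"
  proof
    fix j :: nat
    have "vert (C.axis j) \<in> vert ` S" using S(3) C.axis_V by blast
    then obtain s where "s \<in> S" "vert s = vert (C.axis j)" by auto
    then show "j \<in> (\<Union>s\<in>S. {j. same_orbit s (C.axis j)})" using vert_eq_iff S(1) C.axis_V by blast
  qed
  moreover have "finite (\<Union>s\<in>S. {j. same_orbit s (C.axis j)})"
    using S(1,2) by (intro finite_UN_I C.axis_proper) auto
  ultimately have "finite (UNIV :: nat set)" by (rule finite_subset)
  then show False by simp
qed

section \<open>Cusp sections in the quotient\<close>

lemma cuspidal_rayD:
  assumes "cuspidal_ray x"
  shows "(x k, x (Suc k)) \<in> E" "x (Suc (Suc k)) \<noteq> x k" "x k \<in> V"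
    "g \<in> G \<Longrightarrow> \<phi> g (x k) = x k \<Longrightarrow> \<phi> g (x (Suc k)) = x (Suc k)"
    "(x (Suc k), z) \<in> E \<Longrightarrow> z \<noteq> x (Suc (Suc k)) \<Longrightarrow> \<exists>g\<in>G. \<phi> g (x (Suc k)) = x (Suc k) \<and> \<phi> g (x k) = z"
    "v \<in> V \<Longrightarrow> finite {k. same_orbit v (x k)}"
  using assms E_V unfolding cuspidal_ray_def by blast+

text \<open>
  If \<open>g\<close> followed \<open>y\<close> only up to some point, then the stabilizer of that point would contain an
  element moving the vertex from which the image of \<open>x\<close> arrives to the one to which it leaves. Pulled
  back to \<open>x\<close>, it fixes a vertex of \<open>x\<close>, hence also the next one, to which it moves the previous one.
\<close>

lemma cuspidal_ray_same_direction:
  assumes x: "cuspidal_ray x" and y: "cuspidal_ray y" and g: "g \<in> G" "\<phi> g (x i) = y k" "\<phi> g (x (Suc i)) = y (Suc k)"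
  shows "\<phi> g (x (i + m)) = y (k + m) \<and> \<phi> g (x (Suc (i + m))) = y (Suc (k + m))"
proof (induction m)
  case 0
  then show ?case using g by simp
next
  case (Suc m)
  let ?a = "x (i + m)" and ?b = "x (Suc (i + m))" and ?c = "x (Suc (Suc (i + m)))"
  have V: "?a \<in> V" "?b \<in> V" "?c \<in> V" using cuspidal_rayD(3)[OF x] by auto
  have "(y (Suc (k + m)), \<phi> g ?c) \<in> E"
    using Suc act_E[OF g(1) V(2,3)] cuspidal_rayD(1)[OF x, of "Suc (i + m)"] by simp
  moreover have False if ne: "\<phi> g ?c \<noteq> y (Suc (Suc (k + m)))"
  proof -
    obtain d where d: "d \<in> G" "\<phi> d (y (Suc (k + m))) = y (Suc (k + m))" "\<phi> d (y (k + m)) = \<phi> g ?c"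
      using cuspidal_rayD(5)[OF y calculation ne] by blast
    let ?h = "ginv g \<cdot> (d \<cdot> g)"
    have h: "?h \<in> G" "\<And>w. w \<in> V \<Longrightarrow> \<phi> ?h w = \<phi> (ginv g) (\<phi> d (\<phi> g w))"
      using g(1) d(1) by (simp_all add: act_mult inv_G mult_G)
    have "\<phi> ?h ?b = ?b" using h(2)[OF V(2)] Suc d act_inv[OF g(1) V(2)] by simp
    from cuspidal_rayD(4)[OF x h(1) this] have "\<phi> ?h ?c = ?c" .
    moreover have "\<phi> ?h ?a = ?c" using h(2)[OF V(1)] Suc d act_inv[OF g(1) V(3)] by simp
    ultimately have "?a = ?c" using act_inj[OF h(1) V(1,3)] by simp
    then show False using cuspidal_rayD(2)[OF x, of "i + m"] by simp
  qed
  ultimately show ?case using Suc by auto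
qed

text \<open>
  If \<open>x\<close> does not follow \<open>y\<close>, it runs down \<open>y\<close>, up to adjusting \<open>g\<close> at each step by the stabilizer of a
  vertex of \<open>y\<close>, which is transitive on the neighbours other than the next vertex.
\<close>

lemma cuspidal_ray_opposite_direction:
  assumes x: "cuspidal_ray x" and y: "cuspidal_ray y" and g: "g \<in> G" "\<phi> g (x i) = y k" "\<phi> g (x (Suc i)) \<noteq> y (Suc k)"
  shows "m < k \<Longrightarrow> \<exists>h\<in>G. \<phi> h (x (i + m)) = y (k - m) \<and> \<phi> h (x (Suc (i + m))) = y (k - Suc m)"
proof (induction m)
  case 0
  then obtain k' where k': "k = Suc k'" by (cases k) auto
  have V: "x i \<in> V" "x (Suc i) \<in> V" "y k' \<in> V" "y k \<in> V" using cuspidal_rayD(3) x y by auto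
  have "(y (Suc k'), \<phi> g (x (Suc i))) \<in> E" using act_E[OF g(1) V(1,2)] cuspidal_rayD(1)[OF x, of i] g k' by simp
  from cuspidal_rayD(5)[OF y this] g(3) k' obtain d where
    d: "d \<in> G" "\<phi> d (y (Suc k')) = y (Suc k')" "\<phi> d (y k') = \<phi> g (x (Suc i))" by blast
  have "\<phi> (ginv d \<cdot> g) (x i) = y k" "\<phi> (ginv d \<cdot> g) (x (Suc i)) = y k'"
    using d g k' V act_inv[OF d(1), of "y (Suc k')"] act_inv[OF d(1), of "y k'"] by (simp_all add: act_mult inv_G)
  then show ?case using d g k' by (intro bexI[of _ "ginv d \<cdot> g"]) (auto intro: mult_G inv_G)
next
  case (Suc m)
  then obtain h where h: "h \<in> G" "\<phi> h (x (i + m)) = y (k - m)" "\<phi> h (x (Suc (i + m))) = y (k - Suc m)" by auto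
  obtain l where l: "k - Suc m = Suc l" "k - m = Suc (Suc l)" "k - Suc (Suc m) = l"
    using Suc.prems by (metis Suc_diff_Suc Suc_lessD)
  let ?a = "x (i + m)" and ?b = "x (Suc (i + m))" and ?c = "x (Suc (Suc (i + m)))"
  have V: "?a \<in> V" "?b \<in> V" "?c \<in> V" "y l \<in> V" "y (Suc l) \<in> V" using cuspidal_rayD(3) x y by auto
  have "(y (Suc l), \<phi> h ?c) \<in> E" using act_E[OF h(1) V(2,3)] cuspidal_rayD(1)[OF x, of "Suc (i + m)"] h l by simp
  moreover have "\<phi> h ?c \<noteq> y (Suc (Suc l))"
    using act_inj[OF h(1) V(3,1)] cuspidal_rayD(2)[OF x, of "i + m"] h l by simp
  ultimately obtain d where d: "d \<in> G" "\<phi> d (y (Suc l)) = y (Suc l)" "\<phi> d (y l) = \<phi> h ?c"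
    using cuspidal_rayD(5)[OF y] by blast
  have "\<phi> (ginv d \<cdot> h) ?b = y (Suc l)" "\<phi> (ginv d \<cdot> h) ?c = y l"
    using d h l V act_inv[OF d(1) V(5)] act_inv[OF d(1) V(4)] by (simp_all add: act_mult inv_G)
  then show ?case using d h l by (intro bexI[of _ "ginv d \<cdot> h"]) (auto intro: mult_G inv_G)
qed

text \<open>
  Running in the same direction, the ray would meet one orbit periodically. Running in opposite
  directions, the two stretches meet halfway: at a vertex, whose stabilizer would move the next
  vertex of the ray to the previous one, or in an edge, which would be inverted.
\<close>

lemma cuspidal_ray_inj:
  assumes x: "cuspidal_ray x" and ij: "same_orbit (x i) (x j)"
  shows "i = j"
proof -
  have False if ij: "i < j" "same_orbit (x i) (x j)" for i j
  proof -
    obtain g where g: "g \<in> G" "\<phi> g (x i) = x j" using ij by (auto simp: same_orbit_def)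
    show False
    proof (cases "\<phi> g (x (Suc i)) = x (Suc j)")
      case True
      have shift: "same_orbit (x (i + m)) (x (j + m))" for m
        using cuspidal_ray_same_direction[OF x x g True] g by (auto simp: same_orbit_def)
      have "same_orbit (x i) (x (i + n * (j - i)))" for n
      proof (induction n)
        case (Suc n)
        have "same_orbit (x (i + n * (j - i))) (x (j + n * (j - i)))" using shift by blast
        moreover have "j + n * (j - i) = i + Suc n * (j - i)" using ij by simp
        ultimately show ?case using Suc same_orbit_trans[OF cuspidal_rayD(3)[OF x]] by metis
      qed (use same_orbit_refl[OF cuspidal_rayD(3)[OF x]] in simp)
      then have "range (\<lambda>n. i + n * (j - i)) \<subseteq> {k. same_orbit (x i) (x k)}" by auto
      then have "finite (range (\<lambda>n. i + n * (j - i)))" using cuspidal_rayD(6)[OF x cuspidal_rayD(3)[OF x]] finite_subset by blast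
      moreover have "inj (\<lambda>n. i + n * (j - i))" using ij by (auto simp: inj_def)
      ultimately show False using finite_imageD infinite_UNIV_nat by blast
    next
      case False
      note opp = cuspidal_ray_opposite_direction[OF x x g False]
      define l where "l = (j - i) div 2"
      consider "j - i = 2 * l" | "j - i = 2 * l + 1" unfolding l_def by linarith
      then show False
      proof cases
        case 1
        then have l: "l < j" "j - l = i + l" "j - Suc l = i + l - 1" "0 < l" using ij by auto
        obtain h where h: "h \<in> G" "\<phi> h (x (i + l)) = x (i + l)" "\<phi> h (x (Suc (i + l))) = x (i + l - 1)"
          using opp[OF l(1)] l by auto
        then have "x (Suc (i + l)) = x (i + l - 1)" using cuspidal_rayD(4)[OF x, of h "i + l"] by simp
        then show False using cuspidal_rayD(2)[OF x, of "i + l - 1"] l by simp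
      next
        case 2
        then have l: "l < j" "j - l = Suc (i + l)" "j - Suc l = i + l" using ij by auto
        obtain h where h: "h \<in> G" "\<phi> h (x (i + l)) = x (Suc (i + l))" "\<phi> h (x (Suc (i + l))) = x (i + l)"
          using opp[OF l(1)] l by auto
        then show False using no_inversion[OF h(1) cuspidal_rayD(1)[OF x, of "i + l"]] by blast
      qed
    qed
  qed
  from this[of i j] this[of j i] ij same_orbit_sym[OF cuspidal_rayD(3)[OF x]] show ?thesis
    by (meson linorder_neqE_nat)
qed

text \<open>
  A meeting in opposite directions leads from \<open>x i\<close> down to the orbit of \<open>y 0\<close>, which \<open>x\<close> visits only finitely
  often. So such meetings do not occur far out on \<open>x\<close>.
\<close>

lemma cuspidal_ray_disjoint:
  assumes x: "cuspidal_ray x" and y: "cuspidal_ray y"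
    and same: "\<not> (\<exists>g\<in>G. \<exists>i k. \<phi> g (x i) = y k \<and> \<phi> g (x (Suc i)) = y (Suc k))"
  shows "\<exists>J. \<forall>i\<ge>J. \<forall>k. \<not> same_orbit (x i) (y k)"
proof -
  let ?S = "{i. same_orbit (y 0) (x i)}"
  have S: "finite ?S" using cuspidal_rayD(6)[OF x cuspidal_rayD(3)[OF y]] .
  have "\<not> same_orbit (x i) (y k)" if i: "Suc (Max (insert 0 ?S)) \<le> i" for i k
  proof
    assume "same_orbit (x i) (y k)"
    then obtain g where g: "g \<in> G" "\<phi> g (x i) = y k" by (auto simp: same_orbit_def)
    then have ne: "\<phi> g (x (Suc i)) \<noteq> y (Suc k)" using same by blast
    have "same_orbit (x (i + k)) (y 0)"
    proof (cases k)
      case 0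
      then show ?thesis using g by (auto simp: same_orbit_def)
    next
      case (Suc k')
      then show ?thesis using cuspidal_ray_opposite_direction[OF x y g ne, of k'] by (auto simp: same_orbit_def)
    qed
    then have "i + k \<in> ?S" using same_orbit_sym[OF cuspidal_rayD(3)[OF x]] by simp
    then have "i + k \<le> Max (insert 0 ?S)" using S by (intro Max_ge) auto
    then show False using i by simp
  qed
  then show ?thesis by blast
qed

lemma cuspidal_ray_arc_from:
  assumes x: "cuspidal_ray x" and j: "j \<in> arcs Q" "tail Q j = vert (x (Suc n))"
  shows "j = Arc (x (Suc n)) (x (Suc (Suc n))) \<or> j = Arc (x (Suc n)) (x n)"
proof -
  obtain z where z: "(x (Suc n), z) \<in> E" "j = Arc (x (Suc n)) z" using arc_from[OF j cuspidal_rayD(3)[OF x]] by blast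
  show ?thesis
  proof (cases "z = x (Suc (Suc n))")
    case False
    from cuspidal_rayD(5)[OF x z(1) False] obtain g where g: "g \<in> G" "\<phi> g (x (Suc n)) = x (Suc n)" "\<phi> g (x n) = z" by blast
    then show ?thesis using Arc_act[OF g(1) E_sym[OF cuspidal_rayD(1)[OF x, of n]]] z by simp
  qed (use z in simp)
qed

lemma cuspidal_ray_arc_into:
  assumes x: "cuspidal_ray x" and i: "i \<in> arcs Q" "head Q i = vert (x (Suc n))"
  shows "i = Arc (x (Suc (Suc n))) (x (Suc n)) \<or> i = Arc (x n) (x (Suc n))"
proof -
  obtain z where z: "(x (Suc n), z) \<in> E" "i = Arc z (x (Suc n))" using arc_into[OF i cuspidal_rayD(3)[OF x]] by blast
  then have "Arc (x (Suc n)) z \<in> arcs Q" "tail Q (Arc (x (Suc n)) z) = vert (x (Suc n))"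
    by (simp_all add: Arc_in_arcs tail_Arc)
  from cuspidal_ray_arc_from[OF x this] show ?thesis using z edge_rev_Arc by metis
qed

lemma cuspidal_ray_weight_out:
  assumes x: "cuspidal_ray x"
  shows "edge_weight \<Gamma> \<phi> (Arc (x n) (x (Suc n))) = 1"
proof -
  have "x n \<in> V" "x (Suc n) \<in> V" using cuspidal_rayD(3)[OF x] by auto
  then have "nbr_orbit (x n) (x (Suc n)) = {x (Suc n)}"
    unfolding nbr_orbit_def using cuspidal_rayD(4)[OF x] one_G act_one by force
  then show ?thesis using edge_weight_Arc[OF cuspidal_rayD(1)[OF x, of n]] by simp
qed

lemma cuspidal_ray_weight_in:
  assumes x: "cuspidal_ray x"
  shows "edge_weight \<Gamma> \<phi> (Arc (x (Suc n)) (x n)) = card (nbrs (x (Suc n))) - 1"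
proof -
  let ?a = "x n" and ?b = "x (Suc n)" and ?c = "x (Suc (Suc n))"
  have V: "?a \<in> V" "?b \<in> V" "?c \<in> V" using cuspidal_rayD(3)[OF x] by auto
  have "nbr_orbit ?b ?a = nbrs ?b - {?c}"
  proof (intro equalityI subsetI)
    fix z assume z: "z \<in> nbr_orbit ?b ?a"
    then obtain g where g: "g \<in> G" "\<phi> g ?b = ?b" "z = \<phi> g ?a" by (auto simp: nbr_orbit_def)
    have "\<phi> g ?c = ?c" using cuspidal_rayD(4)[OF x g(1,2)] .
    then have "z \<noteq> ?c" using act_inj[OF g(1) V(1,3)] cuspidal_rayD(2)[OF x, of n] g by auto
    then show "z \<in> nbrs ?b - {?c}" using z nbr_orbit_sub[OF E_sym[OF cuspidal_rayD(1)[OF x, of n]]] by auto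
  next
    fix z assume "z \<in> nbrs ?b - {?c}"
    then show "z \<in> nbr_orbit ?b ?a" using cuspidal_rayD(5)[OF x, of n z] by (auto simp: nbr_orbit_def nbrs_def)
  qed
  moreover have "?c \<in> nbrs ?b" using cuspidal_rayD(1)[OF x, of "Suc n"] by (simp add: nbrs_def)
  ultimately show ?thesis using edge_weight_Arc[OF E_sym[OF cuspidal_rayD(1)[OF x, of n]]] by simp
qed

definition section_arcs :: "(nat \<Rightarrow> 'v) \<Rightarrow> ('v \<times> 'v) set set" where
  "section_arcs x = (\<Union>n. {Arc (x n) (x (Suc n)), Arc (x (Suc n)) (x n)})"

lemma section_arcs_shift:
  "finite (section_arcs x - section_arcs (\<lambda>n. x (a + n)))"
proof -
  have "section_arcs x - section_arcs (\<lambda>n. x (a + n)) \<subseteq> (\<Union>n<a. {Arc (x n) (x (Suc n)), Arc (x (Suc n)) (x n)})"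
  proof
    fix i assume i: "i \<in> section_arcs x - section_arcs (\<lambda>n. x (a + n))"
    then obtain n where n: "i \<in> {Arc (x n) (x (Suc n)), Arc (x (Suc n)) (x n)}" by (auto simp: section_arcs_def)
    have "n < a"
    proof (rule ccontr)
      assume "\<not> n < a"
      then have "n = a + (n - a)" by simp
      then have "i \<in> {Arc (x (a + (n - a))) (x (a + Suc (n - a))), Arc (x (a + Suc (n - a))) (x (a + (n - a)))}"
        using n by (metis add_Suc_right)
      then show False using i by (auto simp: section_arcs_def)
    qed
    then show "i \<in> (\<Union>n<a. {Arc (x n) (x (Suc n)), Arc (x (Suc n)) (x n)})" using n by blast
  qed
  then show ?thesis using finite_subset by blast
qed

definition periodic_cuspidal_ray :: "(nat \<Rightarrow> 'v) \<Rightarrow> bool" where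
  "periodic_cuspidal_ray x \<longleftrightarrow> cuspidal_ray x \<and> (\<exists>p>0. \<exists>N. \<forall>n\<ge>N. card (nbrs (x (n + p))) = card (nbrs (x n)))"

lemma periodic_cuspidal_ray_shift:
  assumes "periodic_cuspidal_ray x"
  shows "periodic_cuspidal_ray (\<lambda>n. x (a + n))"
proof -
  obtain p N where pN: "p > 0" "\<And>n. n \<ge> N \<Longrightarrow> card (nbrs (x (n + p))) = card (nbrs (x n))"
    using assms by (auto simp: periodic_cuspidal_ray_def)
  have "card (nbrs (x (a + (n + p)))) = card (nbrs (x (a + n)))" if "n \<ge> N" for n
    using pN(2)[of "a + n"] that by (simp add: add.assoc)
  then show ?thesis using pN cuspidal_ray_shift[of x a] assms unfolding periodic_cuspidal_ray_def by blast
qed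

lemma periodic_cuspidal_ray_of_cusp:
  assumes noleaf: "\<And>x. \<not> leaf x" and c: "periodic_cusp \<Gamma> \<phi> Y c" and r: "r \<in> c"
  shows "\<exists>a. periodic_cuspidal_ray (\<lambda>n. fst (r (a + n)))"
proof -
  interpret C: cusp_action \<Gamma> \<phi> Y c
    by unfold_locales (use c in \<open>auto simp: is_cusp_def periodic_cusp_def\<close>)
  have "\<exists>z. z \<noteq> y \<and> (x, z) \<in> E" if "(x, y) \<in> E" for x y
    using noleaf[of x] E_V(1)[OF that] unfolding leaf_def nbrs_def by blast
  from C.cuspidal_ray_tail[OF this r] obtain a where a: "cuspidal_ray (\<lambda>n. fst (r (a + n)))" by blast
  obtain s N p where s: "s \<in> c" "p > 0"
    "\<And>n. n \<ge> N \<Longrightarrow> card (nbrs (fst (s (n + p)))) = card (nbrs (fst (s n)))"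
    using c by (auto simp: periodic_cusp_def out_degree_eq)
  obtain a' b' where ab: "\<And>n. r (a' + n) = s (b' + n)" using C.mem_c_equiv[OF r, of s] s(1) by blast
  have "card (nbrs (fst (r (a + (n + p))))) = card (nbrs (fst (r (a + n))))" if n: "n \<ge> a' + N" for n
  proof -
    define k where "k = a + n - a'"
    have k: "a + n = a' + k" "a + (n + p) = a' + (k + p)" "N \<le> b' + k" using n by (auto simp: k_def)
    show ?thesis unfolding k(1,2) ab using s(3)[OF k(3)] by (simp add: add.assoc)
  qed
  then show ?thesis using a s(2) unfolding periodic_cuspidal_ray_def by blast
qed

text \<open>
  Start from the rays that come with a cuspidal lattice, cut down to tails with the local
  properties above, and choose a family of minimal size that still covers almost all edges. Two of
  its members never run in the same direction, because one of them would be superfluous; hence they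
  become disjoint after a further cut.
\<close>

theorem cusp_sections:
  assumes uni: "uniform Y" and cusp: "cuspidal \<Gamma> \<phi> Y"
  shows "\<exists>S. finite S \<and> (\<forall>x\<in>S. periodic_cuspidal_ray x) \<and> finite (arcs Q - (\<Union>x\<in>S. section_arcs x)) \<and>
     (\<forall>x\<in>S. \<forall>y\<in>S. \<forall>i j. same_orbit (x i) (y j) \<longrightarrow> x = y \<and> i = j)"
proof -
  let ?ok = "\<lambda>S. finite S \<and> (\<forall>x\<in>S. periodic_cuspidal_ray x) \<and> finite (arcs Q - (\<Union>x\<in>S. section_arcs x))"
  obtain H :: "('v set, ('v \<times> 'v) set) pre_digraph" and R where HR: "finite (verts H)" "finite (arcs H)" "finite R"
    "\<And>r. r \<in> R \<Longrightarrow> \<exists>c. periodic_cusp \<Gamma> \<phi> Y c \<and> r \<in> c"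
    "verts Q = verts H \<union> (\<Union>r\<in>R. \<Union>j. {vert (fst (r j))})"
    "arcs Q = arcs H \<union> (\<Union>r\<in>R. \<Union>j. {Group_Action.orbit \<Gamma> (edge_act \<phi>) (r j),
                                edge_rev (Group_Action.orbit \<Gamma> (edge_act \<phi>) (r j))})"
    using cusp unfolding cuspidal_def
  proof (elim exE conjE)
    fix H :: "('v set, ('v \<times> 'v) set) pre_digraph" and R
    assume *: "finite (verts H)" "finite (arcs H)" "finite R"
      "\<forall>r\<in>R. \<exists>c. periodic_cusp \<Gamma> \<phi> Y c \<and> r \<in> c"
      "verts Q = verts H \<union> (\<Union>r\<in>R. \<Union>j. {vert (fst (r j))})"
      "arcs Q = arcs H \<union> (\<Union>r\<in>R. \<Union>j. {Group_Action.orbit \<Gamma> (edge_act \<phi>) (r j),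
                                  edge_rev (Group_Action.orbit \<Gamma> (edge_act \<phi>) (r j))})"
    show thesis by (rule that[OF *(1-3) bspec[OF *(4)] *(5,6)])
  qed
  have rays: "r \<in> rays Y" if r: "r \<in> R" for r
  proof -
    obtain c where c: "periodic_cusp \<Gamma> \<phi> Y c" "r \<in> c" using HR(4)[OF r] by blast
    interpret C: cusp_action \<Gamma> \<phi> Y c
      by unfold_locales (use c in \<open>auto simp: is_cusp_def periodic_cusp_def\<close>)
    show ?thesis using C.mem_c_rays c by blast
  qed
  have "\<exists>a. periodic_cuspidal_ray (\<lambda>n. fst (r (a + n)))" if r: "r \<in> R" for r
  proof -
    obtain c where c: "periodic_cusp \<Gamma> \<phi> Y c" "r \<in> c" using HR(4)[OF r] by blast
    have "is_cusp \<Gamma> \<phi> Y c" using c by (simp add: periodic_cusp_def)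
    from no_leaf[OF uni this HR(3) _ HR(1,5)] have "\<not> leaf x" for x using rays by blast
    from periodic_cuspidal_ray_of_cusp[OF this c] show ?thesis .
  qed
  then obtain a where a: "\<And>r. r \<in> R \<Longrightarrow> periodic_cuspidal_ray (\<lambda>n. fst (r (a r + n)))" by metis
  let ?S0 = "(\<lambda>r n. fst (r (a r + n))) ` R"
  have "arcs Q - (\<Union>x\<in>?S0. section_arcs x) \<subseteq>
     arcs H \<union> (\<Union>r\<in>R. section_arcs (\<lambda>n. fst (r n)) - section_arcs (\<lambda>n. fst (r (a r + n))))"
  proof
    fix i assume i: "i \<in> arcs Q - (\<Union>x\<in>?S0. section_arcs x)"
    show "i \<in> arcs H \<union> (\<Union>r\<in>R. section_arcs (\<lambda>n. fst (r n)) - section_arcs (\<lambda>n. fst (r (a r + n))))"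
    proof (cases "i \<in> arcs H")
      case False
      then obtain r j where r: "r \<in> R" "i \<in> {Group_Action.orbit \<Gamma> (edge_act \<phi>) (r j),
            edge_rev (Group_Action.orbit \<Gamma> (edge_act \<phi>) (r j))}" using i HR(6) by auto
      have "r j = (fst (r j), fst (r (Suc j)))" using ray_snd[OF rays[OF r(1)], of j] by (cases "r j") auto
      then have "Group_Action.orbit \<Gamma> (edge_act \<phi>) (r j) = Arc (fst (r j)) (fst (r (Suc j)))"
        unfolding Arc_def by (rule arg_cong)
      then have "i \<in> section_arcs (\<lambda>n. fst (r n))" using r edge_rev_Arc by (auto simp: section_arcs_def)
      then show ?thesis using i r(1) by blast
    qed auto
  qed
  moreover have "finite \<dots>" using HR(2,3) section_arcs_shift by blast
  ultimately have "?ok ?S0" using HR(3) a finite_subset by blast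
  from ex_has_least_nat[of ?ok, OF this, of card]
  obtain S where S: "?ok S" "\<And>S'. ?ok S' \<Longrightarrow> card S \<le> card S'" by blast
  have cuspidal_ray: "cuspidal_ray x" if "x \<in> S" for x using S(1) that by (simp add: periodic_cuspidal_ray_def)
  have same: "\<not> (\<exists>g\<in>G. \<exists>i k. \<phi> g (x i) = y k \<and> \<phi> g (x (Suc i)) = y (Suc k))"
    if xy: "x \<in> S" "y \<in> S" "x \<noteq> y" for x y
  proof
    assume "\<exists>g\<in>G. \<exists>i k. \<phi> g (x i) = y k \<and> \<phi> g (x (Suc i)) = y (Suc k)"
    then obtain g i k where g: "g \<in> G" "\<phi> g (x i) = y k" "\<phi> g (x (Suc i)) = y (Suc k)" by blast
    have tail: "section_arcs (\<lambda>n. x (i + n)) \<subseteq> section_arcs y"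
    proof
      fix z assume "z \<in> section_arcs (\<lambda>n. x (i + n))"
      then obtain n where n: "z \<in> {Arc (x (i + n)) (x (Suc (i + n))), Arc (x (Suc (i + n))) (x (i + n))}"
        by (auto simp: section_arcs_def)
      have "Arc (x (i + n)) (x (Suc (i + n))) = Arc (y (k + n)) (y (Suc (k + n)))"
        "Arc (x (Suc (i + n))) (x (i + n)) = Arc (y (Suc (k + n))) (y (k + n))"
        using cuspidal_ray_same_direction[OF cuspidal_ray cuspidal_ray g, of n] xy
          Arc_act[OF g(1) cuspidal_rayD(1)[OF cuspidal_ray[OF xy(1)], of "i + n"]]
          Arc_act[OF g(1) E_sym[OF cuspidal_rayD(1)[OF cuspidal_ray[OF xy(1)], of "i + n"]]] by auto
      then show "z \<in> section_arcs y" using n by (auto simp: section_arcs_def)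
    qed
    have "arcs Q - (\<Union>x\<in>S - {x}. section_arcs x) \<subseteq>
        (arcs Q - (\<Union>x\<in>S. section_arcs x)) \<union> (section_arcs x - section_arcs (\<lambda>n. x (i + n)))"
      using tail xy by blast
    then have "finite (arcs Q - (\<Union>x\<in>S - {x}. section_arcs x))"
      using S(1) section_arcs_shift finite_subset by blast
    then have "?ok (S - {x})" using S(1) by blast
    then have "card S \<le> card (S - {x})" by (rule S(2))
    then show False using S(1) xy(1) by (metis card_Diff1_less not_le)
  qed
  have "\<exists>J. \<forall>x\<in>S. \<forall>y\<in>S. x \<noteq> y \<longrightarrow> (\<forall>i\<ge>J. \<forall>k. \<not> same_orbit (x i) (y k))"
  proof -
    have "\<forall>p\<in>S \<times> S. \<exists>J. fst p \<noteq> snd p \<longrightarrow> (\<forall>i\<ge>J. \<forall>k. \<not> same_orbit (fst p i) (snd p k))"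
      using cuspidal_ray_disjoint[OF cuspidal_ray cuspidal_ray same] by force
    from bchoice[OF this] obtain J where
      J: "\<And>x y i k. x \<in> S \<Longrightarrow> y \<in> S \<Longrightarrow> x \<noteq> y \<Longrightarrow> i \<ge> J (x, y) \<Longrightarrow> \<not> same_orbit (x i) (y k)" by fastforce
    have "J (x, y) \<le> Max (insert 0 (J ` (S \<times> S)))" if "x \<in> S" "y \<in> S" for x y
      using S(1) that by (intro Max_ge) auto
    then show ?thesis using J by (meson order_trans)
  qed
  then obtain J where J: "\<And>x y i k. x \<in> S \<Longrightarrow> y \<in> S \<Longrightarrow> x \<noteq> y \<Longrightarrow> i \<ge> J \<Longrightarrow> \<not> same_orbit (x i) (y k)" by blast
  let ?T = "(\<lambda>x n. x (J + n)) ` S"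
  have "arcs Q - (\<Union>x\<in>?T. section_arcs x) \<subseteq>
      (arcs Q - (\<Union>x\<in>S. section_arcs x)) \<union> (\<Union>x\<in>S. section_arcs x - section_arcs (\<lambda>n. x (J + n)))"
    by blast
  moreover have "finite \<dots>" using S(1) section_arcs_shift by blast
  ultimately have "finite (arcs Q - (\<Union>x\<in>?T. section_arcs x))" using finite_subset by blast
  moreover have "\<forall>x\<in>?T. \<forall>y\<in>?T. \<forall>i j. same_orbit (x i) (y j) \<longrightarrow> x = y \<and> i = j"
  proof (intro ballI allI impI)
    fix x' y' i j assume *: "x' \<in> ?T" "y' \<in> ?T" "same_orbit (x' i) (y' j)"
    then obtain x y where xy: "x \<in> S" "y \<in> S" "x' = (\<lambda>n. x (J + n))" "y' = (\<lambda>n. y (J + n))" by auto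
    then have "x = y" using J[of x y "J + i" "J + j"] * by auto
    moreover from this have "i = j" using cuspidal_ray_inj[OF cuspidal_ray[OF xy(1)], of "J + i" "J + j"] * xy by auto
    ultimately show "x' = y' \<and> i = j" using xy by simp
  qed
  ultimately show ?thesis using S(1) periodic_cuspidal_ray_shift by (intro exI[of _ ?T]) auto
qed

end

section \<open>The edge operator\<close>

text \<open>
  Translates the condition on cyclically consecutive letters, which is convenient for rotations and
  powers, into the condition on consecutive edges of a walk.
\<close>

lemma successively_zip_rotate1:
  assumes "p \<noteq> []"
  shows "(\<forall>(a, b)\<in>set (zip p (rotate1 p)). P a b) \<longleftrightarrow> successively P (p @ [hd p])"
proof -
  have *: "(\<forall>(a, b)\<in>set (zip (x # xs) (xs @ [z])). P a b) \<longleftrightarrow> successively P (x # xs @ [z])" for x xs z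
    by (induction xs arbitrary: x) auto
  show ?thesis using assms *[of "hd p" "tl p" "hd p"] by (cases p) auto
qed

lemma cas_iff:
  "pre_digraph.cas X x p y \<longleftrightarrow>
    (if p = [] then x = y else tail X (hd p) = x \<and> head X (last p) = y \<and>
       successively (\<lambda>a b. head X a = tail X b) p)"
proof (induction p arbitrary: x)
  case (Cons a p)
  have "pre_digraph.cas X x (a # p) y \<longleftrightarrow> tail X a = x \<and> pre_digraph.cas X (head X a) p y"
    by (rule pre_digraph.cas.simps)
  also have "\<dots> \<longleftrightarrow> tail X a = x \<and> (if p = [] then head X a = y else tail X (hd p) = head X a \<and> head X (last p) = y \<and>
      successively (\<lambda>a b. head X a = tail X b) p)"
    by (simp only: Cons.IH)
  also have "\<dots> \<longleftrightarrow> tail X (hd (a # p)) = x \<and> head X (last (a # p)) = y \<and>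
      successively (\<lambda>a b. head X a = tail X b) (a # p)"
  proof (cases p)
    case (Cons b q)
    have "tail X b = head X a \<longleftrightarrow> head X a = tail X b" by auto
    then show ?thesis using Cons by (simp only: list.simps if_False list.sel last.simps successively.simps) blast
  qed simp
  finally show ?case by (simp only: list.simps if_False)
qed (simp only: pre_digraph.cas.simps(1) if_True refl)

lemma closed_path_iff:
  assumes "wf_digraph X"
  shows "closed_path X p \<longleftrightarrow> p \<noteq> [] \<and> set p \<subseteq> arcs X \<and>
     (\<forall>(a, b)\<in>set (zip p (rotate1 p)). head X a = tail X b)"
proof (cases "p = []")
  case False
  have "(\<forall>(a, b)\<in>set (zip p (rotate1 p)). head X a = tail X b) \<longleftrightarrow>
      successively (\<lambda>a b. head X a = tail X b) p \<and> head X (last p) = tail X (hd p)"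
    unfolding successively_zip_rotate1[OF False] successively_append_iff using False by auto
  moreover have "tail X (hd p) \<in> verts X" if "set p \<subseteq> arcs X"
    using wf_digraph.tail_in_verts[OF assms, of "hd p"] that hd_in_set[OF False] by blast
  ultimately show ?thesis
    using False by (auto simp: closed_path_def pre_digraph.awalk_def cas_iff)
qed (simp add: closed_path_def)

lemma closed_path_rotate1: "wf_digraph X \<Longrightarrow> closed_path X p \<Longrightarrow> closed_path X (rotate1 p)"
  by (simp add: closed_path_iff zip_rotate1)

lemma closed_path_wpow:
  assumes "wf_digraph X" "0 < m"
  shows "closed_path X (wpow q m) \<longleftrightarrow> closed_path X q"
proof -
  have set: "set (wpow xs m) = set xs" for xs :: "'b list" using assms(2) by auto
  have set': "set (wpow xs m) = set xs" for xs :: "('b \<times> 'b) list" using assms(2) by auto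
  have "wpow q m = [] \<longleftrightarrow> q = []" using assms(2) by (auto simp: concat_eq_Nil_conv)
  then show ?thesis
    unfolding closed_path_iff[OF assms(1)] rotate1_wpow by (simp add: zip_wpow set set' del: set_concat)
qed

lemma has_net_prod_cong:
  assumes "\<And>i. i \<in> I \<Longrightarrow> f i = g i" "has_net_prod f I z"
  shows "has_net_prod g I z"
  unfolding has_net_prod_def
proof (rule Lim_transform_eventually)
  show "(prod f \<longlongrightarrow> z) (finite_subsets_at_top I)" using assms(2) by (simp add: has_net_prod_def)
  show "\<forall>\<^sub>F F in finite_subsets_at_top I. prod f F = prod g F"
    unfolding eventually_finite_subsets_at_top
    by (intro exI[of _ "{}"]) (auto intro!: prod.cong assms(1))
qed

context tree_action
begin

definition transition :: "('v \<times> 'v) set \<Rightarrow> ('v \<times> 'v) set \<Rightarrow> real" where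
  "transition i j = (if j \<in> arcs Q \<and> tail Q j = head Q i then of_int (pair_weight \<Gamma> \<phi> i j) else 0)"

lemma wf_Q: "wf_digraph Q"
proof
  fix i assume "i \<in> arcs Q"
  then obtain x y where "i = Arc x y" "(x, y) \<in> E" by (auto simp: arcs_Q)
  then show "tail Q i \<in> verts Q" "head Q i \<in> verts Q" using E_V by (auto simp: tail_Arc head_Arc verts_Q)
qed

lemma pair_weight_bounds:
  assumes "j \<in> arcs Q"
  shows "0 \<le> pair_weight \<Gamma> \<phi> i j" "pair_weight \<Gamma> \<phi> i j \<le> int (edge_weight \<Gamma> \<phi> j)"
proof -
  obtain x y where "j = Arc x y" "(x, y) \<in> E" using assms by (auto simp: arcs_Q)
  then have "1 \<le> edge_weight \<Gamma> \<phi> j" using edge_weight_bounds by simp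
  then show "0 \<le> pair_weight \<Gamma> \<phi> i j" "pair_weight \<Gamma> \<phi> i j \<le> int (edge_weight \<Gamma> \<phi> j)"
    by (auto simp: pair_weight_def)
qed

lemma transition_nonneg: "0 \<le> transition i j"
  using pair_weight_bounds by (simp add: transition_def)

lemma transition_row_sum:
  assumes \<Delta>: "\<And>x. card (nbrs x) \<le> \<Delta>" and i: "i \<in> arcs Q" and F: "finite F" "F \<subseteq> arcs Q"
  shows "(\<Sum>j\<in>F. transition i j) \<le> real (\<Delta> * \<Delta>)"
proof -
  obtain a b where ab: "i = Arc a b" "(a, b) \<in> E" using i by (auto simp: arcs_Q)
  have bV: "b \<in> V" using ab E_V by blast
  let ?S = "Arc b ` nbrs b"
  have out: "j \<in> ?S" if "transition i j \<noteq> 0" for j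
    using arc_from[of j b] that bV by (auto simp: transition_def ab head_Arc nbrs_def split: if_splits)
  have le: "transition i j \<le> real \<Delta>" if j: "j \<in> ?S" for j
  proof -
    obtain z where z: "(b, z) \<in> E" "j = Arc b z" using j by (auto simp: nbrs_def)
    have "edge_weight \<Gamma> \<phi> j \<le> \<Delta>" using edge_weight_bounds(2)[OF z(1)] \<Delta>[of b] z(2) by simp
    then have "pair_weight \<Gamma> \<phi> i j \<le> int \<Delta>" using pair_weight_bounds(2)[of j i] Arc_in_arcs z by fastforce
    then show ?thesis by (auto simp: transition_def)
  qed
  have "(\<Sum>j\<in>F. transition i j) \<le> (\<Sum>j\<in>?S. transition i j)"
  proof -
    have "(\<Sum>j\<in>F. transition i j) = (\<Sum>j\<in>F \<inter> ?S. transition i j)"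
      using F out by (intro sum.mono_neutral_right) auto
    also have "\<dots> \<le> (\<Sum>j\<in>?S. transition i j)"
      using finite_nbrs by (intro sum_mono2) (auto simp: transition_nonneg)
    finally show ?thesis .
  qed
  also have "\<dots> \<le> real (card ?S) * real \<Delta>" using le by (intro sum_bounded_above) auto
  also have "\<dots> \<le> real \<Delta> * real \<Delta>"
    using card_image_le[OF finite_nbrs, of "Arc b" b] \<Delta>[of b] by (intro mult_right_mono) auto
  finally show ?thesis by simp
qed

lemma path_weight_closed:
  assumes "closed_path Q p"
  shows "of_int (path_weight \<Gamma> \<phi> p) = cyclic_weight transition p"
proof -
  have p: "p \<noteq> []" "set p \<subseteq> arcs Q" "\<And>a b. (a, b) \<in> set (zip p (rotate1 p)) \<Longrightarrow> head Q a = tail Q b"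
    using assms closed_path_iff[OF wf_Q] by auto
  have "cyclic_weight transition p = (\<Prod>j<length p. transition (p ! j) (rotate1 p ! j))"
    unfolding cyclic_weight_def by (subst prod.list_conv_set_nth) (auto simp: atLeast0LessThan intro!: prod.cong)
  also have "\<dots> = (\<Prod>j<length p. of_int (pair_weight \<Gamma> \<phi> (p ! j) (p ! (Suc j mod length p))))"
  proof (rule prod.cong[OF refl])
    fix j assume j: "j \<in> {..<length p}"
    have eq: "rotate1 p ! j = p ! (Suc j mod length p)" using j by (simp add: nth_rotate1)
    have "(p ! j, rotate1 p ! j) \<in> set (zip p (rotate1 p))" using j by (auto simp: set_zip)
    then have "head Q (p ! j) = tail Q (rotate1 p ! j)" by (rule p(3))
    moreover have "rotate1 p ! j \<in> arcs Q" using p(2) nth_mem[of j "rotate1 p"] j by auto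
    ultimately show "transition (p ! j) (rotate1 p ! j) = of_int (pair_weight \<Gamma> \<phi> (p ! j) (p ! (Suc j mod length p)))"
      unfolding eq by (simp add: transition_def)
  qed
  finally show ?thesis by (simp add: path_weight_def)
qed

lemma cyclic_weight_not_closed:
  assumes "set p \<subseteq> arcs Q" "p \<noteq> []" "\<not> closed_path Q p"
  shows "cyclic_weight transition p = 0"
proof -
  obtain a b where ab: "(a, b) \<in> set (zip p (rotate1 p))" "head Q a \<noteq> tail Q b"
    using assms closed_path_iff[OF wf_Q, of p] by auto
  then have "transition a b = 0" by (auto simp: transition_def)
  then have "0 \<in> set (map2 transition p (rotate1 p))"
    using ab(1) by (auto intro!: image_eqI[where x = "(a, b)"])
  then show ?thesis unfolding cyclic_weight_def prod_list_zero_iff .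
qed

lemma edge_operator_eq:
  assumes "finite K" "{e. f e \<noteq> 0} \<subseteq> K"
  shows "edge_operator \<Gamma> \<phi> Y f j = (\<Sum>e\<in>K. f e * of_real (transition e j))"
proof -
  have "edge_operator \<Gamma> \<phi> Y f j = (\<Sum>e | f e \<noteq> 0. f e * of_real (transition e j))"
    unfolding edge_operator_def Let_def by (intro sum.cong refl) (auto simp: transition_def)
  also have "\<dots> = (\<Sum>e\<in>K. f e * of_real (transition e j))"
    using assms by (intro sum.mono_neutral_left) auto
  finally show ?thesis .
qed

lemma one_minus_uT_basis:
  "one_minus_uT \<Gamma> \<phi> Y u (basis i) j = char_matrix transition u i j"
proof -
  have "edge_operator \<Gamma> \<phi> Y (basis i) j = (\<Sum>e\<in>{i}. basis i e * of_real (transition e j))"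
    by (rule edge_operator_eq) (auto simp: basis_def)
  then show ?thesis by (auto simp: one_minus_uT_def char_matrix_def basis_def)
qed

lemma linear_one_minus_uT: "linear_SP (arcs Q) (one_minus_uT \<Gamma> \<phi> Y u)"
  unfolding linear_SP_def
proof (intro conjI ballI allI)
  show "one_minus_uT \<Gamma> \<phi> Y u ` S_space (arcs Q) \<subseteq> P_space (arcs Q)"
    by (auto simp: S_space_def P_space_def one_minus_uT_def edge_operator_def Let_def)
next
  fix f g :: "('v \<times> 'v) set \<Rightarrow> complex"
  assume fg: "f \<in> S_space (arcs Q)" "g \<in> S_space (arcs Q)"
  let ?K = "{e. f e \<noteq> 0} \<union> {e. g e \<noteq> 0}"
  have K: "finite ?K" using fg by (auto simp: S_space_def)
  have sub: "{e. f e + g e \<noteq> 0} \<subseteq> ?K" by auto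
  have "edge_operator \<Gamma> \<phi> Y (\<lambda>i. f i + g i) j = edge_operator \<Gamma> \<phi> Y f j + edge_operator \<Gamma> \<phi> Y g j" for j
    using edge_operator_eq[OF K, of f j] edge_operator_eq[OF K, of g j] edge_operator_eq[OF K, of "\<lambda>i. f i + g i" j]
      by (simp add: sum.distrib[symmetric] distrib_right sub)
  then show "one_minus_uT \<Gamma> \<phi> Y u (\<lambda>i. f i + g i) = (\<lambda>i. one_minus_uT \<Gamma> \<phi> Y u f i + one_minus_uT \<Gamma> \<phi> Y u g i)"
    by (auto simp: one_minus_uT_def fun_eq_iff algebra_simps)
next
  fix f :: "('v \<times> 'v) set \<Rightarrow> complex" and a
  assume f: "f \<in> S_space (arcs Q)"
  let ?K = "{e. f e \<noteq> 0}"
  have K: "finite ?K" using f by (auto simp: S_space_def)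
  have "edge_operator \<Gamma> \<phi> Y (\<lambda>i. a * f i) j = a * edge_operator \<Gamma> \<phi> Y f j" for j
    using edge_operator_eq[OF K, of f j] edge_operator_eq[OF K, of "\<lambda>i. a * f i" j]
    by (auto simp: sum_distrib_left mult.assoc)
  then show "one_minus_uT \<Gamma> \<phi> Y u (\<lambda>i. a * f i) = (\<lambda>i. a * one_minus_uT \<Gamma> \<phi> Y u f i)"
    by (auto simp: one_minus_uT_def fun_eq_iff algebra_simps)
qed

text \<open>
  The outward and inward edges of the disjoint cusp sections satisfy the transition rules by the
  local structure at the vertices of a cuspidal ray: the only edges at such a vertex are, up to the group, the
  one leading on and the one leading back.
\<close>

lemma exists_cusp_weights:
  assumes uni: "uniform Y" and cusp: "cuspidal \<Gamma> \<phi> Y"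
  shows "\<exists>B F1 S. \<exists>e f :: (nat \<Rightarrow> 'v) \<Rightarrow> nat \<Rightarrow> ('v \<times> 'v) set. cusp_weights (arcs Q) transition B F1 S e f"
proof -
  obtain \<Delta> where \<Delta>: "\<And>x. card (nbrs x) \<le> \<Delta>" using bounded_valency[OF uni] by blast
  obtain S where S: "finite S" "\<And>x. x \<in> S \<Longrightarrow> periodic_cuspidal_ray x" "finite (arcs Q - (\<Union>x\<in>S. section_arcs x))"
     and inj: "\<And>x y i j. x \<in> S \<Longrightarrow> y \<in> S \<Longrightarrow> same_orbit (x i) (y j) \<Longrightarrow> x = y \<and> i = j"
    using cusp_sections[OF uni cusp] by metis
  define e where "e x n = Arc (x n) (x (Suc n))" for x :: "nat \<Rightarrow> 'v" and n
  define f where "f x n = Arc (x (Suc n)) (x n)" for x :: "nat \<Rightarrow> 'v" and n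
  define F1 where "F1 = arcs Q - (\<Union>x\<in>S. range (\<lambda>n. e x (Suc n)) \<union> range (\<lambda>n. f x (Suc n)))"
  have cuspidal_ray: "cuspidal_ray x" if "x \<in> S" for x using S(2)[OF that] by (simp add: periodic_cuspidal_ray_def)
  have xV: "x n \<in> V" if "x \<in> S" for x n using cuspidal_rayD(3)[OF cuspidal_ray[OF that]] .
  have arcs: "e x n \<in> arcs Q" "f x n \<in> arcs Q" if "x \<in> S" for x n
    using cuspidal_rayD(1)[OF cuspidal_ray[OF that], of n] by (auto simp: e_def f_def intro: Arc_in_arcs E_sym)
  have ends: "tail Q (e x n) = vert (x n)" "head Q (e x n) = vert (x (Suc n))"
    "tail Q (f x n) = vert (x (Suc n))" "head Q (f x n) = vert (x n)" for x n
    by (simp_all add: e_def f_def tail_Arc head_Arc)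
  have rev: "edge_rev (e x n) = f x n" "edge_rev (f x n) = e x n" for x n
    by (simp_all add: e_def f_def edge_rev_Arc)
  have vert_inj: "x = y \<and> m = n" if "x \<in> S" "y \<in> S" "vert (x m) = vert (y n)" for x y m n
    using inj[of x y m n] vert_eq_iff[of "x m" "y n"] that xV by blast
  have e_inj: "x = y \<and> m = n" if "x \<in> S" "y \<in> S" "e x m = e y n" for x y m n
    using vert_inj[of x y m n] that ends by metis
  have f_inj: "x = y \<and> m = n" if "x \<in> S" "y \<in> S" "f x m = f y n" for x y m n
    using vert_inj[of x y m n] that ends by metis
  have e_f: "e x m \<noteq> f y n" if "x \<in> S" "y \<in> S" for x y m n
  proof
    assume "e x m = f y n"
    then have "vert (x m) = vert (y (Suc n))" "vert (x (Suc m)) = vert (y n)" using ends by metis+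
    then show False using vert_inj[of x y m "Suc n"] vert_inj[of x y "Suc m" n] that by auto
  qed
  have we: "edge_weight \<Gamma> \<phi> (e x n) = 1" if "x \<in> S" for x n
    using cuspidal_ray_weight_out[OF cuspidal_ray[OF that]] by (simp add: e_def)
  have wf: "edge_weight \<Gamma> \<phi> (f x n) = card (nbrs (x (Suc n))) - 1" if "x \<in> S" for x n
    using cuspidal_ray_weight_in[OF cuspidal_ray[OF that]] by (simp add: f_def)
  have back_e: "transition (f x n) (e x n) = 0" if "x \<in> S" for x n
    using we[OF that] by (simp add: transition_def pair_weight_def rev)
  have out_of: "j = e x (Suc n) \<or> j = f x n" if "x \<in> S" "j \<in> arcs Q" "tail Q j = vert (x (Suc n))" for x j n
    using cuspidal_ray_arc_from[OF cuspidal_ray[OF that(1)] that(2,3)] by (simp add: e_def f_def)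
  have into: "i = f x (Suc n) \<or> i = e x n" if "x \<in> S" "i \<in> arcs Q" "head Q i = vert (x (Suc n))" for x i n
    using cuspidal_ray_arc_into[OF cuspidal_ray[OF that(1)] that(2,3)] by (simp add: e_def f_def)
  have twD: "j \<in> arcs Q \<and> tail Q j = head Q i" if "transition i j \<noteq> 0" for i j
    using that by (auto simp: transition_def split: if_splits)
  have "cusp_weights (arcs Q) transition (real (\<Delta> * \<Delta>) + 1) F1 S e f"
  proof
    show "(\<Sum>j\<in>F. transition i j) \<le> real (\<Delta> * \<Delta>) + 1" if "i \<in> arcs Q" "finite F" "F \<subseteq> arcs Q" for i F
      using transition_row_sum[OF \<Delta> that] by simp
    show "0 < real (\<Delta> * \<Delta>) + 1"
      by (rule add_nonneg_pos) (rule of_nat_0_le_iff, rule zero_less_one)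
    show "finite F1"
    proof (rule finite_subset)
      show "F1 \<subseteq> (arcs Q - (\<Union>x\<in>S. section_arcs x)) \<union> (\<Union>x\<in>S. {e x 0, f x 0})"
      proof
        fix i assume i: "i \<in> F1"
        show "i \<in> (arcs Q - (\<Union>x\<in>S. section_arcs x)) \<union> (\<Union>x\<in>S. {e x 0, f x 0})"
        proof (cases "i \<in> (\<Union>x\<in>S. section_arcs x)")
          case True
          then obtain x n where x: "x \<in> S" "i = e x n \<or> i = f x n" by (auto simp: section_arcs_def e_def f_def)
          then show ?thesis using i by (cases n) (auto simp: F1_def)
        qed (use i in \<open>auto simp: F1_def\<close>)
      qed
    qed (use S in auto)
    show "arcs Q = F1 \<union> (\<Union>x\<in>S. range (\<lambda>n. e x (Suc n)) \<union> range (\<lambda>n. f x (Suc n)))"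
      using arcs by (auto simp: F1_def)
    show "e x 0 \<in> F1" "f x 0 \<in> F1" if "x \<in> S" for x
    proof -
      have "e x 0 \<noteq> e y (Suc n)" "e x 0 \<noteq> f y (Suc n)" "f x 0 \<noteq> f y (Suc n)" "f x 0 \<noteq> e y (Suc n)"
        if "y \<in> S" for y n
        using e_inj[of x y 0 "Suc n"] f_inj[of x y 0 "Suc n"] e_f[of x y 0 "Suc n"] e_f[of y x "Suc n" 0]
          that \<open>x \<in> S\<close> by auto
      then show "e x 0 \<in> F1" "f x 0 \<in> F1" using arcs[OF that] unfolding F1_def by blast+
    qed
    show "e x (Suc n) \<notin> F1" "f x (Suc n) \<notin> F1" if "x \<in> S" for x n
      using that by (auto simp: F1_def)
    show "transition (e x n) (e x (Suc n)) = 1" if "x \<in> S" for x n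
      using that arcs we e_f[OF that that] by (simp add: transition_def ends pair_weight_def rev)
    show "j = e x (Suc (Suc n)) \<or> j = f x (Suc n)" if "x \<in> S" "j \<in> arcs Q" "transition (e x (Suc n)) j \<noteq> 0" for x n j
      using out_of[of x j "Suc n"] twD[OF that(3)] that by (simp add: ends)
    show "j = f x n" if "x \<in> S" "j \<in> arcs Q" "transition (f x (Suc n)) j \<noteq> 0" for x n j
      using out_of[of x j n] twD[OF that(3)] that back_e[of x "Suc n"] by (auto simp: ends)
    show "i = e x n" if "x \<in> S" "i \<in> arcs Q" "transition i (e x (Suc n)) \<noteq> 0" for x n i
      using into[of x i n] twD[OF that(3)] that back_e[of x "Suc n"] by (auto simp: ends)
    show "i = e x (Suc n) \<or> i = f x (Suc (Suc n))" if "x \<in> S" "i \<in> arcs Q" "transition i (f x (Suc n)) \<noteq> 0" for x n i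
      using into[of x i "Suc n"] twD[OF that(3)] that by (auto simp: ends)
    show "\<exists>p>0. \<exists>N. \<forall>n\<ge>N. transition (e x (n + p)) (f x (n + p)) = transition (e x n) (f x n) \<and>
        transition (f x (Suc (n + p))) (f x (n + p)) = transition (f x (Suc n)) (f x n)" if x: "x \<in> S" for x
    proof -
      obtain p N where pN: "p > 0" "\<And>n. n \<ge> N \<Longrightarrow> card (nbrs (x (n + p))) = card (nbrs (x n))"
        using S(2)[OF x] by (auto simp: periodic_cuspidal_ray_def)
      have 1: "transition (e x n) (f x n) = of_int (int (card (nbrs (x (Suc n))) - 1) - 1)" for n
        using arcs[OF x] wf[OF x] by (simp add: transition_def ends pair_weight_def rev)
      have 2: "transition (f x (Suc n)) (f x n) = of_int (int (card (nbrs (x (Suc n))) - 1))" for n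
        using arcs[OF x] wf[OF x] e_f[OF x x] by (simp add: transition_def ends pair_weight_def rev not_sym)
      have "card (nbrs (x (Suc (n + p)))) = card (nbrs (x (Suc n)))" if "n \<ge> N" for n
        using pN(2)[of "Suc n"] that by simp
      then show ?thesis using pN(1) unfolding 1 2 by (intro exI[of _ p] conjI exI[of _ N]) auto
    qed
  qed (use S transition_nonneg e_inj f_inj e_f in \<open>auto simp: F1_def\<close>)
  then show ?thesis by blast
qed

end

theorem theorem4p3:
  fixes \<Gamma> :: "('g, 'm) monoid_scheme"
    and \<phi> :: "'g \<Rightarrow> 'v \<Rightarrow> 'v"
    and Y :: "'v pair_pre_digraph"
  assumes "tree_lattice \<Gamma> \<phi> Y"
    and "uniform Y"
    and "orientation_preserving \<Gamma> \<phi> Y"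
    and "cuspidal \<Gamma> \<phi> Y"
  defines "X \<equiv> quotient_graph \<Gamma> \<phi> Y"
  shows "\<exists>r>0.
    (\<forall>u::complex. cmod u < r \<longrightarrow>
       strong_det_class (arcs X) (one_minus_uT \<Gamma> \<phi> Y u) \<and>
       det_class (arcs X) (one_minus_uT \<Gamma> \<phi> Y u) \<and>
       has_net_prod (zeta_factor \<Gamma> \<phi> u) (prime_cycles X) (bass_ihara_zeta \<Gamma> \<phi> Y u) \<and>
       inverse (bass_ihara_zeta \<Gamma> \<phi> Y u) = net_det (arcs X) (one_minus_uT \<Gamma> \<phi> Y u)) \<and>
    (\<exists>p q :: complex poly. \<forall>u. cmod u < r \<longrightarrow>
       poly q u \<noteq> 0 \<and>
       net_det (arcs X) (one_minus_uT \<Gamma> \<phi> Y u) = poly p u / poly q u)"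
proof -
  interpret T: tree_action \<Gamma> \<phi> Y
    by unfold_locales (use assms in \<open>auto simp: tree_lattice_def\<close>)
  obtain B F1 S and e f :: "(nat \<Rightarrow> 'v) \<Rightarrow> nat \<Rightarrow> ('v \<times> 'v) set"
    where "cusp_weights (arcs X) T.transition B F1 S e f"
    using T.exists_cusp_weights[OF assms(2,4)] unfolding X_def by blast
  then interpret W: cusp_weights "arcs X" T.transition B F1 S e f .
  \<comment> \<open>Any \<open>r \<le> 1\<close> with \<open>r * B < 1\<close> would do.\<close>
  define r where "r = 1 / (B + 1)"
  have r: "0 < r" "r \<le> 1" "r * B < 1" using W.B_pos by (auto simp: r_def field_simps)
  have lin: "linear_SP (arcs X) (one_minus_uT \<Gamma> \<phi> Y u)" for u
    unfolding X_def by (rule T.linear_one_minus_uT)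
  note bas = T.one_minus_uT_basis
  have main: "strong_det_class (arcs X) (one_minus_uT \<Gamma> \<phi> Y u) \<and>
       det_class (arcs X) (one_minus_uT \<Gamma> \<phi> Y u) \<and>
       has_net_prod (zeta_factor \<Gamma> \<phi> u) (prime_cycles X) (bass_ihara_zeta \<Gamma> \<phi> Y u) \<and>
       inverse (bass_ihara_zeta \<Gamma> \<phi> Y u) = net_det (arcs X) (one_minus_uT \<Gamma> \<phi> Y u)"
    if u: "cmod u < r" for u
  proof -
    have "cmod u * B \<le> r * B" using u W.B_pos by (intro mult_right_mono) auto
    then have uB: "cmod u * B < 1" using r by simp
    let ?L = "\<Sum>\<^sub>\<infinity>p\<in>W.closed_words (arcs X). W.cyc_term u p"
    let ?C = "{p. closed_path X p}"
    have wfX: "wf_digraph X" unfolding X_def by (rule T.wf_Q)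
    have P: "prime_cycles X = {c. (\<exists>p\<in>?C. c = cyclic_class p) \<and> \<not> (\<exists>q m. q \<in> ?C \<and> 2 \<le> m \<and> c = cyclic_class (wpow q m))}"
      by (auto simp: prime_cycles_def graph_cycles_def)
    have prod: "has_net_prod (\<lambda>c. inverse (1 - of_real (cyclic_weight T.transition (SOME p. p \<in> c)) * u ^ length (SOME p. p \<in> c)))
        (prime_cycles X) (exp ?L)"
    proof (rule W.has_net_prod_primes[OF _ _ _ _ uB P])
      show "?C \<subseteq> W.closed_words (arcs X)" by (auto simp: closed_path_iff[OF wfX] W.closed_words_def)
      show "rotate1 p \<in> ?C" if "p \<in> ?C" for p using closed_path_rotate1[OF wfX] that by simp
      show "wpow q m \<in> ?C \<longleftrightarrow> q \<in> ?C" if "0 < m" for q m using closed_path_wpow[OF wfX that] by simp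
      show "cyclic_weight T.transition p = 0" if "p \<in> W.closed_words (arcs X)" "p \<notin> ?C" for p
        using T.cyclic_weight_not_closed that by (auto simp: W.closed_words_def X_def)
    qed
    have zeta: "has_net_prod (zeta_factor \<Gamma> \<phi> u) (prime_cycles X) (exp ?L)"
    proof (rule has_net_prod_cong[OF _ prod])
      fix c assume c: "c \<in> prime_cycles X"
      define p where "p = (SOME p. p \<in> c)"
      obtain q where q: "closed_path X q" "c = cyclic_class q" using c by (auto simp: P)
      then have "p \<in> c" unfolding p_def using cyclic_class_self by (metis someI)
      then obtain k where "p = rotate k q" using q by (auto simp: cyclic_class_def)
      then have "closed_path X p" using q(1) closed_path_rotate1[OF wfX]
        by (induction k arbitrary: p) auto
      then have "of_int (path_weight \<Gamma> \<phi> p) = cyclic_weight T.transition p" using T.path_weight_closed by (simp add: X_def)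
      then have "(of_int (path_weight \<Gamma> \<phi> p) :: complex) = of_real (cyclic_weight T.transition p)" by (metis of_real_of_int_eq)
      then show "inverse (1 - of_real (cyclic_weight T.transition (SOME p. p \<in> c)) * u ^ length (SOME p. p \<in> c)) = zeta_factor \<Gamma> \<phi> u c"
        by (simp add: zeta_factor_def cycle_weight_def cycle_length_def p_def)
    qed
    have Z: "bass_ihara_zeta \<Gamma> \<phi> Y u = exp ?L"
      using net_prod_eqI[OF zeta] by (simp add: bass_ihara_zeta_def X_def)
    have "inverse (bass_ihara_zeta \<Gamma> \<phi> Y u) = net_det (arcs X) (one_minus_uT \<Gamma> \<phi> Y u)"
      unfolding Z W.det_class_of_char_matrix(2)[OF lin bas uB] by (simp add: exp_minus)
    then show ?thesis
      using W.strong_det_class_of_char_matrix[OF lin bas uB] W.det_class_of_char_matrix(1)[OF lin bas uB] zeta Z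
      by simp
  qed
  have "rational_on r (\<lambda>u. net_det (arcs X) (one_minus_uT \<Gamma> \<phi> Y u))"
    by (rule W.rational_on_net_det[OF r(3,1,2) lin bas])
  then show ?thesis using main r(1) unfolding rational_on_def by blast
qed

end
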